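(* Let $d\ge 2$ and let $\Omega\subset\mathbb{R}^d$ be an open set with compact Lipschitz boundary. There is a constant $C>0$ depending only on $d$ and $\Omega$ such that $$\|u\|_{L^{d/(d-1)}(\Omega)}\le C\left(|Du|(\Omega)+\|u\|_{L^1(\Omega)}\right)$$ for all $u\in\mathrm{BV}(\Omega)$.
   Context: $\mathrm{BV}(\Omega)$ is the space of integrable functions $u$ on $\Omega$ whose distributional gradient $Du$ is a finite ($\mathbb{R}^d$-valued) Radon measure in $\Omega$; $|Du|$ is its total variation measure. *)

theory Defs
  imports "HOL-Analysis.Analysis"
begin

text \<open>The hyperplane orthogonal to \<open>e\<close> plays the role of
  \<open>\<real>\<^sup>d\<^sup>-\<^sup>1\<close>, and \<open>(y - (y \<bullet> e) *\<^sub>R e, y \<bullet> e)\<close> are the coordinates of \<open>y\<close> in an orthonormal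
  system whose last axis is \<open>e\<close>.  Neither \<open>\<Omega>\<close> nor its boundary needs to be bounded here.\<close>

definition lipschitz_boundary :: "'a::euclidean_space set \<Rightarrow> bool" where
  "lipschitz_boundary \<Omega> \<longleftrightarrow>
    (\<forall>x\<in>frontier \<Omega>. \<exists>r>0. \<exists>e \<gamma> L. norm e = 1 \<and> L-lipschitz_on {z. z \<bullet> e = 0} \<gamma> \<and>
       \<Omega> \<inter> ball x r = {y \<in> ball x r. \<gamma> (y - (y \<bullet> e) *\<^sub>R e) < y \<bullet> e})"

primrec continuously_differentiable :: "nat \<Rightarrow> ('a::euclidean_space \<Rightarrow> real) \<Rightarrow> bool" where
  "continuously_differentiable 0 f \<longleftrightarrow> continuous_on UNIV f"
| "continuously_differentiable (Suc k) f \<longleftrightarrow> f differentiable_on UNIV \<and>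
     (\<forall>i\<in>Basis. continuously_differentiable k (\<lambda>x. frechet_derivative f (at x) i))"

text \<open>The space \<open>C\<^sub>c\<^sup>\<infinity>(\<Omega>)\<close>; its elements are extended by zero to the whole space.\<close>

definition test_functions :: "'a::euclidean_space set \<Rightarrow> ('a \<Rightarrow> real) set" where
  "test_functions \<Omega> = {\<phi>. (\<forall>k. continuously_differentiable k \<phi>) \<and>
     compact (closure {x. \<phi> x \<noteq> 0}) \<and> closure {x. \<phi> x \<noteq> 0} \<subseteq> \<Omega>}"

text \<open>Vector-valued measures on the sigma-algebra of \<open>M\<close>; the measure carried by \<open>M\<close> is irrelevant.
  Being defined everywhere with values in a normed space, they are finite, and on the Borel sets of
  an open subset of a Euclidean space a finite measure is automatically Radon.\<close>

definition vector_measure :: "'a measure \<Rightarrow> ('a set \<Rightarrow> 'b::real_normed_vector) \<Rightarrow> bool" where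
  "vector_measure M \<mu> \<longleftrightarrow>
    (\<forall>A. range A \<subseteq> sets M \<longrightarrow> disjoint_family A \<longrightarrow> (\<lambda>n::nat. \<mu> (A n)) sums \<mu> (\<Union>n. A n))"

definition total_variation ::
    "'a measure \<Rightarrow> ('a set \<Rightarrow> 'b::real_normed_vector) \<Rightarrow> 'a set \<Rightarrow> ennreal" where
  "total_variation M \<mu> E =
    (SUP A \<in> {A :: nat \<Rightarrow> 'a set. range A \<subseteq> sets M \<and> disjoint_family A \<and> (\<Union>n. A n) = E}.
       \<Sum>n. ennreal (norm (\<mu> (A n))))"

text \<open>Jordan decomposition of a real-valued measure: \<open>\<nu>\<^sup>\<plusminus> = (|\<nu>| \<plusminus> \<nu>) / 2\<close>.\<close>

definition positive_part :: "'a measure \<Rightarrow> ('a set \<Rightarrow> real) \<Rightarrow> 'a measure" where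
  "positive_part M \<nu> = measure_of (space M) (sets M)
     (\<lambda>E. ennreal ((enn2real (total_variation M \<nu> E) + \<nu> E) / 2))"

definition negative_part :: "'a measure \<Rightarrow> ('a set \<Rightarrow> real) \<Rightarrow> 'a measure" where
  "negative_part M \<nu> = measure_of (space M) (sets M)
     (\<lambda>E. ennreal ((enn2real (total_variation M \<nu> E) - \<nu> E) / 2))"

definition signed_integral :: "'a measure \<Rightarrow> ('a set \<Rightarrow> real) \<Rightarrow> ('a \<Rightarrow> real) \<Rightarrow> real" where
  "signed_integral M \<nu> f =
     integral\<^sup>L (positive_part M \<nu>) f - integral\<^sup>L (negative_part M \<nu>) f"

definition is_distributional_gradient ::
    "'a::euclidean_space set \<Rightarrow> ('a \<Rightarrow> real) \<Rightarrow> ('a set \<Rightarrow> 'a) \<Rightarrow> bool" where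
  "is_distributional_gradient \<Omega> u \<mu> \<longleftrightarrow>
     vector_measure (restrict_space borel \<Omega>) \<mu> \<and>
     (\<forall>\<phi>\<in>test_functions \<Omega>. \<forall>i\<in>Basis.
        (\<integral>x. u x * frechet_derivative \<phi> (at x) i \<partial>lebesgue_on \<Omega>) =
        - signed_integral (restrict_space borel \<Omega>) (\<lambda>E. \<mu> E \<bullet> i) \<phi>)"

definition BV :: "'a::euclidean_space set \<Rightarrow> ('a \<Rightarrow> real) set" where
  "BV \<Omega> = {u. integrable (lebesgue_on \<Omega>) u \<and> (\<exists>\<mu>. is_distributional_gradient \<Omega> u \<mu>)}"

text \<open>For \<open>u \<in> BV \<Omega>\<close> the gradient is uniquely determined on the Borel subsets of the open set
  \<open>\<Omega>\<close>; the choice only concerns its irrelevant values on other sets.\<close>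

definition distributional_gradient ::
    "'a::euclidean_space set \<Rightarrow> ('a \<Rightarrow> real) \<Rightarrow> 'a set \<Rightarrow> 'a" where
  "distributional_gradient \<Omega> u = (SOME \<mu>. is_distributional_gradient \<Omega> u \<mu>)"

text \<open>\<open>gradient_variation \<Omega> u E\<close> is \<open>|Du|(E)\<close> for Borel sets \<open>E \<subseteq> \<Omega>\<close>.\<close>

definition gradient_variation ::
    "'a::euclidean_space set \<Rightarrow> ('a \<Rightarrow> real) \<Rightarrow> 'a set \<Rightarrow> ennreal" where
  "gradient_variation \<Omega> u =
     total_variation (restrict_space borel \<Omega>) (distributional_gradient \<Omega> u)"

definition Lp_norm :: "real \<Rightarrow> 'a::euclidean_space set \<Rightarrow> ('a \<Rightarrow> real) \<Rightarrow> ennreal" where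
  "Lp_norm p \<Omega> u =
    (let I = \<integral>\<^sup>+ x. ennreal (\<bar>u x\<bar> powr p) \<partial>lebesgue_on \<Omega>
     in if I = \<infinity> then \<infinity> else ennreal (enn2real I powr (1 / p)))"

end

theory Submission
  imports Defs
begin

text \<open>No extension operator is needed.  Near a boundary point \<open>\<Omega>\<close> is the epigraph of a Lipschitz function,
  hence stable under translation by an open cone, which contains a basis of directions.  For a function
  \<open>f\<close> on such a domain \<open>G\<close>, mollified with a kernel supported in the cone, Gagliardo's argument is run on a
  lattice of mesh \<open>h\<close> spanned by these directions: the value at a node is at most the sum of the increments
  along any of the lattice half-lines starting there, all of which stay in \<open>G\<close>, and by duality the increments
  in one direction sum up to at most a constant times \<open>h\<close> times the variation.  The discrete Loomis--Whitney
  inequality bounds the sum of the \<open>d / (d - 1)\<close>-th powers over the lattice; one averages over the translates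
  of the lattice and lets \<open>h\<close> tend to \<open>0\<close>.

  In general \<open>u\<close> is multiplied by smooth cutoff functions, which costs \<open>\<parallel>u\<parallel>\<^sub>1\<close>.  The compact boundary is covered by
  finitely many charts, and the function which remains away from the boundary is extended by zero to the
  whole space.  The gradient measure only enters through the bound of \<open>\<integral> u \<partial>\<^sub>i\<phi>\<close> by a multiple of
  \<open>|Du|(\<Omega>) sup |\<phi>|\<close>.\<close>

section \<open>Smooth functions\<close>

text \<open>Mesh and kernel width are the same \<open>h\<close> on purpose. Kernels around different
  nodes then have disjoint supports, so a single signed sum of them is a test function of size at
  most 1, and the sum of all increments in one direction is one pairing with the gradient. Only
  increments of the mollified function are estimated, never its derivatives. Half-lines suffice
  because the mollified function has bounded support: a value is recovered by telescoping from a
  node outwards to 0, moving only in directions that point into the domain. Boundary values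
  therefore never enter. Two features of the domain shape the localization. A test function on a
  chart domain need not be supported in \<open>\<Omega>\<close>, so it is first multiplied by the
  cutoff. And \<open>\<Omega>\<close> may be unbounded although its boundary is compact, so the
  cutoffs come in sequences whose derivative bounds and lower bounds are uniform.\<close>

definition smooth :: "('a::euclidean_space \<Rightarrow> real) \<Rightarrow> bool" where
  "smooth f \<longleftrightarrow> (\<forall>k. continuously_differentiable k f)"

abbreviation partial_deriv :: "('a::euclidean_space \<Rightarrow> real) \<Rightarrow> 'a \<Rightarrow> 'a \<Rightarrow> real" where
  "partial_deriv f i x \<equiv> frechet_derivative f (at x) i"

lemma continuously_differentiable_SucI:
  assumes "\<And>x. (f has_derivative f' x) (at x)"
    and "\<And>i. i \<in> Basis \<Longrightarrow> continuously_differentiable k (\<lambda>x. f' x i)"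
  shows "continuously_differentiable (Suc k) f"
proof -
  have "frechet_derivative f (at x) = f' x" for x
    using frechet_derivative_at[OF assms(1)[of x]] by simp
  moreover have "f differentiable_on UNIV"
    using assms(1) by (auto simp: differentiable_on_def differentiable_def)
  ultimately show ?thesis
    using assms(2) by simp
qed

lemma continuously_differentiable_SucD:
  assumes "continuously_differentiable (Suc k) f"
  shows "(f has_derivative frechet_derivative f (at x)) (at x)"
    and "i \<in> Basis \<Longrightarrow> continuously_differentiable k (partial_deriv f i)"
  using assms by (auto simp: differentiable_on_def frechet_derivative_works)

lemma continuously_differentiable_mono_Suc:
  "continuously_differentiable (Suc k) f \<Longrightarrow> continuously_differentiable k f"
proof (induction k arbitrary: f)
  case 0
  then show ?case
    by (simp add: differentiable_imp_continuous_on)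
next
  case (Suc k)
  then show ?case
    using continuously_differentiable.simps(2) by blast
qed

lemma continuously_differentiable_imp_continuous:
  "continuously_differentiable k f \<Longrightarrow> continuous_on UNIV f"
  by (cases k) (auto simp: differentiable_imp_continuous_on)

lemma continuously_differentiable_const: "continuously_differentiable k (\<lambda>_. c)"
proof (induction k arbitrary: c)
  case (Suc k)
  show ?case
    by (rule continuously_differentiable_SucI[where f' = "\<lambda>_ _. 0"]) (use Suc in auto)
qed simp

lemma continuously_differentiable_add:
  "continuously_differentiable k f \<Longrightarrow> continuously_differentiable k g \<Longrightarrow>
    continuously_differentiable k (\<lambda>x. f x + g x)"
proof (induction k arbitrary: f g)
  case 0
  then show ?case by (simp add: continuous_on_add)
next
  case (Suc k)
  note D = continuously_differentiable_SucD[OF Suc.prems(1)] continuously_differentiable_SucD[OF Suc.prems(2)]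
  show ?case
    by (rule continuously_differentiable_SucI[OF has_derivative_add[OF D(1) D(3)]])
       (use Suc.IH D in auto)
qed

lemma continuously_differentiable_mult:
  "continuously_differentiable k f \<Longrightarrow> continuously_differentiable k g \<Longrightarrow>
    continuously_differentiable k (\<lambda>x. f x * g x)"
proof (induction k arbitrary: f g)
  case 0
  then show ?case by (simp add: continuous_on_mult)
next
  case (Suc k)
  note D = continuously_differentiable_SucD[OF Suc.prems(1)] continuously_differentiable_SucD[OF Suc.prems(2)]
  show ?case
    by (rule continuously_differentiable_SucI[OF has_derivative_mult[OF D(1) D(3)]])
       (intro continuously_differentiable_add Suc.IH D Suc.prems[THEN continuously_differentiable_mono_Suc])
qed

lemma continuously_differentiable_compose:
  fixes f :: "real \<Rightarrow> real"
  shows "continuously_differentiable k f \<Longrightarrow> continuously_differentiable k g \<Longrightarrow>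
    continuously_differentiable k (\<lambda>x. f (g x))"
proof (induction k arbitrary: f g)
  case 0
  then show ?case
    by (auto intro: continuous_on_compose2)
next
  case (Suc k)
  note D = continuously_differentiable_SucD[OF Suc.prems(1)] continuously_differentiable_SucD[OF Suc.prems(2)]
  \<comment> \<open>The only basis vector of the reals is \<open>1\<close>, so by linearity the
    derivative in direction \<open>s\<close> is \<open>s\<close> times a function of
    \<open>t\<close> to which the induction hypothesis applies.\<close>
  have lin: "frechet_derivative f (at t) s = s * partial_deriv f 1 t" for t s
    using linear_cmul[OF has_derivative_linear[OF D(1)[of t]], of s 1] by simp
  show ?case
  proof (rule continuously_differentiable_SucI[OF has_derivative_compose[OF D(3) D(1)]])
    fix i :: 'a assume "i \<in> Basis"
    then have "continuously_differentiable k (\<lambda>x. partial_deriv g i x * partial_deriv f 1 (g x))"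
      using Suc.IH[OF D(2) Suc.prems(2)[THEN continuously_differentiable_mono_Suc], of 1] D(4)
      by (intro continuously_differentiable_mult) simp_all
    then show "continuously_differentiable k (\<lambda>x. frechet_derivative f (at (g x)) (frechet_derivative g (at x) i))"
      by (simp only: lin[of _ "frechet_derivative g (at _) i"])
  qed
qed

lemma continuously_differentiable_affine:
  "continuously_differentiable k f \<Longrightarrow> continuously_differentiable k (\<lambda>x. f (c *\<^sub>R x + a))"
proof (induction k arbitrary: f)
  case 0
  then show ?case
    by (auto intro!: continuous_on_compose2[of UNIV f] continuous_intros)
next
  case (Suc k)
  note D = continuously_differentiable_SucD[OF Suc.prems(1)]
  have "((\<lambda>x. f (c *\<^sub>R x + a)) has_derivative (\<lambda>h. frechet_derivative f (at (c *\<^sub>R x + a)) (c *\<^sub>R h))) (at x)" for x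
    by (rule has_derivative_compose[OF _ D(1)]) (auto intro!: derivative_eq_intros)
  then show ?case
  proof (rule continuously_differentiable_SucI)
    fix i :: 'a assume "i \<in> Basis"
    then have "continuously_differentiable k (\<lambda>x. c * partial_deriv f i (c *\<^sub>R x + a))"
      using Suc.IH[OF D(2)] by (intro continuously_differentiable_mult continuously_differentiable_const) auto
    then show "continuously_differentiable k (\<lambda>x. frechet_derivative f (at (c *\<^sub>R x + a)) (c *\<^sub>R i))"
      by (simp add: linear_cmul[OF has_derivative_linear[OF D(1)]])
  qed
qed

text \<open>Differentiability is local, and on the overlap of \<open>U\<close> and \<open>W\<close>
  the derivatives of \<open>g\<close> and \<open>h\<close> agree because both are derivatives of
  \<open>f\<close>. In this way the product of a cutoff and a test function, extended by zero, is
  seen to be smooth.\<close>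

lemma continuously_differentiable_local:
  assumes "open U" "open W" "U \<union> W = UNIV"
    and "continuously_differentiable k g" "continuously_differentiable k h"
    and "\<And>x. x \<in> U \<Longrightarrow> f x = g x" "\<And>x. x \<in> W \<Longrightarrow> f x = h x"
  shows "continuously_differentiable k f"
  using assms(4-)
proof (induction k arbitrary: f g h)
  case 0
  have "continuous_on U f" "continuous_on W f"
    using 0 continuous_on_subset[OF _ subset_UNIV] by (simp_all cong: continuous_on_cong)
  then show ?case
    using continuous_on_open_Un[of U W f] assms by auto
next
  case (Suc k)
  note D = continuously_differentiable_SucD[OF Suc.prems(1)] continuously_differentiable_SucD[OF Suc.prems(2)]
  define f' where "f' = (\<lambda>x. if x \<in> U then frechet_derivative g (at x) else frechet_derivative h (at x))"
  have U: "(f has_derivative frechet_derivative g (at x)) (at x)" if "x \<in> U" for x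
    by (rule has_derivative_transform_within_open[OF D(1) assms(1) that]) (use Suc in auto)
  have W: "(f has_derivative frechet_derivative h (at x)) (at x)" if "x \<in> W" for x
    by (rule has_derivative_transform_within_open[OF D(3) assms(2) that]) (use Suc in auto)
  show ?case
  proof (rule continuously_differentiable_SucI)
    show "(f has_derivative f' x) (at x)" for x
      using U W assms(3) by (auto simp: f'_def)
    fix i :: 'a assume i: "i \<in> Basis"
    show "continuously_differentiable k (\<lambda>x. f' x i)"
      by (rule Suc.IH[OF D(2) D(4)])
         (use i in \<open>auto simp: f'_def intro!: fun_cong[OF has_derivative_unique[OF U W]]\<close>)
  qed
qed

lemma smooth_has_derivative:
  "smooth f \<Longrightarrow> (f has_derivative frechet_derivative f (at x)) (at x)"
  using continuously_differentiable_SucD(1) smooth_def by blast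

lemma smooth_partial_deriv: "smooth f \<Longrightarrow> i \<in> Basis \<Longrightarrow> smooth (partial_deriv f i)"
  using continuously_differentiable_SucD(2) smooth_def by blast

lemma smooth_continuous_on: "smooth f \<Longrightarrow> continuous_on S f"
  using continuously_differentiable.simps(1) smooth_def continuous_on_subset by blast

lemma smooth_const: "smooth (\<lambda>_. c)"
  by (simp add: smooth_def continuously_differentiable_const)

lemma smooth_add: "smooth f \<Longrightarrow> smooth g \<Longrightarrow> smooth (\<lambda>x. f x + g x)"
  by (simp add: smooth_def continuously_differentiable_add)

lemma smooth_mult: "smooth f \<Longrightarrow> smooth g \<Longrightarrow> smooth (\<lambda>x. f x * g x)"
  by (simp add: smooth_def continuously_differentiable_mult)

lemma smooth_sum: "(\<And>a. a \<in> A \<Longrightarrow> smooth (f a)) \<Longrightarrow> smooth (\<lambda>x. \<Sum>a\<in>A. f a x)"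
  by (induction A rule: infinite_finite_induct) (auto simp: smooth_const smooth_add)

lemma smooth_prod: "(\<And>a. a \<in> A \<Longrightarrow> smooth (f a)) \<Longrightarrow> smooth (\<lambda>x. \<Prod>a\<in>A. f a x)"
  by (induction A rule: infinite_finite_induct) (auto simp: smooth_const smooth_mult)

lemma smooth_compose: "smooth f \<Longrightarrow> smooth g \<Longrightarrow> smooth (\<lambda>x. f (g x))"
  for f :: "real \<Rightarrow> real"
  by (simp add: smooth_def continuously_differentiable_compose)

lemma smooth_affine: "smooth f \<Longrightarrow> smooth (\<lambda>x. f (c *\<^sub>R x + a))"
  by (simp add: smooth_def continuously_differentiable_affine)

lemma smooth_local:
  assumes "open U" "open W" "U \<union> W = UNIV" "smooth g" "smooth h"
    and "\<And>x. x \<in> U \<Longrightarrow> f x = g x" "\<And>x. x \<in> W \<Longrightarrow> f x = h x"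
  shows "smooth f"
  using continuously_differentiable_local[OF assms(1-3) _ _ assms(6,7)] assms(4,5)
  by (simp add: smooth_def)

lemma smooth_inner: "smooth (\<lambda>x. x \<bullet> a)"
  unfolding smooth_def
proof
  fix k show "continuously_differentiable k (\<lambda>x. x \<bullet> a)"
  proof (cases k)
    case (Suc m)
    show ?thesis
      unfolding Suc
      by (rule continuously_differentiable_SucI[where f' = "\<lambda>_ h. h \<bullet> a"])
         (auto intro!: derivative_eq_intros continuously_differentiable_const)
  qed (simp add: continuous_on_inner)
qed

lemma smooth_norm_square: "smooth (\<lambda>x::'a::euclidean_space. (norm x)\<^sup>2)"
proof -
  have "(norm x)\<^sup>2 = (\<Sum>i\<in>Basis. (x \<bullet> i) * (x \<bullet> i))" for x :: 'a
    by (metis power2_norm_eq_inner euclidean_inner)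
  then show ?thesis
    by (simp add: smooth_sum smooth_mult smooth_inner)
qed

section \<open>A smooth bump function supported in a ball\<close>

definition exp_cutoff :: "real \<Rightarrow> real" where
  "exp_cutoff t = (if t > 0 then exp (- (1 / t)) else 0)"

lemma tendsto_poly_div_exp_0: "((\<lambda>x. poly p x / exp x) \<longlongrightarrow> (0::real)) at_top"
proof -
  have "((\<lambda>x. \<Sum>i\<le>degree p. coeff p i * (x ^ i / exp x)) \<longlongrightarrow> (\<Sum>i\<le>degree p. coeff p i * 0)) at_top"
    by (intro tendsto_intros tendsto_power_div_exp_0)
  then show ?thesis
    by (simp add: poly_altdef sum_divide_distrib)
qed

text \<open>With the polynomial factor the class of functions is closed under differentiation.\<close>

lemma continuously_differentiable_poly_exp_cutoff:
  "continuously_differentiable k (\<lambda>t::real. poly p (1 / t) * exp_cutoff t)"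
proof (induction k arbitrary: p)
  case base: 0
  have lim: "((\<lambda>t. poly p (1 / t) * exp_cutoff t) \<longlongrightarrow> 0) (at 0)" for p
  proof (rule filterlim_split_at)
    have "\<forall>\<^sub>F t in at_left (0::real). poly p (1 / t) * exp_cutoff t = 0"
      by (auto simp: eventually_at_filter exp_cutoff_def)
    then show "((\<lambda>t. poly p (1 / t) * exp_cutoff t) \<longlongrightarrow> 0) (at_left 0)"
      by (rule tendsto_eventually)
    have "((\<lambda>t. poly p (inverse t) / exp (inverse t)) \<longlongrightarrow> 0) (at_right (0::real))"
      by (rule filterlim_compose[OF tendsto_poly_div_exp_0 filterlim_inverse_at_top_right])
    then show "((\<lambda>t. poly p (1 / t) * exp_cutoff t) \<longlongrightarrow> 0) (at_right 0)"
      by (rule Lim_transform_eventually)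
         (auto simp: eventually_at_filter exp_cutoff_def exp_minus field_simps)
  qed
  have "isCont (\<lambda>t. poly p (1 / t) * exp_cutoff t) t" for t
  proof -
    consider "t < 0" | "t = 0" | "t > 0" by linarith
    then show ?thesis
    proof cases
      case 1
      have "isCont (\<lambda>t. 0::real) t" by simp
      then show ?thesis
        using 1 by (subst isCont_cong[of _ "\<lambda>_. 0"])
          (auto simp: exp_cutoff_def eventually_nhds intro!: exI[of _ "{..<0}"])
    next
      case 2
      then show ?thesis
        using lim[of p] by (simp add: isCont_def exp_cutoff_def)
    next
      case 3
      then have "isCont (\<lambda>t. poly p (1 / t) * exp (- (1 / t))) t"
        by (intro continuous_intros) auto
      then show ?thesis
        using 3 by (subst isCont_cong[of _ "\<lambda>t. poly p (1 / t) * exp (- (1 / t))"])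
          (auto simp: exp_cutoff_def eventually_nhds intro!: exI[of _ "{0<..}"])
    qed
  qed
  then show ?case
    by (simp add: continuous_at_imp_continuous_on)
next
  case (Suc k)
  \<comment> \<open>Differentiating p(1/t) exp(-1/t) gives (p - p')(1/t) exp(-1/t) / t^2; the
    polynomial \<open>[:0, 0, 1:]\<close> supplies the factor 1/t^2.\<close>
  define q where "q = [:0, 0, 1:] * (p - pderiv p)"
  let ?f = "\<lambda>p t. poly p (1 / t) * exp_cutoff t"
  have "(?f p has_field_derivative ?f q t) (at t)" for t
  proof -
    consider "t < 0" | "t = 0" | "t > 0" by linarith
    then show ?thesis
    proof cases
      case 1
      have "((\<lambda>t. 0) has_field_derivative ?f q t) (at t)"
        using 1 by (simp add: exp_cutoff_def)
      then show ?thesis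
        by (rule has_field_derivative_transform_within_open[of _ _ _ "{..<0}"]) (use 1 in \<open>auto simp: exp_cutoff_def\<close>)
    next
      case 2
      \<comment> \<open>At the origin the difference quotient of the function for \<open>p\<close>
        is the function for \<open>[:0, 1:] * p\<close>, whose continuity is contained in the
        induction hypothesis.\<close>
      have "((\<lambda>t. ?f ([:0, 1:] * p) t) \<longlongrightarrow> ?f ([:0, 1:] * p) 0) (at 0)"
        using Suc.IH[of "[:0, 1:] * p", THEN continuously_differentiable_imp_continuous]
        unfolding continuous_on_eq_continuous_at[OF open_UNIV] isCont_def by blast
      then have "((\<lambda>t. (?f p t - ?f p 0) / (t - 0)) \<longlongrightarrow> 0) (at 0)"
        by (simp add: exp_cutoff_def)
      then show ?thesis
        using 2 by (simp add: has_field_derivative_iff exp_cutoff_def)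
    next
      case 3
      then have "((\<lambda>t. poly p (1 / t) * exp (- (1 / t))) has_field_derivative ?f q t) (at t)"
      proof -
        have "((\<lambda>t. poly p (1 / t) * exp (- (1 / t))) has_field_derivative
            (poly (pderiv p) (1 / t) * (- 1 / t\<^sup>2)) * exp (- (1 / t)) + poly p (1 / t) * (exp (- (1 / t)) * (1 / t\<^sup>2))) (at t)"
          using 3 by (auto intro!: derivative_eq_intros DERIV_chain2[OF poly_DERIV] simp: power2_eq_square)
        moreover have "(poly (pderiv p) (1 / t) * (- 1 / t\<^sup>2)) * exp (- (1 / t)) +
            poly p (1 / t) * (exp (- (1 / t)) * (1 / t\<^sup>2)) = ?f q t"
          using 3 by (simp add: q_def exp_cutoff_def algebra_simps power2_eq_square diff_divide_distrib)
        ultimately show ?thesis by simp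
      qed
      then show ?thesis
        by (rule has_field_derivative_transform_within_open[of _ _ _ "{0<..}"]) (use 3 in \<open>auto simp: exp_cutoff_def\<close>)
    qed
  qed
  then show ?case
    by (intro continuously_differentiable_SucI[where f' = "\<lambda>t h. ?f q t * h"])
       (use Suc.IH in \<open>auto simp: has_field_derivative_def\<close>)
qed

lemma smooth_exp_cutoff: "smooth exp_cutoff"
  using continuously_differentiable_poly_exp_cutoff[of _ 1] by (simp add: smooth_def)

lemma exp_cutoff_nonneg: "0 \<le> exp_cutoff t"
  and exp_cutoff_le_1: "exp_cutoff t \<le> 1"
  and exp_cutoff_eq_0_iff: "exp_cutoff t = 0 \<longleftrightarrow> t \<le> 0"
  by (auto simp: exp_cutoff_def)

lemma exp_cutoff_mono: "s \<le> t \<Longrightarrow> exp_cutoff s \<le> exp_cutoff t"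
  by (auto simp: exp_cutoff_def frac_le)

text \<open>The squared norm, unlike the norm itself, is smooth at the centre.\<close>

definition bump :: "'a::euclidean_space \<Rightarrow> real \<Rightarrow> 'a \<Rightarrow> real" where
  "bump a r x = exp_cutoff (r\<^sup>2 - (norm (x - a))\<^sup>2)"

lemma smooth_bump: "smooth (bump a r)"
proof -
  have "smooth (\<lambda>x. (norm (1 *\<^sub>R x + (- a)))\<^sup>2)"
    by (rule smooth_affine[OF smooth_norm_square])
  then have "smooth (\<lambda>x. r\<^sup>2 + (-1) * (norm (x - a))\<^sup>2)"
    by (intro smooth_add smooth_mult smooth_const) auto
  then have "smooth (\<lambda>x. exp_cutoff (r\<^sup>2 + (-1) * (norm (x - a))\<^sup>2))"
    by (rule smooth_compose[OF smooth_exp_cutoff])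
  then show ?thesis
    by (simp add: bump_def[abs_def])
qed

lemma bump_nonneg: "0 \<le> bump a r x"
  and bump_le_1: "bump a r x \<le> 1"
  by (simp_all add: bump_def exp_cutoff_nonneg exp_cutoff_le_1)

lemma bump_eq_0_iff:
  assumes "r \<ge> 0" shows "bump a r x = 0 \<longleftrightarrow> x \<notin> ball a r"
  using assms
  by (auto simp: bump_def exp_cutoff_eq_0_iff dist_norm norm_minus_commute abs_le_square_iff[symmetric])

text \<open>By monotonicity of \<open>exp_cutoff\<close> a ball of radius \<open>s\<close> with
  \<open>0 \<le> s < r\<close> yields a positive lower bound. The lower bounds for cutoffs and
  kernels below arise in this way.\<close>

lemma bump_ge:
  assumes "dist a x \<le> s"
  shows "exp_cutoff (r\<^sup>2 - s\<^sup>2) \<le> bump a r x"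
  using assms power_mono[of "norm (x - a)" s 2]
  by (auto simp: bump_def dist_norm norm_minus_commute intro!: exp_cutoff_mono)

section \<open>The discrete Loomis--Whitney inequality\<close>

text \<open>Convexity of \<open>exp\<close> at the points \<open>ln (x i)\<close>. A vanishing
  \<open>x i\<close> has no usable logarithm and is split off: the product is then 0.\<close>

lemma weighted_arith_geom_mean:
  fixes x \<theta> :: "'i \<Rightarrow> real"
  assumes "finite I" and "\<And>i. i \<in> I \<Longrightarrow> x i \<ge> 0" and "\<And>i. i \<in> I \<Longrightarrow> \<theta> i > 0"
    and "(\<Sum>i\<in>I. \<theta> i) = 1"
  shows "(\<Prod>i\<in>I. x i powr \<theta> i) \<le> (\<Sum>i\<in>I. \<theta> i * x i)"
proof (cases "\<exists>i\<in>I. x i = 0")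
  case True
  then have "(\<Prod>i\<in>I. x i powr \<theta> i) = 0"
    using assms(1) by (auto simp: prod_zero_iff)
  moreover have "0 \<le> (\<Sum>i\<in>I. \<theta> i * x i)"
    using assms(2,3) by (intro sum_nonneg mult_nonneg_nonneg) (auto intro: less_imp_le)
  ultimately show ?thesis by linarith
next
  case False
  then have pos: "x i > 0" if "i \<in> I" for i
    using assms(2) that by (metis less_eq_real_def)
  have ne: "I \<noteq> {}"
    using assms(4) by auto
  have "exp (\<Sum>i\<in>I. \<theta> i *\<^sub>R ln (x i)) \<le> (\<Sum>i\<in>I. \<theta> i * exp (ln (x i)))"
    by (rule convex_on_sum[OF assms(1) ne exp_convex assms(4)]) (simp_all add: assms(3) less_imp_le)
  also have "\<dots> = (\<Sum>i\<in>I. \<theta> i * x i)"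
    using pos by simp
  also have "exp (\<Sum>i\<in>I. \<theta> i *\<^sub>R ln (x i)) = (\<Prod>i\<in>I. x i powr \<theta> i)"
  proof -
    have "exp (\<theta> i *\<^sub>R ln (x i)) = x i powr \<theta> i" if "i \<in> I" for i
      using pos[OF that] by (simp add: powr_def)
    then show ?thesis
      using assms(1) by (simp add: exp_sum)
  qed
  finally show ?thesis .
qed

text \<open>Hoelder's inequality with exponents \<open>1 / \<theta> i\<close>. Once each
  \<open>f i\<close> is normalized to have sum 1, the weighted arithmetic-geometric mean inequality
  is summed over \<open>k\<close>. If some \<open>f i\<close> has sum 0, it vanishes on
  \<open>K\<close>, and so does the left side.\<close>

lemma sum_prod_powr_le:
  fixes f :: "'i \<Rightarrow> 'k \<Rightarrow> real"
  assumes "finite I" "finite K" and f: "\<And>i k. i \<in> I \<Longrightarrow> k \<in> K \<Longrightarrow> f i k \<ge> 0"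
    and \<theta>: "\<And>i. i \<in> I \<Longrightarrow> \<theta> i > 0" "(\<Sum>i\<in>I. \<theta> i) = 1"
  shows "(\<Sum>k\<in>K. \<Prod>i\<in>I. f i k powr \<theta> i) \<le> (\<Prod>i\<in>I. (\<Sum>k\<in>K. f i k) powr \<theta> i)"
proof (cases "\<exists>i\<in>I. (\<Sum>k\<in>K. f i k) = 0")
  case True
  then obtain i where i: "i \<in> I" "\<forall>k\<in>K. f i k = 0"
    using assms(2) f by (auto simp: sum_nonneg_eq_0_iff)
  then have "(\<Sum>k\<in>K. \<Prod>i\<in>I. f i k powr \<theta> i) = 0"
    using assms(1) by (intro sum.neutral) (auto simp: prod_zero_iff)
  then show ?thesis
    by (simp add: prod_nonneg)
next
  case False
  define s where "s i = (\<Sum>k\<in>K. f i k)" for i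
  have s: "s i > 0" if "i \<in> I" for i
    using False f that by (metis s_def less_eq_real_def sum_nonneg)
  have "(\<Sum>k\<in>K. \<Prod>i\<in>I. f i k powr \<theta> i) = (\<Sum>k\<in>K. (\<Prod>i\<in>I. s i powr \<theta> i) * (\<Prod>i\<in>I. (f i k / s i) powr \<theta> i))"
  proof (intro sum.cong refl)
    fix k
    have "f i k powr \<theta> i = s i powr \<theta> i * (f i k / s i) powr \<theta> i" if "i \<in> I" for i
    proof -
      have "s i powr \<theta> i * (f i k / s i) powr \<theta> i = (s i * (f i k / s i)) powr \<theta> i"
        by (rule powr_mult[symmetric])
      then show ?thesis
        using s[OF that] by simp
    qed
    then show "(\<Prod>i\<in>I. f i k powr \<theta> i) = (\<Prod>i\<in>I. s i powr \<theta> i) * (\<Prod>i\<in>I. (f i k / s i) powr \<theta> i)"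
      by (simp add: prod.distrib[symmetric])
  qed
  also have "\<dots> \<le> (\<Sum>k\<in>K. (\<Prod>i\<in>I. s i powr \<theta> i) * (\<Sum>i\<in>I. \<theta> i * (f i k / s i)))"
    by (intro sum_mono mult_left_mono weighted_arith_geom_mean prod_nonneg assms)
       (use s f in \<open>auto intro: divide_nonneg_pos\<close>)
  also have "\<dots> = (\<Prod>i\<in>I. s i powr \<theta> i) * (\<Sum>i\<in>I. \<Sum>k\<in>K. \<theta> i * (f i k / s i))"
    by (subst sum.swap) (simp add: sum_distrib_left)
  also have "(\<Sum>i\<in>I. \<Sum>k\<in>K. \<theta> i * (f i k / s i)) = (\<Sum>i\<in>I. \<theta> i)"
  proof (rule sum.cong[OF refl])
    fix i assume "i \<in> I"
    then have "s i \<noteq> 0" using s by fastforce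
    then show "(\<Sum>k\<in>K. \<theta> i * (f i k / s i)) = \<theta> i"
      by (simp add: sum_distrib_left[symmetric] sum_divide_distrib[symmetric] s_def[symmetric])
  qed
  finally show ?thesis
    using \<theta>(2) by (simp add: s_def)
qed

lemma sum_prod_root_le:
  fixes f :: "'i \<Rightarrow> 'k \<Rightarrow> real"
  assumes "finite I" "I \<noteq> {}" "finite K" and f: "\<And>i k. i \<in> I \<Longrightarrow> k \<in> K \<Longrightarrow> f i k \<ge> 0"
  shows "(\<Sum>k\<in>K. \<Prod>i\<in>I. f i k powr (1 / card I)) \<le> (\<Prod>i\<in>I. (\<Sum>k\<in>K. f i k) powr (1 / card I))"
  using assms by (intro sum_prod_powr_le) (auto simp: card_gt_0_iff)

lemma sum_powr_mult_le:
  fixes f g :: "'k \<Rightarrow> real"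
  assumes "finite K" "\<And>k. k \<in> K \<Longrightarrow> f k \<ge> 0" "\<And>k. k \<in> K \<Longrightarrow> g k \<ge> 0"
    and "a > 0" "b > 0" "a + b = 1"
  shows "(\<Sum>k\<in>K. f k powr a * g k powr b) \<le> (\<Sum>k\<in>K. f k) powr a * (\<Sum>k\<in>K. g k) powr b"
proof -
  let ?F = "\<lambda>c::bool. if c then f else g" and ?\<theta> = "\<lambda>c. if c then a else b"
  have "(\<Sum>k\<in>K. \<Prod>c\<in>UNIV. ?F c k powr ?\<theta> c) \<le> (\<Prod>c\<in>UNIV. (\<Sum>k\<in>K. ?F c k) powr ?\<theta> c)"
    using assms by (intro sum_prod_powr_le) (auto simp: UNIV_bool split: if_splits)
  then show ?thesis
    by (simp add: UNIV_bool mult.commute)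
qed

lemma sum_root_mult_le:
  fixes f :: "'i \<Rightarrow> 'k \<Rightarrow> real"
  assumes "finite I" "finite K" and f: "\<And>i k. i \<in> I \<Longrightarrow> k \<in> K \<Longrightarrow> f i k \<ge> 0"
    and g: "\<And>k. k \<in> K \<Longrightarrow> g k \<ge> 0"
  shows "(\<Sum>k\<in>K. g k powr (1 / Suc (card I)) * (\<Prod>i\<in>I. f i k powr (1 / Suc (card I)))) \<le>
    (\<Sum>k\<in>K. g k) powr (1 / Suc (card I)) * (\<Prod>i\<in>I. (\<Sum>k\<in>K. f i k) powr (1 / Suc (card I)))"
proof -
  \<comment> \<open>The extra index \<open>None\<close> stands for \<open>g\<close>, so that the
    equal exponents \<open>1 / Suc (card I)\<close> add up to 1.\<close>
  let ?J = "insert None (Some ` I)" and ?F = "case_option g f"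
  have card: "card ?J = Suc (card I)"
    using assms(1) by (simp add: card_image)
  have prod: "(\<Prod>j\<in>?J. h j) = h None * (\<Prod>i\<in>I. h (Some i))" for h :: "'i option \<Rightarrow> real"
    using assms(1) by (simp add: prod.reindex)
  have "0 \<le> ?F j k" if "j \<in> ?J" "k \<in> K" for j k
    using that f g by auto
  then show ?thesis
    using sum_prod_root_le[of ?J K ?F] assms(1,2) unfolding card prod by simp
qed

section \<open>The Loomis-Whitney inequality on a finite grid\<close>

lemma sum_PiE_insert:
  assumes "a \<notin> J"
  shows "(\<Sum>k\<in>Pi\<^sub>E (insert a J) (\<lambda>_. A). f k) = (\<Sum>k\<in>Pi\<^sub>E J (\<lambda>_. A). \<Sum>m\<in>A. f (k(a := m)))"
proof -
  have "(\<Sum>k\<in>Pi\<^sub>E (insert a J) (\<lambda>_. A). f k) = (\<Sum>(m, k)\<in>A \<times> Pi\<^sub>E J (\<lambda>_. A). f (k(a := m)))"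
    unfolding PiE_insert_eq using inj_combinator[OF assms, of "\<lambda>_. A"]
    by (subst sum.reindex) (auto simp: case_prod_unfold)
  also have "\<dots> = (\<Sum>m\<in>A. \<Sum>k\<in>Pi\<^sub>E J (\<lambda>_. A). f (k(a := m)))"
    by (simp add: sum.cartesian_product)
  finally show ?thesis
    by (simp add: sum.swap[of _ A])
qed

text \<open>The weight \<open>g\<close> is what carries the induction: when a new coordinate
  \<open>a\<close> is summed out, the line sum along \<open>a\<close> does not depend on that
  coordinate and becomes the weight of the inequality in the remaining ones.\<close>

lemma loomis_whitney_weighted:
  fixes E :: "'i \<Rightarrow> ('i \<Rightarrow> 'b) \<Rightarrow> real"
  assumes "finite J" "J \<noteq> {}" "finite A"
    and "\<And>k. k \<in> Pi\<^sub>E J (\<lambda>_. A) \<Longrightarrow> g k \<ge> 0"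
    and "\<And>i k. i \<in> J \<Longrightarrow> k \<in> Pi\<^sub>E J (\<lambda>_. A) \<Longrightarrow> E i k \<ge> 0"
  shows "(\<Sum>k\<in>Pi\<^sub>E J (\<lambda>_. A). g k powr (1 / card J) * (\<Prod>i\<in>J. (\<Sum>m\<in>A. E i (k(i := m))) powr (1 / card J)))
    \<le> (\<Sum>k\<in>Pi\<^sub>E J (\<lambda>_. A). g k) powr (1 / card J) *
      (\<Prod>i\<in>J. (\<Sum>k\<in>Pi\<^sub>E J (\<lambda>_. A). E i k) powr (1 / card J))"
  using assms
proof (induction J arbitrary: g E rule: finite_ne_induct)
  case (singleton b)
  have *: "(\<Sum>k\<in>Pi\<^sub>E {b} (\<lambda>_. A). f k) = (\<Sum>m\<in>A. f ((\<lambda>_. undefined)(b := m)))" for f :: "_ \<Rightarrow> real"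
    using sum_PiE_insert[of b "{}" f A] by (simp add: fun_upd_def)
  have "g ((\<lambda>_. undefined)(b := m)) \<ge> 0" "E b ((\<lambda>_. undefined)(b := m)) \<ge> 0" if "m \<in> A" for m
    using singleton that by (auto simp: PiE_iff extensional_def)
  then show ?case
    unfolding * by (simp add: sum_nonneg sum_distrib_right)
next
  case (insert a J)
  define m where "m = card J"
  have m: "m \<ge> 1" "card (insert a J) = Suc m"
    using insert by (auto simp: m_def Suc_le_eq card_gt_0_iff)
  let ?\<theta> = "1 / real (Suc m)"
  let ?P = "Pi\<^sub>E J (\<lambda>_. A)"
  define g' where "g' k = (\<Sum>n\<in>A. g (k(a := n)))" for k
  define E' where "E' i k = (\<Sum>n\<in>A. E i (k(a := n)))" for i k
  have fin: "finite ?P"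
    using insert by (simp add: finite_PiE)
  have upd: "k(a := n) \<in> Pi\<^sub>E (insert a J) (\<lambda>_. A)" if "k \<in> ?P" "n \<in> A" for k n
    using that insert by (auto simp: PiE_iff extensional_def)
  have upd2: "k(i := n) \<in> ?P" if "k \<in> ?P" "n \<in> A" "i \<in> J" for k n i
    using that by (auto simp: PiE_iff extensional_def)
  have g0: "g' k \<ge> 0" if "k \<in> ?P" for k
    unfolding g'_def by (intro sum_nonneg insert.prems(2) upd that)
  have E0: "E' i k \<ge> 0" if "k \<in> ?P" "i \<in> insert a J" for k i
    unfolding E'_def by (intro sum_nonneg insert.prems(3)[OF that(2) upd[OF that(1)]])
  have "(\<Sum>k\<in>Pi\<^sub>E (insert a J) (\<lambda>_. A). g k powr ?\<theta> * (\<Prod>i\<in>insert a J. (\<Sum>n\<in>A. E i (k(i := n))) powr ?\<theta>))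
    = (\<Sum>k\<in>?P. E' a k powr ?\<theta> * (\<Sum>l\<in>A. g (k(a := l)) powr ?\<theta> *
        (\<Prod>i\<in>J. (\<Sum>n\<in>A. E i (k(i := n, a := l))) powr ?\<theta>)))"
    unfolding sum_PiE_insert[OF insert.hyps(3)] sum_distrib_left
  proof (intro sum.cong refl)
    fix k l assume "k \<in> ?P" "l \<in> A"
    have "k(a := l, i := n) = k(i := n, a := l)" if "i \<in> J" for i n
      using insert.hyps(3) that by (intro fun_upd_twist) auto
    then have "(\<Prod>i\<in>J. (\<Sum>n\<in>A. E i (k(a := l, i := n))) powr ?\<theta>) = (\<Prod>i\<in>J. (\<Sum>n\<in>A. E i (k(i := n, a := l))) powr ?\<theta>)"
      by (intro prod.cong refl) simp
    then show "g (k(a := l)) powr ?\<theta> * (\<Prod>i\<in>insert a J. (\<Sum>n\<in>A. E i (k(a := l, i := n))) powr ?\<theta>) =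
      E' a k powr ?\<theta> * (g (k(a := l)) powr ?\<theta> * (\<Prod>i\<in>J. (\<Sum>n\<in>A. E i (k(i := n, a := l))) powr ?\<theta>))"
      using insert.hyps by (simp add: E'_def)
  qed
  \<comment> \<open>Hoelder in the coordinate \<open>a\<close> alone, for \<open>g\<close> and the
    \<open>m\<close> line sums in the directions of \<open>J\<close>. The line sum along
    \<open>a\<close> is constant in that coordinate and has been pulled out.\<close>
  also have "\<dots> \<le> (\<Sum>k\<in>?P. E' a k powr ?\<theta> * (g' k powr ?\<theta> *
        (\<Prod>i\<in>J. (\<Sum>l\<in>A. \<Sum>n\<in>A. E i (k(i := n, a := l))) powr ?\<theta>)))"
  proof (intro sum_mono mult_left_mono)
    fix k assume k: "k \<in> ?P"
    have "E i (k(i := n, a := l)) \<ge> 0" if "i \<in> J" "n \<in> A" "l \<in> A" for i n l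
      using that k by (intro insert.prems(3) upd upd2) auto
    then show "(\<Sum>l\<in>A. g (k(a := l)) powr ?\<theta> * (\<Prod>i\<in>J. (\<Sum>n\<in>A. E i (k(i := n, a := l))) powr ?\<theta>)) \<le>
      g' k powr ?\<theta> * (\<Prod>i\<in>J. (\<Sum>l\<in>A. \<Sum>n\<in>A. E i (k(i := n, a := l))) powr ?\<theta>)"
      unfolding g'_def m_def using insert.hyps(1) insert.prems(1)
      by (intro sum_root_mult_le) (auto intro!: sum_nonneg insert.prems(2) upd k)
  qed auto
  \<comment> \<open>Apart from exchanging two sums, only exponents are rewritten:
    \<open>1 / Suc m\<close> is \<open>1 / m\<close> times \<open>m / Suc m\<close>. This prepares
    Hoelder's inequality for two functions with exponents \<open>1 / Suc m\<close> and
    \<open>m / Suc m\<close>.\<close>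
  also have "\<dots> = (\<Sum>k\<in>?P. g' k powr ?\<theta> * (E' a k powr (1 / m) *
        (\<Prod>i\<in>J. (\<Sum>n\<in>A. E' i (k(i := n))) powr (1 / m))) powr (m / Suc m))"
  proof (intro sum.cong refl)
    fix k assume k: "k \<in> ?P"
    have "(\<Sum>l\<in>A. \<Sum>n\<in>A. E i (k(i := n, a := l))) = (\<Sum>n\<in>A. E' i (k(i := n)))" for i
      unfolding E'_def by (rule sum.swap)
    moreover have "(1 / real m) * (m / Suc m) = ?\<theta>"
      using m by simp
    ultimately show "E' a k powr ?\<theta> * (g' k powr ?\<theta> * (\<Prod>i\<in>J. (\<Sum>l\<in>A. \<Sum>n\<in>A. E i (k(i := n, a := l))) powr ?\<theta>)) =
      g' k powr ?\<theta> * (E' a k powr (1 / m) * (\<Prod>i\<in>J. (\<Sum>n\<in>A. E' i (k(i := n))) powr (1 / m))) powr (m / Suc m)"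
      by (simp add: powr_mult powr_powr prod_powr_distrib[symmetric] prod_nonneg)
  qed
  also have "\<dots> \<le> (\<Sum>k\<in>?P. g' k) powr ?\<theta> * (\<Sum>k\<in>?P. E' a k powr (1 / m) *
        (\<Prod>i\<in>J. (\<Sum>n\<in>A. E' i (k(i := n))) powr (1 / m))) powr (m / Suc m)"
  proof -
    have "?\<theta> + m / Suc m = 1"
      by (simp add: add_divide_distrib[symmetric])
    then show ?thesis
      using g0 m(1) fin by (intro sum_powr_mult_le) (auto intro!: mult_nonneg_nonneg prod_nonneg)
  qed
  also have "\<dots> \<le> (\<Sum>k\<in>?P. g' k) powr ?\<theta> * ((\<Sum>k\<in>?P. E' a k) powr (1 / m) *
        (\<Prod>i\<in>J. (\<Sum>k\<in>?P. E' i k) powr (1 / m))) powr (m / Suc m)"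
    by (intro mult_left_mono powr_mono2 insert.IH[of "E' a" E', folded m_def] sum_nonneg mult_nonneg_nonneg prod_nonneg)
       (auto simp: E0 insert.prems(1))
  also have "\<dots> = (\<Sum>k\<in>?P. g' k) powr ?\<theta> * (\<Prod>i\<in>insert a J. (\<Sum>k\<in>?P. E' i k) powr ?\<theta>)"
    using m(1) insert.hyps
    by (simp add: powr_mult powr_powr prod_powr_distrib[symmetric] prod_nonneg)
  also have "\<dots> = (\<Sum>k\<in>Pi\<^sub>E (insert a J) (\<lambda>_. A). g k) powr ?\<theta> *
      (\<Prod>i\<in>insert a J. (\<Sum>k\<in>Pi\<^sub>E (insert a J) (\<lambda>_. A). E i k) powr ?\<theta>)"
    by (simp add: sum_PiE_insert[OF insert.hyps(3)] g'_def E'_def)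
  finally show ?case
    unfolding m(2) .
qed

text \<open>With d = \<open>card I\<close>, the power d/(d-1) is a product of d factors with
  exponent 1/(d-1), one for each direction and bounded by the line sum in that direction. The line
  sum along a chosen \<open>a\<close> is constant in the coordinate \<open>a\<close>, so Hoelder in
  this coordinate involves exactly d-1 functions. What remains is the weighted inequality in d-1
  coordinates, with the line sums along \<open>a\<close> as weight.\<close>

lemma discrete_gagliardo:
  fixes D :: "'i \<Rightarrow> ('i \<Rightarrow> 'b) \<Rightarrow> real"
  assumes "finite I" "card I \<ge> 2" "finite A"
    and D: "\<And>i k. i \<in> I \<Longrightarrow> k \<in> Pi\<^sub>E I (\<lambda>_. A) \<Longrightarrow> D i k \<ge> 0"
    and F: "\<And>k. k \<in> Pi\<^sub>E I (\<lambda>_. A) \<Longrightarrow> F k \<ge> 0"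
    and FD: "\<And>i k. i \<in> I \<Longrightarrow> k \<in> Pi\<^sub>E I (\<lambda>_. A) \<Longrightarrow> F k \<le> (\<Sum>n\<in>A. D i (k(i := n)))"
    and V: "\<And>i. i \<in> I \<Longrightarrow> (\<Sum>k\<in>Pi\<^sub>E I (\<lambda>_. A). D i k) \<le> V"
  shows "(\<Sum>k\<in>Pi\<^sub>E I (\<lambda>_. A). F k powr (real (card I) / (real (card I) - 1))) \<le> V powr (real (card I) / (real (card I) - 1))"
proof -
  have "I \<noteq> {}"
    using assms(2) by auto
  then obtain a J where I: "I = insert a J" "a \<notin> J"
    by (meson all_not_in_conv mk_disjoint_insert)
  have J: "finite J" "J \<noteq> {}" "card I = Suc (card J)"
    using assms(1,2) I by (auto simp: card_insert_if)
  define m where "m = card J"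
  have m: "m \<ge> 1" "card I = Suc m"
    using J by (auto simp: m_def Suc_le_eq card_gt_0_iff)
  let ?\<theta> = "1 / real m"
  let ?P = "Pi\<^sub>E J (\<lambda>_. A)"
  define E' where "E' i k = (\<Sum>n\<in>A. D i (k(a := n)))" for i k
  have upd: "k(a := n) \<in> Pi\<^sub>E I (\<lambda>_. A)" if "k \<in> ?P" "n \<in> A" for k n
    using that I by (auto simp: PiE_iff extensional_def)
  have upd2: "k(i := n) \<in> Pi\<^sub>E K (\<lambda>_. A)" if "k \<in> Pi\<^sub>E K (\<lambda>_. A)" "n \<in> A" "i \<in> K" for k n i K
    using that by (auto simp: PiE_iff extensional_def)
  have E0: "E' i k \<ge> 0" if "k \<in> ?P" "i \<in> I" for k i
    unfolding E'_def by (intro sum_nonneg D[OF that(2) upd[OF that(1)]])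
  have powr_dim: "x powr (real (card I) / (real (card I) - 1)) = (\<Prod>i\<in>I. x powr ?\<theta>)" if "x \<ge> 0" for x :: real
  proof (cases "x = 0")
    case False
    then have "(x powr ?\<theta>) ^ card I = x powr (real (card I) * ?\<theta>)"
      by (rule powr_power)
    then show ?thesis
      using m by simp
  qed (simp add: m(2))
  have V0: "0 \<le> V"
    using V[of a] I(1) sum_nonneg[of "Pi\<^sub>E I (\<lambda>_. A)" "D a", OF D] by fastforce
  have "(\<Sum>k\<in>Pi\<^sub>E I (\<lambda>_. A). F k powr (real (card I) / (real (card I) - 1)))
    \<le> (\<Sum>k\<in>Pi\<^sub>E I (\<lambda>_. A). \<Prod>i\<in>I. (\<Sum>n\<in>A. D i (k(i := n))) powr ?\<theta>)"
  proof (intro sum_mono)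
    fix k assume k: "k \<in> Pi\<^sub>E I (\<lambda>_. A)"
    have "F k powr (real (card I) / (real (card I) - 1)) = (\<Prod>i\<in>I. F k powr ?\<theta>)"
      by (rule powr_dim[OF F[OF k]])
    also have "\<dots> \<le> (\<Prod>i\<in>I. (\<Sum>n\<in>A. D i (k(i := n))) powr ?\<theta>)"
      using F[OF k] FD[OF _ k] by (intro prod_mono conjI powr_mono2) auto
    finally show "F k powr (real (card I) / (real (card I) - 1)) \<le> \<dots>" .
  qed
  also have "\<dots> = (\<Sum>k\<in>?P. E' a k powr ?\<theta> * (\<Sum>l\<in>A. \<Prod>i\<in>J. (\<Sum>n\<in>A. D i (k(i := n, a := l))) powr ?\<theta>))"
    unfolding I(1) sum_PiE_insert[OF I(2)] sum_distrib_left
  proof (intro sum.cong refl)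
    fix k l assume "k \<in> ?P" "l \<in> A"
    have "k(a := l, i := n) = k(i := n, a := l)" if "i \<in> J" for i n
      using I(2) that by (intro fun_upd_twist) auto
    then have "(\<Prod>i\<in>J. (\<Sum>n\<in>A. D i (k(a := l, i := n))) powr ?\<theta>) = (\<Prod>i\<in>J. (\<Sum>n\<in>A. D i (k(i := n, a := l))) powr ?\<theta>)"
      by (intro prod.cong refl) simp
    then show "(\<Prod>i\<in>insert a J. (\<Sum>n\<in>A. D i (k(a := l, i := n))) powr ?\<theta>) =
      E' a k powr ?\<theta> * (\<Prod>i\<in>J. (\<Sum>n\<in>A. D i (k(i := n, a := l))) powr ?\<theta>)"
      using I(2) J by (simp add: E'_def)
  qed
  also have "\<dots> \<le> (\<Sum>k\<in>?P. E' a k powr ?\<theta> * (\<Prod>i\<in>J. (\<Sum>l\<in>A. \<Sum>n\<in>A. D i (k(i := n, a := l))) powr ?\<theta>))"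
  proof (intro sum_mono mult_left_mono)
    fix k assume k: "k \<in> ?P"
    have "D i (k(i := n, a := l)) \<ge> 0" if "i \<in> J" "n \<in> A" "l \<in> A" for i n l
      using that k I by (intro D upd upd2) auto
    then show "(\<Sum>l\<in>A. \<Prod>i\<in>J. (\<Sum>n\<in>A. D i (k(i := n, a := l))) powr ?\<theta>) \<le>
      (\<Prod>i\<in>J. (\<Sum>l\<in>A. \<Sum>n\<in>A. D i (k(i := n, a := l))) powr ?\<theta>)"
      unfolding m_def using J assms(3) by (intro sum_prod_root_le) (auto intro!: sum_nonneg)
  qed auto
  also have "\<dots> = (\<Sum>k\<in>?P. E' a k powr ?\<theta> * (\<Prod>i\<in>J. (\<Sum>n\<in>A. E' i (k(i := n))) powr ?\<theta>))"
  proof -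
    have "(\<Sum>l\<in>A. \<Sum>n\<in>A. D i (k(i := n, a := l))) = (\<Sum>n\<in>A. E' i (k(i := n)))" for i k
      unfolding E'_def by (rule sum.swap)
    then show ?thesis by simp
  qed
  also have "\<dots> \<le> (\<Sum>k\<in>?P. E' a k) powr ?\<theta> * (\<Prod>i\<in>J. (\<Sum>k\<in>?P. E' i k) powr ?\<theta>)"
    unfolding m_def using J assms(3) E0 I by (intro loomis_whitney_weighted) auto
  also have "\<dots> = (\<Prod>i\<in>I. (\<Sum>k\<in>Pi\<^sub>E I (\<lambda>_. A). D i k) powr ?\<theta>)"
    unfolding I(1) using I(2) J by (simp add: sum_PiE_insert E'_def)
  also have "\<dots> \<le> (\<Prod>i\<in>I. V powr ?\<theta>)"
    using V D by (intro prod_mono conjI powr_mono2 sum_nonneg) auto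
  also have "\<dots> = V powr (real (card I) / (real (card I) - 1))"
    by (rule powr_dim[OF V0, symmetric])
  finally show ?thesis .
qed

section \<open>Mollification\<close>

lemma nn_integral_lborel_shift:
  fixes f :: "'a::euclidean_space \<Rightarrow> ennreal"
  assumes [measurable]: "f \<in> borel_measurable borel"
  shows "(\<integral>\<^sup>+x. f (x + c) \<partial>lborel) = (\<integral>\<^sup>+x. f x \<partial>lborel)"
  by (subst lborel_distr_plus[of c, symmetric]) (simp add: nn_integral_distr add.commute)

lemma integrable_lborel_shift:
  fixes f :: "'a::euclidean_space \<Rightarrow> real"
  assumes "integrable lborel f"
  shows "integrable lborel (\<lambda>x. f (x + c))"
proof -
  have [measurable]: "f \<in> borel_measurable borel"
    using assms by auto
  show ?thesis
    using assms
    by (subst (asm) lborel_distr_plus[of c, symmetric]) (simp add: integrable_distr_eq add.commute)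
qed

lemma integral_lborel_shift:
  fixes f :: "'a::euclidean_space \<Rightarrow> real"
  assumes [measurable]: "f \<in> borel_measurable borel"
  shows "(\<integral>x. f (x + c) \<partial>lborel) = (\<integral>x. f x \<partial>lborel)"
  by (subst lborel_distr_plus[of c, symmetric]) (simp add: integral_distr add.commute)

lemma integrable_bounded_support:
  fixes f :: "'a::euclidean_space \<Rightarrow> real"
  assumes "f \<in> borel_measurable borel" "\<And>x. \<bar>f x\<bar> \<le> K" "\<And>x. norm x > R \<Longrightarrow> f x = 0"
  shows "integrable lborel f"
proof (rule Bochner_Integration.integrable_bound)
  show "integrable lborel (\<lambda>x::'a. K * indicator (cball 0 R) x :: real)"
    using emeasure_lborel_cball_finite[of "0::'a" R]
    by (intro integrable_mult_right integrable_real_indicator) auto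
  show "AE x in lborel. norm (f x) \<le> norm (K * indicator (cball 0 R) x :: real)"
  proof (rule AE_I2)
    fix x
    show "norm (f x) \<le> norm (K * indicator (cball 0 R) x :: real)"
    proof (cases "norm x > R")
      case False
      then show ?thesis
        using assms(2)[of x] by (simp add: indicator_def)
    qed (use assms(3) in simp)
  qed
qed (use assms in auto)

lemma integrable_mult_bounded:
  fixes f g :: "'a::euclidean_space \<Rightarrow> real"
  assumes "integrable lborel f" "g \<in> borel_measurable borel" "\<And>x. \<bar>g x\<bar> \<le> K"
  shows "integrable lborel (\<lambda>x. f x * g x)"
proof (rule Bochner_Integration.integrable_bound[OF integrable_mult_right[OF assms(1), of K]])
  show "AE y in lborel. norm (f y * g y) \<le> norm (K * f y)"
  proof (rule AE_I2)
    fix y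
    have "\<bar>f y\<bar> * \<bar>g y\<bar> \<le> \<bar>f y\<bar> * \<bar>K\<bar>"
      by (intro mult_left_mono order_trans[OF assms(3) abs_ge_self]) auto
    then show "norm (f y * g y) \<le> norm (K * f y)"
      by (simp add: abs_mult mult.commute)
  qed
qed (use assms in auto)

text \<open>Measurability provides continuous functions that converge off a null set. Clamping them
  to values between \<open>- K\<close> and \<open>K\<close> and cutting them off outside the ball
  leaves the limit unchanged, since \<open>f\<close> obeys both restrictions, and makes them
  dominated.\<close>

lemma L1_approx_continuous_bounded:
  fixes f :: "'a::euclidean_space \<Rightarrow> real"
  assumes [measurable]: "f \<in> borel_measurable borel" and K: "\<And>x. \<bar>f x\<bar> \<le> K"
    and R: "\<And>x. norm x > R \<Longrightarrow> f x = 0" and "e > 0"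
  obtains g where "continuous_on UNIV g" "\<And>x. norm x > R + 1 \<Longrightarrow> g x = 0"
    "(\<integral>\<^sup>+x. ennreal \<bar>f x - g x\<bar> \<partial>lborel) < ennreal e"
proof -
  have "f \<in> borel_measurable lebesgue"
    by (simp add: measurable_completion)
  then have "f measurable_on UNIV"
    by (rule lebesgue_measurable_imp_measurable_on) auto
  then obtain N g where N: "negligible N" and g: "\<And>n. continuous_on UNIV (g n)"
    and lim: "\<And>x. x \<notin> N \<Longrightarrow> (\<lambda>n. g n x) \<longlonglongrightarrow> f x"
    by (auto simp: measurable_on_def)
  define cut where "cut x = max 0 (min 1 (R + 1 - norm x))" for x :: 'a
  define G where "G n x = cut x * max (- K) (min K (g n x))" for n x
  have cont: "continuous_on UNIV (G n)" for n
    unfolding G_def cut_def by (intro continuous_intros g)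
  have [measurable]: "G n \<in> borel_measurable borel" for n
    using cont by (rule borel_measurable_continuous_onI)
  have K0: "K \<ge> 0"
    using K[of 0] by linarith
  have supp: "G n x = 0" if "norm x > R + 1" for n x
    using that by (simp add: G_def cut_def)
  have bound: "\<bar>G n x\<bar> \<le> K" for n x
  proof -
    have "\<bar>cut x\<bar> * \<bar>max (- K) (min K (g n x))\<bar> \<le> 1 * K"
      using K0 by (intro mult_mono) (auto simp: cut_def)
    then show ?thesis
      by (simp add: G_def abs_mult)
  qed
  have limG: "(\<lambda>n. G n x) \<longlonglongrightarrow> f x" if "x \<notin> N" for x
  proof -
    have "(\<lambda>n. G n x) \<longlonglongrightarrow> cut x * max (- K) (min K (f x))"
      unfolding G_def by (intro tendsto_intros lim that)
    also have "cut x * max (- K) (min K (f x)) = f x"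
      using K[of x] R[of x] by (cases "norm x > R") (auto simp: cut_def)
    finally show ?thesis .
  qed
  have null: "AE x in lborel. x \<notin> N"
  proof -
    have "AE x in lebesgue. x \<notin> N"
      using N by (simp add: AE_not_in negligible_iff_null_sets)
    then show ?thesis
      by (simp add: AE_completion_iff)
  qed
  have "(\<lambda>n. \<integral>x. \<bar>f x - G n x\<bar> \<partial>lborel) \<longlonglongrightarrow> (\<integral>x. 0 \<partial>(lborel::'a measure))"
  proof (rule integral_dominated_convergence[where w = "\<lambda>x. 2 * K * indicator (cball 0 (R + 1)) x"])
    show "integrable lborel (\<lambda>x::'a. 2 * K * indicator (cball 0 (R + 1)) x :: real)"
      using emeasure_lborel_cball_finite[of "0::'a" "R + 1"]
      by (intro integrable_mult_right integrable_real_indicator) auto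
    show "AE x in lborel. (\<lambda>n. \<bar>f x - G n x\<bar>) \<longlonglongrightarrow> 0"
      using null
    proof eventually_elim
      case (elim x)
      show ?case
        using tendsto_rabs[OF tendsto_diff[OF tendsto_const limG[OF elim], of "f x"]] by simp
    qed
    show "AE x in lborel. norm \<bar>f x - G n x\<bar> \<le> 2 * K * indicator (cball 0 (R + 1)) x" for n
    proof (rule AE_I2)
      fix x
      show "norm \<bar>f x - G n x\<bar> \<le> 2 * K * indicator (cball 0 (R + 1)) x"
        using bound[of n x] K[of x] supp[of x n] R[of x] by (auto simp: indicator_def)
    qed
  qed auto
  then have "\<forall>\<^sub>F n in sequentially. (\<integral>x. \<bar>f x - G n x\<bar> \<partial>lborel) < e"
    using \<open>e > 0\<close> by (intro order_tendstoD(2)) auto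
  then obtain n where n: "(\<integral>x. \<bar>f x - G n x\<bar> \<partial>lborel) < e"
    by (auto simp: eventually_sequentially)
  have "integrable lborel (\<lambda>x. \<bar>f x - G n x\<bar>)"
    by (intro integrable_abs Bochner_Integration.integrable_diff integrable_bounded_support[OF _ K R]
          integrable_bounded_support[OF _ bound supp]) auto
  then have "(\<integral>\<^sup>+x. ennreal \<bar>f x - G n x\<bar> \<partial>lborel) < ennreal e"
    using n by (subst nn_integral_eq_integral) (auto simp: ennreal_less_iff)
  then show thesis
    using that cont supp by blast
qed

text \<open>Truncation at height \<open>n\<close> reduces to bounded functions; the truncations
  converge in L^1 by domination.\<close>

lemma L1_approx_continuous:
  fixes f :: "'a::euclidean_space \<Rightarrow> real"
  assumes f: "integrable lborel f"
    and R: "\<And>x. norm x > R \<Longrightarrow> f x = 0" and "e > 0"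
  obtains g where "continuous_on UNIV g" "\<And>x. norm x > R + 1 \<Longrightarrow> g x = 0"
    "(\<integral>\<^sup>+x. ennreal \<bar>f x - g x\<bar> \<partial>lborel) < ennreal e"
proof -
  have [measurable]: "f \<in> borel_measurable borel"
    using f by auto
  define F where "F n x = max (- real n) (min (real n) (f x))" for n x
  have "(\<lambda>n. \<integral>x. \<bar>f x - F n x\<bar> \<partial>lborel) \<longlonglongrightarrow> (\<integral>x. 0 \<partial>(lborel::'a measure))"
  proof (rule integral_dominated_convergence[where w = "\<lambda>x. \<bar>f x\<bar>"])
    have "\<forall>\<^sub>F n in sequentially. \<bar>f x - F n x\<bar> = 0" for x
    proof -
      obtain n where "\<bar>f x\<bar> \<le> real n"
        using real_arch_simple by blast
      then show ?thesis
        by (auto simp: eventually_sequentially F_def intro!: exI[of _ n])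
    qed
    then have "(\<lambda>n. \<bar>f x - F n x\<bar>) \<longlonglongrightarrow> 0" for x
      by (rule tendsto_eventually)
    then show "AE x in lborel. (\<lambda>n. \<bar>f x - F n x\<bar>) \<longlonglongrightarrow> 0"
      by simp
  qed (use f in \<open>auto simp: F_def\<close>)
  then have "\<forall>\<^sub>F n in sequentially. (\<integral>x. \<bar>f x - F n x\<bar> \<partial>lborel) < e / 2"
    using \<open>e > 0\<close> by (intro order_tendstoD(2)) auto
  then obtain n where n: "(\<integral>x. \<bar>f x - F n x\<bar> \<partial>lborel) < e / 2"
    by (auto simp: eventually_sequentially)
  have [measurable]: "F n \<in> borel_measurable borel"
    unfolding F_def by measurable
  have FK: "\<bar>F n x\<bar> \<le> real n" and FR: "norm x > R \<Longrightarrow> F n x = 0" for x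
    using R[of x] by (auto simp: F_def)
  obtain g where g: "continuous_on UNIV g" "\<And>x. norm x > R + 1 \<Longrightarrow> g x = 0"
    "(\<integral>\<^sup>+x. ennreal \<bar>F n x - g x\<bar> \<partial>lborel) < ennreal (e / 2)"
    by (rule L1_approx_continuous_bounded[of "F n" "real n" R "e / 2"]) (use FK FR \<open>e > 0\<close> in auto)
  have [measurable]: "g \<in> borel_measurable borel"
    using g(1) by (rule borel_measurable_continuous_onI)
  have "integrable lborel (\<lambda>x. \<bar>f x - F n x\<bar>)"
    by (intro integrable_abs Bochner_Integration.integrable_diff f integrable_bounded_support[OF _ FK FR]) auto
  then have 1: "(\<integral>\<^sup>+x. ennreal \<bar>f x - F n x\<bar> \<partial>lborel) < ennreal (e / 2)"
    using n by (subst nn_integral_eq_integral) (auto simp: ennreal_less_iff)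
  have "(\<integral>\<^sup>+x. ennreal \<bar>f x - g x\<bar> \<partial>lborel) \<le> (\<integral>\<^sup>+x. ennreal \<bar>f x - F n x\<bar> + ennreal \<bar>F n x - g x\<bar> \<partial>lborel)"
    by (intro nn_integral_mono) (auto simp: ennreal_plus[symmetric] simp del: ennreal_plus intro!: ennreal_leI)
  also have "\<dots> = (\<integral>\<^sup>+x. ennreal \<bar>f x - F n x\<bar> \<partial>lborel) + (\<integral>\<^sup>+x. ennreal \<bar>F n x - g x\<bar> \<partial>lborel)"
    by (rule nn_integral_add) auto
  also have "\<dots> < ennreal (e / 2) + ennreal (e / 2)"
    using 1 g(3) by (rule add_strict_mono)
  also have "\<dots> = ennreal e"
    using \<open>e > 0\<close> by (simp add: ennreal_plus[symmetric] del: ennreal_plus)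
  finally show thesis
    using that g by blast
qed

lemma L1_translation_continuous:
  fixes f :: "'a::euclidean_space \<Rightarrow> real"
  assumes f: "integrable lborel f" and R: "\<And>x. norm x > R \<Longrightarrow> f x = 0" and "e > 0"
  obtains d where "d > 0" "\<And>y. norm y < d \<Longrightarrow> (\<integral>\<^sup>+x. ennreal \<bar>f (x + y) - f x\<bar> \<partial>lborel) \<le> ennreal e"
proof -
  have [measurable]: "f \<in> borel_measurable borel"
    using f by auto
  obtain g where g: "continuous_on UNIV g" "\<And>x. norm x > R + 1 \<Longrightarrow> g x = 0"
    "(\<integral>\<^sup>+x. ennreal \<bar>f x - g x\<bar> \<partial>lborel) < ennreal (e / 3)"
    using L1_approx_continuous[OF f R, where e = "e / 3"] \<open>e > 0\<close> by auto
  have [measurable]: "g \<in> borel_measurable borel"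
    using g(1) by (rule borel_measurable_continuous_onI)
  have [measurable]: "cball (0::'a) (R + 2) \<in> sets borel"
    by auto
  define v where "v = measure lborel (cball (0::'a) (R + 2))"
  have v: "v \<ge> 0" "emeasure lborel (cball (0::'a) (R + 2)) = ennreal v"
    using emeasure_lborel_cball_finite[of "0::'a" "R + 2"]
    by (auto simp: v_def emeasure_eq_ennreal_measure less_top)
  \<comment> \<open>For \<open>norm y < 1\<close> the difference \<open>g (x + y) - g x\<close>
    vanishes unless \<open>norm x \<le> R + 2\<close>, so a uniform error \<open>\<epsilon>\<close>
    contributes at most \<open>\<epsilon> * v\<close>. Both points then lie in the ball of radius
    \<open>R + 3\<close>. The \<open>+ 1\<close> keeps the quotient meaningful when
    \<open>v = 0\<close>.\<close>
  define \<epsilon> where "\<epsilon> = e / 3 / (v + 1)"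
  have \<epsilon>: "\<epsilon> > 0" "\<epsilon> * v \<le> e / 3"
    using v(1) \<open>e > 0\<close> by (auto simp: \<epsilon>_def field_simps)
  have "uniformly_continuous_on (cball 0 (R + 3)) g"
    using g(1) continuous_on_subset by (intro compact_uniformly_continuous) auto
  then obtain d0 where d0: "d0 > 0" "\<And>x y. norm x \<le> R + 3 \<Longrightarrow> norm y \<le> R + 3 \<Longrightarrow> dist y x < d0 \<Longrightarrow> \<bar>g y - g x\<bar> < \<epsilon>"
    using \<epsilon>(1) unfolding uniformly_continuous_on_def by (auto simp: dist_real_def)
  have "(\<integral>\<^sup>+x. ennreal \<bar>f (x + y) - f x\<bar> \<partial>lborel) \<le> ennreal e" if y: "norm y < min 1 d0" for y
  proof -
    have "(\<integral>\<^sup>+x. ennreal \<bar>f (x + y) - f x\<bar> \<partial>lborel) \<le>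
      (\<integral>\<^sup>+x. ennreal \<bar>f (x + y) - g (x + y)\<bar> + (ennreal \<bar>f x - g x\<bar> + ennreal \<epsilon> * indicator (cball 0 (R + 2)) x) \<partial>lborel)"
    proof (intro nn_integral_mono)
      fix x
      have "\<bar>g (x + y) - g x\<bar> \<le> \<epsilon> * indicator (cball 0 (R + 2)) x"
      proof (cases "norm x \<le> R + 2")
        case True
        then have "norm (x + y) \<le> R + 3"
          using y norm_triangle_ineq[of x y] by linarith
        then show ?thesis
          using d0(2)[of x "x + y"] y True by (simp add: dist_norm less_imp_le)
      next
        case False
        then have "norm (x + y) > R + 1"
          using y norm_triangle_ineq4[of "x + y" y] by simp
        then show ?thesis
          using g(2) False by simp
      qed
      then have "\<bar>f (x + y) - f x\<bar> \<le> \<bar>f (x + y) - g (x + y)\<bar> + (\<bar>f x - g x\<bar> + \<epsilon> * indicator (cball 0 (R + 2)) x)"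
        by linarith
      then have "ennreal \<bar>f (x + y) - f x\<bar> \<le> ennreal (\<bar>f (x + y) - g (x + y)\<bar> + (\<bar>f x - g x\<bar> + \<epsilon> * indicator (cball 0 (R + 2)) x))"
        by (rule ennreal_leI)
      also have "\<dots> = ennreal \<bar>f (x + y) - g (x + y)\<bar> + (ennreal \<bar>f x - g x\<bar> + ennreal \<epsilon> * indicator (cball 0 (R + 2)) x)"
        using \<epsilon>(1) by (simp add: ennreal_mult ennreal_indicator)
      finally show "ennreal \<bar>f (x + y) - f x\<bar> \<le> \<dots>" .
    qed
    also have "\<dots> = (\<integral>\<^sup>+x. ennreal \<bar>f (x + y) - g (x + y)\<bar> \<partial>lborel) +
        (\<integral>\<^sup>+x. ennreal \<bar>f x - g x\<bar> + ennreal \<epsilon> * indicator (cball 0 (R + 2)) x \<partial>lborel)"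
      by (rule nn_integral_add) measurable
    also have "(\<integral>\<^sup>+x. ennreal \<bar>f x - g x\<bar> + ennreal \<epsilon> * indicator (cball 0 (R + 2)) x \<partial>lborel) =
        (\<integral>\<^sup>+x. ennreal \<bar>f x - g x\<bar> \<partial>lborel) + (\<integral>\<^sup>+x. ennreal \<epsilon> * indicator (cball (0::'a) (R + 2)) x \<partial>lborel)"
      by (rule nn_integral_add) measurable
    also have "(\<integral>\<^sup>+x. ennreal \<epsilon> * indicator (cball (0::'a) (R + 2)) x \<partial>lborel) = ennreal \<epsilon> * ennreal v"
      by (simp add: nn_integral_cmult v(2))
    also have "(\<integral>\<^sup>+x. ennreal \<bar>f (x + y) - g (x + y)\<bar> \<partial>lborel) = (\<integral>\<^sup>+x. ennreal \<bar>f x - g x\<bar> \<partial>lborel)"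
      by (rule nn_integral_lborel_shift[where f = "\<lambda>x. ennreal \<bar>f x - g x\<bar>"]) simp
    also have "(\<integral>\<^sup>+x. ennreal \<bar>f x - g x\<bar> \<partial>lborel) + ((\<integral>\<^sup>+x. ennreal \<bar>f x - g x\<bar> \<partial>lborel) + ennreal \<epsilon> * ennreal v)
      \<le> ennreal (e / 3) + (ennreal (e / 3) + ennreal (e / 3))"
      using g(3) \<epsilon> v(1) by (intro add_mono) (auto simp: ennreal_mult[symmetric] intro!: ennreal_leI)
    also have "\<dots> = ennreal e"
      using \<open>e > 0\<close> by (simp add: ennreal_plus[symmetric] del: ennreal_plus)
    finally show ?thesis .
  qed
  then show thesis
    using d0(1) by (intro that[of "min 1 d0"]) auto
qed

text \<open>A mollified function is an average of translates with weights \<open>\<kappa>\<close>.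
  Tonelli's theorem moves the L^1 norm inside the average, where only translations with
  \<open>\<kappa> y \<noteq> 0\<close> count. The bound \<open>K\<close> makes the product
  integrable for every \<open>x\<close>.\<close>

lemma mollifier_L1_le:
  fixes f :: "'a::euclidean_space \<Rightarrow> real"
  assumes f: "integrable lborel f"
    and \<kappa>: "integrable lborel \<kappa>" "\<And>y. \<kappa> y \<ge> 0" "(\<integral>y. \<kappa> y \<partial>lborel) = 1" "\<And>y. \<bar>\<kappa> y\<bar> \<le> K"
    and d: "\<And>y. \<kappa> y \<noteq> 0 \<Longrightarrow> (\<integral>\<^sup>+x. ennreal \<bar>f (x + y) - f x\<bar> \<partial>lborel) \<le> ennreal e"
  shows "(\<integral>\<^sup>+x. ennreal \<bar>(\<integral>y. f (x + y) * \<kappa> y \<partial>lborel) - f x\<bar> \<partial>lborel) \<le> ennreal e"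
proof -
  have [measurable]: "f \<in> borel_measurable borel" "\<kappa> \<in> borel_measurable borel"
    using f \<kappa>(1) by auto
  have int: "integrable lborel (\<lambda>y. f (x + y) * \<kappa> y)" for x
    using integrable_mult_bounded[OF integrable_lborel_shift[OF f, of x] _ \<kappa>(4)] by (simp add: add.commute)
  have "(\<integral>\<^sup>+x. ennreal \<bar>(\<integral>y. f (x + y) * \<kappa> y \<partial>lborel) - f x\<bar> \<partial>lborel) \<le>
    (\<integral>\<^sup>+x. \<integral>\<^sup>+y. ennreal \<bar>f (x + y) - f x\<bar> * ennreal (\<kappa> y) \<partial>lborel \<partial>lborel)"
  proof (intro nn_integral_mono)
    fix x
    have "(\<integral>y. f (x + y) * \<kappa> y \<partial>lborel) - f x = (\<integral>y. f (x + y) * \<kappa> y - f x * \<kappa> y \<partial>lborel)"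
      using int \<kappa> by (subst Bochner_Integration.integral_diff) auto
    also have "\<dots> = (\<integral>y. (f (x + y) - f x) * \<kappa> y \<partial>lborel)"
      by (simp add: left_diff_distrib)
    finally have "ennreal \<bar>(\<integral>y. f (x + y) * \<kappa> y \<partial>lborel) - f x\<bar> = ennreal (norm (\<integral>y. (f (x + y) - f x) * \<kappa> y \<partial>lborel))"
      by simp
    also have "\<dots> \<le> (\<integral>\<^sup>+y. ennreal (norm ((f (x + y) - f x) * \<kappa> y)) \<partial>lborel)"
      using int[of x] \<kappa>(1) by (intro integral_norm_bound_ennreal) (auto simp: left_diff_distrib)
    also have "\<dots> = (\<integral>\<^sup>+y. ennreal \<bar>f (x + y) - f x\<bar> * ennreal (\<kappa> y) \<partial>lborel)"
      using \<kappa>(2) by (simp add: abs_mult ennreal_mult)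
    finally show "ennreal \<bar>(\<integral>y. f (x + y) * \<kappa> y \<partial>lborel) - f x\<bar> \<le> \<dots>" .
  qed
  also have "\<dots> = (\<integral>\<^sup>+y. \<integral>\<^sup>+x. ennreal \<bar>f (x + y) - f x\<bar> * ennreal (\<kappa> y) \<partial>lborel \<partial>lborel)"
    by (rule lborel_pair.Fubini') simp
  also have "\<dots> \<le> (\<integral>\<^sup>+y. ennreal e * ennreal (\<kappa> y) \<partial>lborel)"
  proof (intro nn_integral_mono)
    fix y
    show "(\<integral>\<^sup>+x. ennreal \<bar>f (x + y) - f x\<bar> * ennreal (\<kappa> y) \<partial>lborel) \<le> ennreal e * ennreal (\<kappa> y)"
      using d[of y] by (cases "\<kappa> y = 0") (auto simp: nn_integral_multc intro!: mult_right_mono)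
  qed
  also have "\<dots> = ennreal e"
    using \<kappa> by (simp add: nn_integral_cmult nn_integral_eq_integral)
  finally show ?thesis .
qed

text \<open>The translation acts on \<open>\<psi>\<close>, so the derivative falls on
  \<open>\<psi>\<close> and never on \<open>f\<close>. The mean value inequality bounds the
  difference quotients by \<open>K\<close>, and dominated convergence applies.\<close>

lemma has_real_derivative_integral_translate:
  fixes f \<psi> :: "'a::euclidean_space \<Rightarrow> real"
  assumes f: "integrable lborel f" and \<psi>: "smooth \<psi>"
    and K: "\<And>x. \<bar>\<psi> x\<bar> \<le> K" "\<And>x. \<bar>frechet_derivative \<psi> (at x) v\<bar> \<le> K"
  shows "((\<lambda>t. \<integral>y. f y * \<psi> (y - t *\<^sub>R v) \<partial>lborel) has_real_derivative
    - (\<integral>y. f y * frechet_derivative \<psi> (at (y - t *\<^sub>R v)) v \<partial>lborel)) (at t)"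
proof -
  have [measurable]: "f \<in> borel_measurable borel" "\<psi> \<in> borel_measurable borel"
    using f \<psi> by (auto intro!: borel_measurable_continuous_onI smooth_continuous_on)
  have deriv: "((\<lambda>t. \<psi> (y - t *\<^sub>R v)) has_real_derivative - frechet_derivative \<psi> (at (y - t *\<^sub>R v)) v) (at t)" for y t
  proof -
    have "((\<lambda>t. \<psi> (y - t *\<^sub>R v)) has_derivative (\<lambda>s. frechet_derivative \<psi> (at (y - t *\<^sub>R v)) (- (s *\<^sub>R v)))) (at t)"
      by (rule has_derivative_compose[OF _ smooth_has_derivative[OF \<psi>]]) (auto intro!: derivative_eq_intros)
    moreover have "frechet_derivative \<psi> (at (y - t *\<^sub>R v)) (- (s *\<^sub>R v)) = - frechet_derivative \<psi> (at (y - t *\<^sub>R v)) v * s" for s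
      using has_derivative_linear[OF smooth_has_derivative[OF \<psi>, of "y - t *\<^sub>R v"]]
      by (simp add: linear_neg linear_cmul)
    ultimately show ?thesis
      unfolding has_field_derivative_def by (auto elim!: has_derivative_eq_rhs)
  qed
  have int: "integrable lborel (\<lambda>y. f y * \<psi> (y - t *\<^sub>R v))" for t
    by (rule integrable_mult_bounded[OF f _ K(1)]) simp
  have lip: "\<bar>\<psi> (y - s *\<^sub>R v) - \<psi> (y - t *\<^sub>R v)\<bar> \<le> K * \<bar>s - t\<bar>" for y s
    using field_differentiable_bound[of UNIV "\<lambda>t. \<psi> (y - t *\<^sub>R v)" "\<lambda>t. - frechet_derivative \<psi> (at (y - t *\<^sub>R v)) v" K s t]
      deriv K(2) by (auto simp: norm_minus_commute has_field_derivative_at_within)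
  show ?thesis
    unfolding has_field_derivative_iff tendsto_at_iff_sequentially comp_def
  proof (intro allI impI)
    fix X :: "nat \<Rightarrow> real"
    assume X: "\<forall>i. X i \<in> UNIV - {t}" "X \<longlonglongrightarrow> t"
    let ?q = "\<lambda>n y. (\<psi> (y - X n *\<^sub>R v) - \<psi> (y - t *\<^sub>R v)) / (X n - t)"
    have lim: "(\<lambda>n. f y * ?q n y) \<longlonglongrightarrow> f y * - frechet_derivative \<psi> (at (y - t *\<^sub>R v)) v" for y
      using deriv[of y t, unfolded has_field_derivative_iff tendsto_at_iff_sequentially comp_def] X
      by (intro tendsto_mult_left) auto
    \<comment> \<open>Measurability of the limit integrand is inherited from the difference
      quotients.\<close>
    have meas: "(\<lambda>y. f y * - frechet_derivative \<psi> (at (y - t *\<^sub>R v)) v) \<in> borel_measurable borel"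
      by (rule borel_measurable_LIMSEQ_metric[OF _ lim]) measurable
    have "(\<lambda>n. \<integral>y. f y * ?q n y \<partial>lborel) \<longlonglongrightarrow> (\<integral>y. f y * - frechet_derivative \<psi> (at (y - t *\<^sub>R v)) v \<partial>lborel)"
    proof (rule integral_dominated_convergence[where w = "\<lambda>y. K * \<bar>f y\<bar>"])
      show "AE y in lborel. norm (f y * ?q n y) \<le> K * \<bar>f y\<bar>" for n
      proof (rule AE_I2)
        fix y
        have "\<bar>?q n y\<bar> \<le> K"
          using lip[of y "X n"] X(1) by (simp add: abs_divide divide_le_eq)
        then show "norm (f y * ?q n y) \<le> K * \<bar>f y\<bar>"
          by (simp add: abs_mult mult.commute[of K] mult_left_mono del: abs_divide times_divide_eq_right)
      qed
    qed (use f meas lim in auto)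
    moreover have "(\<integral>y. f y * ?q n y \<partial>lborel) =
        ((\<integral>y. f y * \<psi> (y - X n *\<^sub>R v) \<partial>lborel) - (\<integral>y. f y * \<psi> (y - t *\<^sub>R v) \<partial>lborel)) / (X n - t)" for n
      by (subst Bochner_Integration.integral_diff[OF int int, symmetric])
         (simp add: right_diff_distrib diff_divide_distrib flip: integral_divide_zero)
    ultimately show "(\<lambda>n. ((\<integral>y. f y * \<psi> (y - X n *\<^sub>R v) \<partial>lborel) - (\<integral>y. f y * \<psi> (y - t *\<^sub>R v) \<partial>lborel)) / (X n - t))
        \<longlonglongrightarrow> - (\<integral>y. f y * frechet_derivative \<psi> (at (y - t *\<^sub>R v)) v \<partial>lborel)"
      by (simp only: mult_minus_right Bochner_Integration.integral_minus)
  qed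
qed

section \<open>Domains stable under translation by a cone\<close>

lemma test_functionsI:
  assumes "smooth \<phi>" "compact K" "K \<subseteq> \<Omega>" "\<And>x. x \<notin> K \<Longrightarrow> \<phi> x = 0"
  shows "\<phi> \<in> test_functions \<Omega>"
proof -
  have "{x. \<phi> x \<noteq> 0} \<subseteq> K"
    using assms(4) by auto
  then have sub: "closure {x. \<phi> x \<noteq> 0} \<subseteq> K"
    using assms(2) by (simp add: closure_minimal compact_imp_closed)
  then have "compact (closure {x. \<phi> x \<noteq> 0})"
    using compact_Int_closed[OF assms(2), of "closure {x. \<phi> x \<noteq> 0}"] by (simp add: Int_absorb1)
  then show ?thesis
    using assms sub by (auto simp: test_functions_def smooth_def)
qed

lemma test_functionsD:
  assumes "\<phi> \<in> test_functions \<Omega>"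
  shows "smooth \<phi>" "compact (closure {x. \<phi> x \<noteq> 0})" "closure {x. \<phi> x \<noteq> 0} \<subseteq> \<Omega>"
  using assms by (auto simp: test_functions_def smooth_def)

lemma eq_0_outside_support: "x \<notin> closure {x. \<phi> x \<noteq> 0} \<Longrightarrow> \<phi> x = 0"
  using closure_subset[of "{x. \<phi> x \<noteq> 0}"] by auto

lemma frechet_derivative_eq_0_outside:
  assumes "closed K" "\<And>x. x \<notin> K \<Longrightarrow> \<phi> x = c" "x \<notin> K"
  shows "frechet_derivative \<phi> (at x) = (\<lambda>_. 0)"
proof -
  have "(\<phi> has_derivative (\<lambda>_. 0)) (at x)"
    by (rule has_derivative_transform_within_open[where f = "\<lambda>_. c" and s = "- K"]) (use assms in auto)
  then show ?thesis
    using frechet_derivative_at by metis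
qed

text \<open>The outer value is an arbitrary constant \<open>c\<close> because the cutoff that
  removes a neighbourhood of the boundary equals a positive constant, not 0, far away.\<close>

lemma partial_deriv_bounded_if_constant_outside:
  assumes "smooth \<phi>" "compact K" "\<And>x. x \<notin> K \<Longrightarrow> \<phi> x = c" "i \<in> Basis"
  obtains B where "B \<ge> 0" "\<And>x. \<bar>partial_deriv \<phi> i x\<bar> \<le> B"
proof -
  have "bounded (partial_deriv \<phi> i ` K)"
    using smooth_partial_deriv[OF assms(1,4)] assms(2)
    by (intro compact_imp_bounded compact_continuous_image smooth_continuous_on)
  then obtain B where "B > 0" "\<And>x. x \<in> K \<Longrightarrow> \<bar>partial_deriv \<phi> i x\<bar> \<le> B"
    unfolding bounded_pos by auto
  moreover have "partial_deriv \<phi> i x = 0" if "x \<notin> K" for x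
    using frechet_derivative_eq_0_outside[OF compact_imp_closed[OF assms(2)] assms(3) that] by simp
  ultimately show thesis
    using that[of B] by (metis abs_zero less_imp_le)
qed

lemma partial_derivs_bounded_if_constant_outside:
  fixes \<phi> :: "'a::euclidean_space \<Rightarrow> real"
  assumes "smooth \<phi>" "compact K" "\<And>x. x \<notin> K \<Longrightarrow> \<phi> x = c"
  obtains B where "B \<ge> 0" "\<And>x i. i \<in> Basis \<Longrightarrow> \<bar>partial_deriv \<phi> i x\<bar> \<le> B"
proof -
  have "\<forall>i\<in>Basis. \<exists>B\<ge>0. \<forall>x. \<bar>partial_deriv \<phi> i x\<bar> \<le> B"
    using partial_deriv_bounded_if_constant_outside[OF assms] by metis
  then obtain B where B: "\<And>i. i \<in> Basis \<Longrightarrow> B i \<ge> 0" "\<And>i x. i \<in> Basis \<Longrightarrow> \<bar>partial_deriv \<phi> i x\<bar> \<le> B i"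
    by metis
  show thesis
  proof
    show "(\<Sum>i\<in>(Basis::'a set). B i) \<ge> 0"
      using B(1) by (rule sum_nonneg)
    show "\<bar>partial_deriv \<phi> i x\<bar> \<le> (\<Sum>i\<in>Basis. B i)" if "i \<in> Basis" for i x
      using B(2)[OF that, of x] member_le_sum[OF that, of B] B(1) by force
  qed
qed

lemma test_function_partials_bounded:
  assumes "\<phi> \<in> test_functions G"
  obtains B where "\<And>x i. i \<in> Basis \<Longrightarrow> \<bar>partial_deriv \<phi> i x\<bar> \<le> B"
  using partial_derivs_bounded_if_constant_outside[of \<phi> "closure {x. \<phi> x \<noteq> 0}" 0]
    test_functionsD[OF assms] eq_0_outside_support[of _ \<phi>] by metis

lemma smooth_frechet_derivative_sum:
  assumes "smooth \<phi>"
  shows "frechet_derivative \<phi> (at x) v = (\<Sum>j\<in>Basis. (v \<bullet> j) * partial_deriv \<phi> j x)"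
proof -
  have lin: "linear (frechet_derivative \<phi> (at x))"
    using smooth_has_derivative[OF assms] by (rule has_derivative_linear)
  have "frechet_derivative \<phi> (at x) v = frechet_derivative \<phi> (at x) (\<Sum>j\<in>Basis. (v \<bullet> j) *\<^sub>R j)"
    by (simp add: euclidean_representation)
  then show ?thesis
    using lin by (simp add: linear_sum linear_cmul)
qed

lemma frechet_derivative_shift:
  assumes "smooth \<phi>"
  shows "frechet_derivative (\<lambda>y. \<phi> (y - a)) (at x) = frechet_derivative \<phi> (at (x - a))"
proof -
  have "((\<lambda>y. \<phi> (y - a)) has_derivative frechet_derivative \<phi> (at (x - a))) (at x)"
    by (rule has_derivative_compose[OF _ smooth_has_derivative[OF assms]]) (auto intro!: derivative_eq_intros)
  then show ?thesis
    using frechet_derivative_at by metis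
qed

lemma smooth_shift: "smooth \<phi> \<Longrightarrow> smooth (\<lambda>y. \<phi> (y - a))"
  using smooth_affine[of \<phi> 1 "- a"] by simp

text \<open>The dual description of a variation measure: every component of the gradient has total
  variation at most \<open>V\<close> on \<open>G\<close>. The integral runs over the whole space,
  but only the values of \<open>f\<close> on \<open>G\<close> enter, as \<open>\<phi>\<close> is
  supported there. Quantifying over all bounds \<open>M\<close> replaces the supremum norm.\<close>

definition weak_gradient_bound :: "'a::euclidean_space set \<Rightarrow> ('a \<Rightarrow> real) \<Rightarrow> real \<Rightarrow> bool" where
  "weak_gradient_bound G f V \<longleftrightarrow> (\<forall>\<phi>\<in>test_functions G. \<forall>i\<in>Basis. \<forall>M. (\<forall>x. \<bar>\<phi> x\<bar> \<le> M) \<longrightarrow>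
     \<bar>\<integral>x. f x * partial_deriv \<phi> i x \<partial>lborel\<bar> \<le> V * M)"

text \<open>The zero test function also admits the bound \<open>M = 1\<close>.\<close>

lemma weak_gradient_bound_nonneg:
  assumes "weak_gradient_bound (G :: 'a::euclidean_space set) f V" shows "V \<ge> 0"
proof -
  have "(\<lambda>_. 0) \<in> test_functions G"
    by (rule test_functionsI[where K = "{}"]) (auto simp: smooth_const)
  moreover obtain i :: 'a where "i \<in> Basis"
    using nonempty_Basis by blast
  ultimately have "\<bar>\<integral>x. f x * partial_deriv (\<lambda>_. 0) i x \<partial>lborel\<bar> \<le> V * 1"
    using assms unfolding weak_gradient_bound_def by (metis abs_zero zero_le_one)
  then show ?thesis
    using abs_ge_zero order_trans by fastforce
qed

text \<open>Expansion of \<open>v\<close> in the standard basis; bounding each coordinate by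
  \<open>norm v\<close> produces the factor \<open>DIM('a)\<close>.\<close>

lemma weak_gradient_bound_direction:
  fixes f :: "'a::euclidean_space \<Rightarrow> real"
  assumes f: "integrable lborel f" and bd: "weak_gradient_bound G f V"
    and \<phi>: "\<phi> \<in> test_functions G" "\<And>x. \<bar>\<phi> x\<bar> \<le> M"
  shows "\<bar>\<integral>x. f x * frechet_derivative \<phi> (at x) v \<partial>lborel\<bar> \<le> real DIM('a) * norm v * (V * M)"
proof -
  note \<phi>D = test_functionsD[OF \<phi>(1)]
  obtain B where B: "\<And>x i. i \<in> Basis \<Longrightarrow> \<bar>partial_deriv \<phi> i x\<bar> \<le> B"
    using test_function_partials_bounded[OF \<phi>(1)] by blast
  have int: "integrable lborel (\<lambda>x. f x * partial_deriv \<phi> i x)" if "i \<in> Basis" for i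
    using smooth_partial_deriv[OF \<phi>D(1) that] B[OF that]
    by (intro integrable_mult_bounded f borel_measurable_continuous_onI smooth_continuous_on)
  have "(\<integral>x. f x * frechet_derivative \<phi> (at x) v \<partial>lborel) =
      (\<integral>x. (\<Sum>j\<in>Basis. (v \<bullet> j) * (f x * partial_deriv \<phi> j x)) \<partial>lborel)"
    by (simp add: smooth_frechet_derivative_sum[OF \<phi>D(1), of _ v] sum_distrib_left mult.left_commute)
  also have "\<dots> = (\<Sum>j\<in>Basis. (v \<bullet> j) * (\<integral>x. f x * partial_deriv \<phi> j x \<partial>lborel))"
    using int by (subst Bochner_Integration.integral_sum) auto
  also have "\<bar>\<dots>\<bar> \<le> (\<Sum>j\<in>Basis. \<bar>(v \<bullet> j) * (\<integral>x. f x * partial_deriv \<phi> j x \<partial>lborel)\<bar>)"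
    by (rule sum_abs)
  also have "\<dots> \<le> (\<Sum>j\<in>(Basis::'a set). norm v * (V * M))"
    using bd \<phi> unfolding weak_gradient_bound_def abs_mult
    by (intro sum_mono mult_mono Basis_le_norm) auto
  finally show ?thesis by simp
qed

text \<open>The last increment, \<open>m = N\<close>, runs into the zero value
  \<open>g (N + 1)\<close>, so the increments add up to \<open>- g k\<close>.\<close>

lemma abs_le_sum_abs_diff_int:
  fixes g :: "int \<Rightarrow> real"
  assumes "k \<le> N" "g (N + 1) = 0"
  shows "\<bar>g k\<bar> \<le> (\<Sum>m\<in>{k..N}. \<bar>g (m + 1) - g m\<bar>)"
  using assms(1)
proof (induction k rule: int_le_induct)
  case base
  then show ?case using assms(2) by simp
next
  case (step k)
  have "{k - 1..N} = insert (k - 1) {k..N}"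
    using step.hyps by auto
  then show ?case
    using step.IH by simp
qed

text \<open>The cone is generated by \<open>ball w \<rho>\<close>. The centre may be 0, and then the
  cone is the whole space; the part of a function away from the boundary is treated by this
  instance.\<close>

locale cone_domain =
  fixes G :: "'a::euclidean_space set" and w :: 'a and \<rho> :: real
  assumes open_G: "open G" and rho_pos: "\<rho> > 0"
    and cone: "\<And>x z t. x \<in> G \<Longrightarrow> z \<in> ball w \<rho> \<Longrightarrow> t \<ge> 0 \<Longrightarrow> x + t *\<^sub>R z \<in> G"
begin

text \<open>The signs make the vectors \<open>edge i\<close>, which lie in the cone, linearly independent.\<close>

definition edge :: "'a \<Rightarrow> 'a" where
  "edge i = w + (if w \<bullet> i \<ge> 0 then \<rho> / 2 else - (\<rho> / 2)) *\<^sub>R i"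

section \<open>The skew lattice\<close>

definition skew :: "'a \<Rightarrow> 'a" where
  "skew z = (\<Sum>i\<in>Basis. (z \<bullet> i) *\<^sub>R edge i)"

lemma edge_in_cone: "i \<in> Basis \<Longrightarrow> edge i \<in> ball w \<rho>"
  using rho_pos by (auto simp: edge_def dist_norm)

lemma norm_edge: "i \<in> Basis \<Longrightarrow> norm (edge i) \<le> norm w + \<rho>"
  using edge_in_cone[of i] norm_triangle_ineq2[of "edge i" w] by (auto simp: dist_norm norm_minus_commute)

lemma linear_skew: "linear skew"
  unfolding skew_def
  by (intro linear_compose_sum ballI linearI) (auto simp: inner_add_left scaleR_add_left)

text \<open>The map is diagonal up to rank one: its value at \<open>z\<close> is S times
  \<open>w\<close> plus a diagonal map with entries \<open>s i\<close>, where S is the sum of the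
  coordinates of \<open>z\<close>. For a kernel vector, summing the coordinates gives S times (1
  plus the sum of all \<open>(w \<bullet> j) / s j\<close>) = 0. The signs in \<open>edge\<close>
  make every such quotient nonnegative, so S = 0 and hence \<open>z = 0\<close>.\<close>

lemma inj_skew: "inj skew"
proof -
  have "z = 0" if "skew z = 0" for z
  proof -
    define s where "s i = (if w \<bullet> i \<ge> 0 then \<rho> / 2 else - (\<rho> / 2))" for i
    define S where "S = (\<Sum>i\<in>Basis. z \<bullet> i)"
    have s: "s i \<noteq> 0" "(w \<bullet> i) / s i \<ge> 0" for i
      using rho_pos by (auto simp: s_def zero_le_divide_iff)
    have eq: "skew z = S *\<^sub>R w + (\<Sum>i\<in>Basis. (z \<bullet> i * s i) *\<^sub>R i)"
      by (simp add: skew_def edge_def s_def S_def scaleR_add_right sum.distrib scaleR_sum_left)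
    have "skew z \<bullet> j = S * (w \<bullet> j) + (z \<bullet> j) * s j" if "j \<in> Basis" for j
      using that unfolding eq by (simp add: inner_add_left inner_sum_left_Basis)
    then have "0 = S * (w \<bullet> j) + (z \<bullet> j) * s j" if "j \<in> Basis" for j
      using that \<open>skew z = 0\<close> by simp
    then have zj: "z \<bullet> j = - (S * ((w \<bullet> j) / s j))" if "j \<in> Basis" for j
      using s(1)[of j] that by (simp add: field_simps eq_neg_iff_add_eq_0)
    have "S = (\<Sum>j\<in>Basis. - (S * ((w \<bullet> j) / s j)))"
      unfolding S_def by (rule sum.cong[OF refl]) (use zj in \<open>simp add: S_def\<close>)
    then have "S * (1 + (\<Sum>j\<in>Basis. (w \<bullet> j) / s j)) = 0"
      unfolding sum_negf sum_distrib_left[symmetric] by (simp add: distrib_left)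
    moreover have "(\<Sum>j\<in>Basis. (w \<bullet> j) / s j) \<ge> 0"
      using s(2) by (intro sum_nonneg)
    ultimately have "S = 0" by auto
    then show "z = 0"
      using zj by (auto intro: euclidean_eqI)
  qed
  then show ?thesis
    by (simp add: linear_injective_0[OF linear_skew])
qed

text \<open>A lower bound for the injective linear map \<open>skew\<close>. It separates the nodes
  and forces them to leave every ball as their indices grow.\<close>

definition skew_const :: real where
  "skew_const = (SOME c. c > 0 \<and> (\<forall>z. c * norm z \<le> norm (skew z)))"

lemma skew_const: "skew_const > 0" "skew_const * norm z \<le> norm (skew z)"
proof -
  have "\<exists>c. c > 0 \<and> (\<forall>z. c * norm z \<le> norm (skew z))"
    using linear_inj_bounded_below_pos[OF linear_skew inj_skew] by metis
  from someI_ex[OF this] show "skew_const > 0" "skew_const * norm z \<le> norm (skew z)"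
    by (auto simp: skew_const_def)
qed

definition node :: "('a \<Rightarrow> int) \<Rightarrow> 'a" where
  "node k = (\<Sum>i\<in>Basis. of_int (k i) *\<^sub>R edge i)"

lemma node_eq_skew: "node k = skew (\<Sum>i\<in>Basis. of_int (k i) *\<^sub>R i)"
  by (simp add: node_def skew_def)

lemma node_upd: "i \<in> Basis \<Longrightarrow> node (k(i := m)) = node k + of_int (m - k i) *\<^sub>R edge i"
  by (simp add: node_def sum.remove[of Basis i] scaleR_diff_left)

lemma norm_node_ge: "i \<in> Basis \<Longrightarrow> skew_const * \<bar>of_int (k i)\<bar> \<le> norm (node k)"
proof -
  assume i: "i \<in> Basis"
  have "\<bar>of_int (k i)\<bar> \<le> norm (\<Sum>i\<in>Basis. of_int (k i) *\<^sub>R i :: 'a)"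
    using Basis_le_norm[OF i, of "\<Sum>i\<in>Basis. of_int (k i) *\<^sub>R i"] i by simp
  then have "skew_const * \<bar>of_int (k i)\<bar> \<le> skew_const * norm (\<Sum>i\<in>Basis. of_int (k i) *\<^sub>R i :: 'a)"
    using skew_const(1) by simp
  also have "\<dots> \<le> norm (node k)"
    unfolding node_eq_skew by (rule skew_const(2))
  finally show ?thesis .
qed

text \<open>The difference of two nodes is a node with a nonzero integer coordinate. Extensionality
  ensures that the index functions differ on \<open>Basis\<close>, the only place where
  \<open>node\<close> evaluates them.\<close>

lemma dist_node_ge:
  assumes "k \<in> extensional Basis" "k' \<in> extensional Basis" "k \<noteq> k'"
  shows "skew_const \<le> norm (node k - node k')"
proof -
  obtain i where i: "i \<in> Basis" "k i \<noteq> k' i"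
    using assms by (meson extensionalityI)
  have "node k - node k' = node (\<lambda>i. k i - k' i)"
    by (simp add: node_def sum_subtractf scaleR_diff_left)
  moreover have "skew_const * 1 \<le> skew_const * \<bar>of_int (k i - k' i)\<bar>"
    using i(2) skew_const(1) by (intro mult_left_mono) auto
  ultimately show ?thesis
    using norm_node_ge[OF i(1), of "\<lambda>i. k i - k' i"] by simp
qed

text \<open>Bounds the distance from a point of a lattice cell to the corner obtained by rounding
  its skew coordinates down.\<close>

definition cell_radius :: real where
  "cell_radius = (\<Sum>i\<in>(Basis::'a set). norm (edge i))"

lemma near_node:
  obtains k where "k \<in> extensional Basis" "norm (x - node k) \<le> cell_radius"
proof -
  have "surj skew"
    by (rule linear_injective_imp_surjective[OF linear_skew inj_skew]) simp
  then obtain z where z: "x = skew z"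
    by (metis surjD)
  define k where "k = restrict (\<lambda>i. \<lfloor>z \<bullet> i\<rfloor>) Basis"
  have "x - node k = (\<Sum>i\<in>Basis. (z \<bullet> i - of_int \<lfloor>z \<bullet> i\<rfloor>) *\<^sub>R edge i)"
    by (simp add: z skew_def node_def k_def sum_subtractf scaleR_diff_left)
  also have "norm \<dots> \<le> cell_radius"
    unfolding cell_radius_def
  proof (rule sum_norm_le)
    fix i :: 'a
    have "\<bar>z \<bullet> i - of_int \<lfloor>z \<bullet> i\<rfloor>\<bar> \<le> 1"
      by linarith
    then show "norm ((z \<bullet> i - of_int \<lfloor>z \<bullet> i\<rfloor>) *\<^sub>R edge i) \<le> norm (edge i)"
      by (simp add: mult_left_le_one_le)
  qed
  finally show thesis
    using that[of k] by (simp add: k_def)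
qed

text \<open>The bound \<open>\<rho> / 2\<close> keeps the closed support of the kernel inside
  \<open>ball w \<rho>\<close>; a third of \<open>skew_const\<close> keeps the supports around
  different nodes apart.\<close>

definition kernel_radius :: real where
  "kernel_radius = min (\<rho> / 2) (skew_const / 3)"

lemma kernel_radius: "kernel_radius > 0" "kernel_radius < \<rho>" "2 * kernel_radius < skew_const"
  using rho_pos skew_const(1) by (auto simp: kernel_radius_def)

text \<open>The kernel is centred at \<open>w\<close> instead of \<open>0\<close>, so that the value of \<open>mollify h f\<close> at a point of
  \<open>G\<close> only depends on \<open>f\<close> inside \<open>G\<close>.  It is not normalized.\<close>

abbreviation kernel :: "'a \<Rightarrow> real" where
  "kernel \<equiv> bump w kernel_radius"

definition mollify :: "real \<Rightarrow> ('a \<Rightarrow> real) \<Rightarrow> 'a \<Rightarrow> real" where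
  "mollify h f x = (\<integral>y. f y * kernel ((1 / h) *\<^sub>R (y - x)) \<partial>lborel)"

text \<open>By duality the sum is the variation of \<open>t \<mapsto> \<integral> f(y) \<psi>(y - t edge i) dy\<close> on \<open>[0, h]\<close> for a
  signed sum \<open>\<psi>\<close> of kernels around the nodes.  The kernels have disjoint supports, so that
  \<open>|\<psi>| \<le> 1\<close>, and their translates along the cone remain admissible test functions on \<open>G\<close>.\<close>

lemma sum_mollify_diff_le:
  assumes f: "integrable lborel f" and bd: "weak_gradient_bound G f V" and h: "h > 0"
    and K: "finite K" "K \<subseteq> extensional Basis" "\<And>k. k \<in> K \<Longrightarrow> x + h *\<^sub>R node k \<in> G" and i: "i \<in> Basis"
  shows "(\<Sum>k\<in>K. \<bar>mollify h f (x + h *\<^sub>R node k + h *\<^sub>R edge i) - mollify h f (x + h *\<^sub>R node k)\<bar>)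
    \<le> h * (real DIM('a) * (norm w + \<rho>) * V)"
proof -
  define p where "p k = x + h *\<^sub>R node k" for k
  \<comment> \<open>The signs turn the sum of absolute increments into an expression that is linear
    in \<open>f\<close>, so that it can be paired with one test function.\<close>
  define s where "s k = sgn (mollify h f (p k + h *\<^sub>R edge i) - mollify h f (p k))" for k
  define b where "b k y = kernel ((1 / h) *\<^sub>R (y - p k))" for k y
  define \<psi> where "\<psi> y = (\<Sum>k\<in>K. s k * b k y)" for y
  define D where "D t = (\<integral>y. f y * \<psi> (y - t *\<^sub>R edge i) \<partial>lborel)" for t
  have b_smooth: "smooth (b k)" for k
    unfolding b_def using smooth_affine[OF smooth_bump, of w kernel_radius "1 / h" "- ((1 / h) *\<^sub>R p k)"]
    by (simp add: scaleR_diff_right)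
  then have \<psi>_smooth: "smooth \<psi>"
    unfolding \<psi>_def by (intro smooth_sum smooth_mult smooth_const)
  have b_near: "norm (y - p k - h *\<^sub>R w) < h * kernel_radius" if "b k y \<noteq> 0" for k y
  proof -
    have "norm ((1 / h) *\<^sub>R (y - p k) - w) < kernel_radius"
      using that bump_eq_0_iff[of kernel_radius w] kernel_radius(1)
      by (auto simp: b_def dist_norm norm_minus_commute)
    moreover have "y - p k - h *\<^sub>R w = h *\<^sub>R ((1 / h) *\<^sub>R (y - p k) - w)"
      using h by (simp add: scaleR_diff_right)
    ultimately show ?thesis
      using h by simp
  qed
  \<comment> \<open>The supports have radius \<open>h * kernel_radius\<close>, and their centres are
    at least \<open>h * skew_const\<close> apart, which is more than twice this radius.\<close>
  have b_unique: "k = k'" if "k \<in> K" "k' \<in> K" "b k y \<noteq> 0" "b k' y \<noteq> 0" for k k' y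
  proof (rule ccontr)
    assume "k \<noteq> k'"
    then have "h * skew_const \<le> h * norm (node k - node k')"
      using that K(2) h by (intro mult_left_mono dist_node_ge) auto
    also have "\<dots> = norm (p k - p k')"
      using h by (simp add: p_def scaleR_diff_right[symmetric])
    also have "\<dots> \<le> norm (y - p k - h *\<^sub>R w) + norm (y - p k' - h *\<^sub>R w)"
      using norm_triangle_ineq4[of "y - p k' - h *\<^sub>R w" "y - p k - h *\<^sub>R w"] by simp
    also have "\<dots> < h * kernel_radius + h * kernel_radius"
      using that by (intro add_strict_mono b_near)
    also have "\<dots> = h * (2 * kernel_radius)"
      by simp
    finally show False
      using kernel_radius(3) h by simp
  qed
  have \<psi>_le: "\<bar>\<psi> y\<bar> \<le> 1" for y
  proof (cases "\<exists>k\<in>K. b k y \<noteq> 0")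
    case True
    then obtain k where k: "k \<in> K" "b k y \<noteq> 0" by blast
    then have "\<psi> y = (\<Sum>k\<in>{k}. s k * b k y)"
      unfolding \<psi>_def using K(1) b_unique by (intro sum.mono_neutral_right) auto
    then have "\<bar>\<psi> y\<bar> \<le> 1 * 1"
      using bump_nonneg[of w kernel_radius] bump_le_1[of w kernel_radius]
      by (simp add: abs_mult b_def s_def abs_sgn_eq)
    then show ?thesis by simp
  next
    case False
    then have "\<psi> y = 0"
      unfolding \<psi>_def by (intro sum.neutral) auto
    then show ?thesis by simp
  qed
  \<comment> \<open>A point of the translated support arises from some \<open>p k\<close> by moving
    \<open>t\<close> times along an edge and \<open>h\<close> times along a vector of
    \<open>ball w \<rho>\<close>. Both moves stay in \<open>G\<close>.\<close>
  have test: "(\<lambda>y. \<psi> (y - t *\<^sub>R edge i)) \<in> test_functions G" if "t \<ge> 0" for t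
  proof (rule test_functionsI)
    show "smooth (\<lambda>y. \<psi> (y - t *\<^sub>R edge i))"
      by (rule smooth_shift[OF \<psi>_smooth])
    let ?C = "\<Union>k\<in>K. cball (p k + t *\<^sub>R edge i + h *\<^sub>R w) (h * kernel_radius)"
    show "compact ?C"
      using K(1) by (intro compact_UN) auto
    show "?C \<subseteq> G"
    proof
      fix y assume "y \<in> ?C"
      then obtain k where k: "k \<in> K" "norm (y - (p k + t *\<^sub>R edge i + h *\<^sub>R w)) \<le> h * kernel_radius"
        by (auto simp: dist_norm norm_minus_commute)
      define z where "z = (1 / h) *\<^sub>R (y - p k - t *\<^sub>R edge i)"
      have "z - w = (1 / h) *\<^sub>R (y - (p k + t *\<^sub>R edge i + h *\<^sub>R w))"
        using h by (simp add: z_def algebra_simps)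
      then have "h * norm (z - w) = norm (y - (p k + t *\<^sub>R edge i + h *\<^sub>R w))"
        using h by simp
      then have "norm (z - w) \<le> kernel_radius"
        using k(2) h by (metis mult_le_cancel_left_pos)
      then have "z \<in> ball w \<rho>"
        using kernel_radius(2) by (simp add: dist_norm norm_minus_commute)
      then have "(p k + t *\<^sub>R edge i) + h *\<^sub>R z \<in> G"
        using K(3)[OF k(1), folded p_def] edge_in_cone[OF i] that h by (intro cone) auto
      then show "y \<in> G"
        using h by (simp add: z_def)
    qed
    show "\<psi> (y - t *\<^sub>R edge i) = 0" if "y \<notin> ?C" for y
    proof -
      have "b k (y - t *\<^sub>R edge i) = 0" if "k \<in> K" for k
      proof (rule ccontr)
        assume "b k (y - t *\<^sub>R edge i) \<noteq> 0"
        from b_near[OF this] have "norm (y - (p k + t *\<^sub>R edge i + h *\<^sub>R w)) \<le> h * kernel_radius"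
          by (simp add: algebra_simps)
        then show False
          using \<open>y \<notin> ?C\<close> that by (auto simp: dist_norm norm_minus_commute)
      qed
      then show ?thesis
        unfolding \<psi>_def by simp
    qed
  qed
  have \<psi>_test: "\<psi> \<in> test_functions G"
    using test[of 0] by simp
  obtain B where B: "\<And>y j. j \<in> Basis \<Longrightarrow> \<bar>partial_deriv \<psi> j y\<bar> \<le> B"
    using test_function_partials_bounded[OF \<psi>_test] by blast
  have B': "\<bar>frechet_derivative \<psi> (at y) (edge i)\<bar> \<le> (\<Sum>j\<in>(Basis::'a set). \<bar>edge i \<bullet> j\<bar> * B)" for y
    unfolding smooth_frechet_derivative_sum[OF \<psi>_smooth, of y "edge i"]
    by (rule order_trans[OF sum_abs sum_mono]) (auto simp: abs_mult intro!: mult_left_mono B)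
  \<comment> \<open>Differentiation under the integral asks for one common bound for
    \<open>\<psi>\<close>, where \<open>1\<close> serves, and for its directional
    derivative.\<close>
  let ?B = "max 1 (\<Sum>j\<in>(Basis::'a set). \<bar>edge i \<bullet> j\<bar> * B)"
  have deriv: "(D has_real_derivative - (\<integral>y. f y * frechet_derivative \<psi> (at (y - t *\<^sub>R edge i)) (edge i) \<partial>lborel)) (at t)" for t
    unfolding D_def
    by (rule has_real_derivative_integral_translate[OF f \<psi>_smooth, of ?B])
       (use \<psi>_le B' in \<open>auto simp: le_max_iff_disj\<close>)
  have deriv_le: "\<bar>- (\<integral>y. f y * frechet_derivative \<psi> (at (y - t *\<^sub>R edge i)) (edge i) \<partial>lborel)\<bar> \<le> real DIM('a) * (norm w + \<rho>) * V"
    if "t \<ge> 0" for t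
  proof -
    have "\<bar>\<integral>y. f y * frechet_derivative (\<lambda>y. \<psi> (y - t *\<^sub>R edge i)) (at y) (edge i) \<partial>lborel\<bar>
        \<le> real DIM('a) * norm (edge i) * (V * 1)"
      by (rule weak_gradient_bound_direction[OF f bd test[OF that] \<psi>_le])
    also have "\<dots> \<le> real DIM('a) * (norm w + \<rho>) * V"
      using norm_edge[OF i] weak_gradient_bound_nonneg[OF bd] by (auto intro!: mult_right_mono mult_left_mono)
    finally show ?thesis
      by (simp add: frechet_derivative_shift[OF \<psi>_smooth])
  qed
  \<comment> \<open>The derivative is controlled for \<open>t \<ge> 0\<close> only, hence the mean
    value inequality on the interval from 0 to \<open>h\<close>.\<close>
  have D_le: "norm (D h - D 0) \<le> real DIM('a) * (norm w + \<rho>) * V * norm (h - 0)"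
    by (rule field_differentiable_bound[of "{0..h}"])
       (use deriv deriv_le h in \<open>auto intro: has_field_derivative_at_within\<close>)
  have D_eq: "D t = (\<Sum>k\<in>K. s k * mollify h f (p k + t *\<^sub>R edge i))" for t
  proof -
    have "integrable lborel (\<lambda>y. f y * b k (y - t *\<^sub>R edge i))" for k
      by (rule integrable_mult_bounded[OF f, of _ 1])
         (auto simp: b_def bump_nonneg bump_le_1 intro!: borel_measurable_continuous_onI continuous_on_compose2[OF smooth_continuous_on[OF smooth_bump, of UNIV]] continuous_intros)
    then have "(\<integral>y. (\<Sum>k\<in>K. s k * (f y * b k (y - t *\<^sub>R edge i))) \<partial>lborel) =
        (\<Sum>k\<in>K. s k * (\<integral>y. f y * b k (y - t *\<^sub>R edge i) \<partial>lborel))"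
      by (subst Bochner_Integration.integral_sum) auto
    moreover have "b k (y - t *\<^sub>R edge i) = kernel ((1 / h) *\<^sub>R (y - (p k + t *\<^sub>R edge i)))" for k y
      by (simp add: b_def diff_diff_eq add.commute)
    ultimately show ?thesis
      by (simp add: D_def \<psi>_def mollify_def sum_distrib_left mult.left_commute)
  qed
  have "D h - D 0 = (\<Sum>k\<in>K. \<bar>mollify h f (p k + h *\<^sub>R edge i) - mollify h f (p k)\<bar>)"
    unfolding D_eq sum_subtractf[symmetric]
    by (intro sum.cong refl) (simp add: s_def abs_sgn algebra_simps)
  then show ?thesis
    using D_le h by (simp add: p_def mult.commute)
qed

end

section \<open>Lattice sums and averaging over translates of the lattice\<close>

abbreviation sobolev_exponent :: "'a::euclidean_space itself \<Rightarrow> real" where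
  "sobolev_exponent _ \<equiv> real DIM('a) / (real DIM('a) - 1)"

context cone_domain
begin

lemma sum_mollify_powr_le:
  fixes N :: int
  assumes dim: "DIM('a) \<ge> 2" and f: "integrable lborel f" and bd: "weak_gradient_bound G f V" and h: "h > 0"
    and supp: "\<And>k i. i \<in> Basis \<Longrightarrow> \<bar>k i\<bar> > N \<Longrightarrow> mollify h f (x + h *\<^sub>R node k) = 0"
  shows "(\<Sum>k\<in>Pi\<^sub>E Basis (\<lambda>_. {-N..N}). if x + h *\<^sub>R node k \<in> G
      then \<bar>mollify h f (x + h *\<^sub>R node k)\<bar> powr sobolev_exponent TYPE('a) else 0)
    \<le> (h * (real DIM('a) * (norm w + \<rho>) * V)) powr sobolev_exponent TYPE('a)"
proof -
  define p where "p k = x + h *\<^sub>R node k" for k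
  \<comment> \<open>At nodes outside \<open>G\<close> both \<open>F\<close> and \<open>D\<close> are
    0, so that the grid inequality can run over a full box. No increment is lost: from a node in
    \<open>G\<close> all later nodes in an edge direction lie in \<open>G\<close> as well.\<close>
  define F where "F k = (if p k \<in> G then \<bar>mollify h f (p k)\<bar> else 0)" for k
  define D where "D i k = (if p k \<in> G then \<bar>mollify h f (p k + h *\<^sub>R edge i) - mollify h f (p k)\<bar> else 0)" for i k
  let ?P = "Pi\<^sub>E Basis (\<lambda>_::'a. {-N..N})"
  have fin: "finite ?P"
    by (intro finite_PiE) auto
  have "F k \<le> (\<Sum>m\<in>{-N..N}. D i (k(i := m)))" if i: "i \<in> Basis" and k: "k \<in> ?P" for i k
  proof (cases "p k \<in> G")
    case False
    then show ?thesis
      by (simp add: F_def D_def sum_nonneg)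
  next
    case True
    have ki: "- N \<le> k i" "k i \<le> N"
      using k i by (auto simp: PiE_iff)
    define g where "g m = mollify h f (p (k(i := m)))" for m
    have "p (k(i := m)) = p k + (h * of_int (m - k i)) *\<^sub>R edge i" for m
      by (simp add: p_def node_upd[OF i] scaleR_add_right)
    then have in_G: "p (k(i := m)) \<in> G" if "k i \<le> m" for m
      using that True h edge_in_cone[OF i] cone by simp
    have step: "p (k(i := m + 1)) = p (k(i := m)) + h *\<^sub>R edge i" for m
      by (simp add: p_def node_upd[OF i] algebra_simps)
    have "g (N + 1) = 0"
      unfolding g_def p_def using ki by (intro supp[OF i]) simp
    then have "\<bar>g (k i)\<bar> \<le> (\<Sum>m\<in>{k i..N}. \<bar>g (m + 1) - g m\<bar>)"
      by (rule abs_le_sum_abs_diff_int[OF ki(2)])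
    also have "\<dots> = (\<Sum>m\<in>{k i..N}. D i (k(i := m)))"
      using in_G by (intro sum.cong refl) (simp add: g_def D_def step)
    also have "\<dots> \<le> (\<Sum>m\<in>{-N..N}. D i (k(i := m)))"
      using ki by (intro sum_mono2) (auto simp: D_def)
    finally show ?thesis
      using True by (simp add: g_def F_def)
  qed
  moreover have "(\<Sum>k\<in>?P. D i k) \<le> h * (real DIM('a) * (norm w + \<rho>) * V)" if i: "i \<in> Basis" for i
  proof -
    have "(\<Sum>k\<in>?P. D i k) = (\<Sum>k\<in>{k\<in>?P. p k \<in> G}. \<bar>mollify h f (p k + h *\<^sub>R edge i) - mollify h f (p k)\<bar>)"
      unfolding D_def by (rule sum.inter_filter[OF fin, symmetric])
    also have "\<dots> \<le> h * (real DIM('a) * (norm w + \<rho>) * V)"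
      unfolding p_def by (intro sum_mollify_diff_le f bd h i finite_subset[OF _ fin]) (auto simp: PiE_def)
    finally show ?thesis .
  qed
  ultimately have "(\<Sum>k\<in>?P. F k powr sobolev_exponent TYPE('a))
      \<le> (h * (real DIM('a) * (norm w + \<rho>) * V)) powr sobolev_exponent TYPE('a)"
    using dim by (intro discrete_gagliardo[where D = D]) (auto simp: D_def F_def)
  also have "(\<Sum>k\<in>?P. F k powr sobolev_exponent TYPE('a)) = (\<Sum>k\<in>?P. if x + h *\<^sub>R node k \<in> G
      then \<bar>mollify h f (x + h *\<^sub>R node k)\<bar> powr sobolev_exponent TYPE('a) else 0)"
    by (intro sum.cong refl) (simp add: F_def p_def)
  finally show ?thesis .
qed

lemma borel_measurable_kernel [measurable]: "kernel \<in> borel_measurable borel"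
  by (intro borel_measurable_continuous_onI smooth_continuous_on smooth_bump)

lemma borel_measurable_mollify [measurable]:
  assumes [measurable]: "f \<in> borel_measurable borel"
  shows "mollify h f \<in> borel_measurable borel"
  unfolding mollify_def[abs_def] by measurable

lemma kernel_scaled_eq_0:
  assumes "h > 0" "norm y > h * (norm w + kernel_radius)"
  shows "kernel ((1 / h) *\<^sub>R y) = 0"
proof -
  have "norm w + kernel_radius < norm ((1 / h) *\<^sub>R y)"
    using assms by (simp add: field_simps)
  then have "(1 / h) *\<^sub>R y \<notin> ball w kernel_radius"
    using norm_triangle_ineq2[of "(1 / h) *\<^sub>R y" w] by (auto simp: dist_norm norm_minus_commute)
  then show ?thesis
    using kernel_radius(1) by (subst bump_eq_0_iff) auto
qed

lemma mollify_eq_0: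
  assumes h: "h > 0" and R: "\<And>y. norm y > R \<Longrightarrow> f y = 0" and x: "norm x > R + h * (norm w + kernel_radius)"
  shows "mollify h f x = 0"
proof -
  have zero: "f y * kernel ((1 / h) *\<^sub>R (y - x)) = 0" for y
  proof (cases "norm y > R")
    case False
    then have "norm (y - x) > h * (norm w + kernel_radius)"
      using x norm_triangle_ineq2[of x y] by (simp add: norm_minus_commute)
    then show ?thesis
      using kernel_scaled_eq_0[OF h] by simp
  qed (simp add: R)
  show ?thesis
    unfolding mollify_def zero by simp
qed

text \<open>Balls of radius \<open>h * cell_radius\<close> around the nodes cover the support.
  Translating each of them to the origin turns the sum of the integrals over these balls into one
  integral, over shifts \<open>x\<close>, of lattice sums. The balls overlap, which only affects the
  constant.\<close>

lemma nn_integral_mollify_powr_le: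
  assumes dim: "DIM('a) \<ge> 2" and f: "integrable lborel f" and bd: "weak_gradient_bound G f V" and h: "h > 0"
    and R: "\<And>x. norm x > R \<Longrightarrow> f x = 0"
  shows "(\<integral>\<^sup>+x. indicator G x * ennreal (\<bar>mollify h f x\<bar> powr sobolev_exponent TYPE('a)) \<partial>lborel)
    \<le> ennreal (unit_ball_vol DIM('a) * (h * cell_radius) ^ DIM('a) *
        (h * (real DIM('a) * (norm w + \<rho>) * V)) powr sobolev_exponent TYPE('a))"
proof -
  let ?q = "sobolev_exponent TYPE('a)"
  let ?A = "(h * (real DIM('a) * (norm w + \<rho>) * V)) powr ?q"
  let ?B = "cball (0::'a) (h * cell_radius)"
  have [measurable]: "f \<in> borel_measurable borel" "G \<in> sets borel" "?B \<in> sets borel"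
    using f open_G by auto
  have cr: "cell_radius \<ge> 0"
    unfolding cell_radius_def by (simp add: sum_nonneg)
  define S where "S = R + h * (norm w + kernel_radius)"
  \<comment> \<open>Chosen so that a node with an index beyond \<open>N\<close>, even when shifted
    by a vector of \<open>?B\<close>, lies outside the ball of radius \<open>S\<close> that contains
    the support of the mollified function.\<close>
  define N where "N = \<lceil>(S + h * cell_radius) / (h * skew_const)\<rceil>"
  define H where "H x = indicator G x * ennreal (\<bar>mollify h f x\<bar> powr ?q)" for x
  have H_meas [measurable]: "H \<in> borel_measurable borel"
    unfolding H_def by measurable
  have supp: "mollify h f (x + h *\<^sub>R node k) = 0" if x: "norm x \<le> h * cell_radius" and i: "i \<in> Basis" "\<bar>k i\<bar> > N" for x k i
  proof (rule mollify_eq_0[OF h R])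
    have "(S + h * cell_radius) / (h * skew_const) \<le> of_int N"
      unfolding N_def by (rule le_of_int_ceiling)
    then have "S + h * cell_radius \<le> h * skew_const * of_int N"
      using h skew_const(1) by (simp add: pos_divide_le_eq mult.commute)
    also have "\<dots> < h * skew_const * \<bar>of_int (k i)\<bar>"
      using h skew_const(1) i(2) by (intro mult_strict_left_mono) auto
    also have "\<dots> \<le> norm (h *\<^sub>R node k)"
      using norm_node_ge[OF i(1), of k] h by simp
    also have "\<dots> \<le> norm (x + h *\<^sub>R node k) + norm x"
      using norm_triangle_ineq4[of "x + h *\<^sub>R node k" x] by simp
    finally show "R + h * (norm w + kernel_radius) < norm (x + h *\<^sub>R node k)"
      using x by (simp add: S_def)
  qed
  let ?P = "Pi\<^sub>E Basis (\<lambda>_::'a. {-N..N})"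
  have fin: "finite ?P"
    by (intro finite_PiE) auto
  have cover: "H x \<le> (\<Sum>k\<in>?P. indicator ?B (x - h *\<^sub>R node k) * H x)" for x
  proof (cases "mollify h f x = 0")
    case True
    then show ?thesis by (simp add: H_def)
  next
    case False
    obtain k where k: "k \<in> extensional Basis" "norm ((1 / h) *\<^sub>R x - node k) \<le> cell_radius"
      using near_node by blast
    have "norm (x - h *\<^sub>R node k) = norm (h *\<^sub>R ((1 / h) *\<^sub>R x - node k))"
      using h by (simp add: scaleR_diff_right)
    also have "\<dots> \<le> h * cell_radius"
      using k(2) h by simp
    finally have near: "norm (x - h *\<^sub>R node k) \<le> h * cell_radius" .
    have "\<bar>k i\<bar> \<le> N" if "i \<in> Basis" for i
      using supp[OF near that, of k] False by (cases "\<bar>k i\<bar> > N") auto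
    then have "k \<in> ?P"
      using k(1) by (auto simp: PiE_iff abs_le_iff minus_le_iff)
    then have "indicator ?B (x - h *\<^sub>R node k) * H x \<le> (\<Sum>k\<in>?P. indicator ?B (x - h *\<^sub>R node k) * H x)"
      using fin by (intro member_le_sum) auto
    then show ?thesis
      using near by simp
  qed
  have "(\<integral>\<^sup>+x. H x \<partial>lborel) \<le> (\<integral>\<^sup>+x. (\<Sum>k\<in>?P. indicator ?B (x - h *\<^sub>R node k) * H x) \<partial>lborel)"
    by (intro nn_integral_mono cover)
  also have "\<dots> = (\<Sum>k\<in>?P. \<integral>\<^sup>+x. indicator ?B (x - h *\<^sub>R node k) * H x \<partial>lborel)"
    by (rule nn_integral_sum) measurable
  also have "\<dots> = (\<Sum>k\<in>?P. \<integral>\<^sup>+x. indicator ?B x * H (x + h *\<^sub>R node k) \<partial>lborel)"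
  proof (rule sum.cong[OF refl])
    fix k
    show "(\<integral>\<^sup>+x. indicator ?B (x - h *\<^sub>R node k) * H x \<partial>lborel) = (\<integral>\<^sup>+x. indicator ?B x * H (x + h *\<^sub>R node k) \<partial>lborel)"
      using nn_integral_lborel_shift[of "\<lambda>x. indicator ?B (x - h *\<^sub>R node k) * H x" "h *\<^sub>R node k"] by simp
  qed
  also have "\<dots> = (\<integral>\<^sup>+x. (\<Sum>k\<in>?P. indicator ?B x * H (x + h *\<^sub>R node k)) \<partial>lborel)"
    by (rule nn_integral_sum[symmetric]) measurable
  also have "\<dots> \<le> (\<integral>\<^sup>+x. ennreal ?A * indicator ?B x \<partial>lborel)"
  proof (intro nn_integral_mono)
    fix x :: 'a
    show "(\<Sum>k\<in>?P. indicator ?B x * H (x + h *\<^sub>R node k)) \<le> ennreal ?A * indicator ?B x"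
    proof (cases "x \<in> ?B")
      case True
      have "(\<Sum>k\<in>?P. H (x + h *\<^sub>R node k)) = ennreal (\<Sum>k\<in>?P. if x + h *\<^sub>R node k \<in> G
          then \<bar>mollify h f (x + h *\<^sub>R node k)\<bar> powr ?q else 0)"
      proof -
        have "H y = ennreal (if y \<in> G then \<bar>mollify h f y\<bar> powr ?q else 0)" for y
          by (simp add: H_def)
        then show ?thesis
          by (simp only:) (rule sum_ennreal, simp)
      qed
      also have "\<dots> \<le> ennreal ?A"
        using True supp by (intro ennreal_leI sum_mollify_powr_le dim f bd h) auto
      finally show ?thesis
        using True by simp
    qed simp
  qed
  also have "\<dots> = ennreal ?A * emeasure lborel ?B"
    by (simp add: nn_integral_cmult_indicator)
  also have "\<dots> = ennreal (unit_ball_vol DIM('a) * (h * cell_radius) ^ DIM('a) * ?A)"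
    using h cr by (simp add: emeasure_cball ennreal_mult[symmetric] mult_ac)
  finally show ?thesis
    by (simp add: H_def)
qed

section \<open>Normalization of the kernel and the limit of vanishing mesh\<close>

definition kernel_mass :: "real \<Rightarrow> real" where
  "kernel_mass h = (\<integral>y. kernel ((1 / h) *\<^sub>R y) \<partial>lborel)"

text \<open>A lower bound of the kernel on the concentric ball of half the radius, times the volume
  of this ball.\<close>

definition mass_const :: real where
  "mass_const = exp_cutoff (kernel_radius\<^sup>2 - (kernel_radius / 2)\<^sup>2) * (unit_ball_vol DIM('a) * (kernel_radius / 2) ^ DIM('a))"

lemma integrable_kernel_scaled: "h > 0 \<Longrightarrow> integrable lborel (\<lambda>y. kernel ((1 / h) *\<^sub>R y))"
  by (rule integrable_bounded_support[where K = 1 and R = "h * (norm w + kernel_radius)"])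
     (auto simp: bump_nonneg bump_le_1 kernel_scaled_eq_0)

lemma mass_const_pos: "mass_const > 0"
proof -
  have "kernel_radius\<^sup>2 - (kernel_radius / 2)\<^sup>2 > 0"
    using kernel_radius(1) by (simp add: power2_eq_square field_simps)
  then have "exp_cutoff (kernel_radius\<^sup>2 - (kernel_radius / 2)\<^sup>2) > 0"
    by (simp add: exp_cutoff_def)
  then show ?thesis
    using kernel_radius(1) by (simp add: mass_const_def)
qed

lemma kernel_mass_ge:
  assumes h: "h > 0" shows "kernel_mass h \<ge> mass_const * h ^ DIM('a)"
proof -
  let ?c = "exp_cutoff (kernel_radius\<^sup>2 - (kernel_radius / 2)\<^sup>2)"
  let ?B = "cball (h *\<^sub>R w) (h * (kernel_radius / 2))"
  have "mass_const * h ^ DIM('a) = (\<integral>y. ?c * indicator ?B y \<partial>lborel)"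
    using h kernel_radius(1) by (simp add: content_cball mass_const_def power_mult_distrib mult_ac del: times_divide_eq_right)
  also have "\<dots> \<le> kernel_mass h"
    unfolding kernel_mass_def
  proof (rule integral_mono)
    show "integrable lborel (\<lambda>y::'a. ?c * indicator ?B y)"
      using emeasure_lborel_cball_finite[of "h *\<^sub>R w" "h * (kernel_radius / 2)"]
      by (intro integrable_mult_right integrable_real_indicator) auto
    show "integrable lborel (\<lambda>y. kernel ((1 / h) *\<^sub>R y))"
      using h by (rule integrable_kernel_scaled)
    fix y
    show "?c * indicator ?B y \<le> kernel ((1 / h) *\<^sub>R y)"
    proof (cases "y \<in> ?B")
      case True
      have "w - (1 / h) *\<^sub>R y = (1 / h) *\<^sub>R (h *\<^sub>R w - y)"
        using h by (simp add: scaleR_diff_right)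
      then have "dist w ((1 / h) *\<^sub>R y) = (1 / h) * norm (h *\<^sub>R w - y)"
        using h by (simp add: dist_norm)
      also have "\<dots> \<le> kernel_radius / 2"
        using True h by (simp add: dist_norm field_simps)
      finally show ?thesis
        using bump_ge[of w _ "kernel_radius / 2" kernel_radius] True by simp
    qed (simp add: bump_nonneg)
  qed
  finally show ?thesis .
qed

lemma mollify_eq:
  assumes "h > 0" "f \<in> borel_measurable borel"
  shows "mollify h f x / kernel_mass h = (\<integral>y. f (x + y) * (kernel ((1 / h) *\<^sub>R y) / kernel_mass h) \<partial>lborel)"
proof -
  have [measurable]: "f \<in> borel_measurable borel" by fact
  have "(\<integral>y. f (y + x) * kernel ((1 / h) *\<^sub>R ((y + x) - x)) \<partial>lborel) = mollify h f x"
    unfolding mollify_def by (rule integral_lborel_shift) measurable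
  then show ?thesis
    by (simp add: add.commute)
qed

text \<open>Although the kernel is centred at \<open>w\<close>, at scale \<open>h\<close> its
  support lies within distance \<open>h * (norm w + kernel_radius)\<close> of the origin, so the
  translations involved tend to 0.\<close>

lemma mollify_tendsto_L1:
  assumes f: "integrable lborel f" and R: "\<And>x. norm x > R \<Longrightarrow> f x = 0"
    and h: "\<And>n. h n > 0" "h \<longlonglongrightarrow> 0"
  shows "(\<lambda>n. \<integral>\<^sup>+x. ennreal \<bar>mollify (h n) f x / kernel_mass (h n) - f x\<bar> \<partial>lborel) \<longlonglongrightarrow> 0"
proof (rule order_tendstoI)
  fix a :: ennreal assume "a > 0"
  then obtain e' where e': "0 < e'" "e' < a"
    using dense by blast
  then obtain e where e: "e' = ennreal e" "e > 0"
    by (cases e') auto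
  obtain d where d: "d > 0" "\<And>y. norm y < d \<Longrightarrow> (\<integral>\<^sup>+x. ennreal \<bar>f (x + y) - f x\<bar> \<partial>lborel) \<le> ennreal e"
    using L1_translation_continuous[OF f R e(2)] by blast
  have "(\<lambda>n. h n * (norm w + kernel_radius)) \<longlonglongrightarrow> 0 * (norm w + kernel_radius)"
    by (intro tendsto_intros h)
  then have "\<forall>\<^sub>F n in sequentially. h n * (norm w + kernel_radius) < d"
    using d(1) by (intro order_tendstoD(2)) auto
  then show "\<forall>\<^sub>F n in sequentially. (\<integral>\<^sup>+x. ennreal \<bar>mollify (h n) f x / kernel_mass (h n) - f x\<bar> \<partial>lborel) < a"
  proof eventually_elim
    case (elim n)
    have pos: "kernel_mass (h n) > 0"
      using kernel_mass_ge[OF h(1)[of n]] mass_const_pos h(1)[of n]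
      by (meson less_le_trans mult_pos_pos zero_less_power)
    have [measurable]: "f \<in> borel_measurable borel"
      using f by auto
    have "(\<integral>\<^sup>+x. ennreal \<bar>mollify (h n) f x / kernel_mass (h n) - f x\<bar> \<partial>lborel) \<le> ennreal e"
      unfolding mollify_eq[OF h(1) \<open>f \<in> borel_measurable borel\<close>]
    proof (rule mollifier_L1_le[OF f, where K = "1 / kernel_mass (h n)"])
      show "integrable lborel (\<lambda>y. kernel ((1 / h n) *\<^sub>R y) / kernel_mass (h n))"
        using integrable_kernel_scaled[OF h(1)] by simp
      show "(\<integral>y. kernel ((1 / h n) *\<^sub>R y) / kernel_mass (h n) \<partial>lborel) = 1"
        using pos by (simp add: kernel_mass_def)
      fix y
      show "kernel ((1 / h n) *\<^sub>R y) / kernel_mass (h n) \<ge> 0"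
        using pos by (simp add: bump_nonneg)
      show "\<bar>kernel ((1 / h n) *\<^sub>R y) / kernel_mass (h n)\<bar> \<le> 1 / kernel_mass (h n)"
        using pos by (simp add: bump_nonneg bump_le_1 abs_divide divide_right_mono)
      assume "kernel ((1 / h n) *\<^sub>R y) / kernel_mass (h n) \<noteq> 0"
      then have "\<not> norm y > h n * (norm w + kernel_radius)"
        using kernel_scaled_eq_0[OF h(1)] by auto
      then show "(\<integral>\<^sup>+x. ennreal \<bar>f (x + y) - f x\<bar> \<partial>lborel) \<le> ennreal e"
        using elim by (intro d(2)) simp
    qed
    then show ?case
      using e' e(1) by simp
  qed
qed simp

text \<open>The ball volume comes from averaging over shifts,
  \<open>DIM('a) * (norm w + \<rho>)\<close> from the increments along an edge,
  \<open>mass_const\<close> from the normalization. Neither the mesh nor the size of the support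
  enters.\<close>

definition cone_sobolev_const :: real where
  "cone_sobolev_const = unit_ball_vol DIM('a) * cell_radius ^ DIM('a) *
     (real DIM('a) * (norm w + \<rho>) / mass_const) powr sobolev_exponent TYPE('a)"

text \<open>Write d for the dimension and q = d/(d-1). Averaging contributes h^d, the increments
  h^q, the normalization h^(-dq). The powers cancel because d + q = dq, so the bound is uniform in
  \<open>h\<close>.\<close>

lemma nn_integral_mollify_normalized_le:
  assumes dim: "DIM('a) \<ge> 2" and f: "integrable lborel f" and bd: "weak_gradient_bound G f V" and h: "h > 0"
    and R: "\<And>x. norm x > R \<Longrightarrow> f x = 0"
  shows "(\<integral>\<^sup>+x. indicator G x * ennreal (\<bar>mollify h f x / kernel_mass h\<bar> powr sobolev_exponent TYPE('a)) \<partial>lborel)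
    \<le> ennreal (cone_sobolev_const * V powr sobolev_exponent TYPE('a))"
proof -
  let ?q = "sobolev_exponent TYPE('a)" and ?d = "DIM('a)"
  let ?C = "real ?d * (norm w + \<rho>)" and ?U = "unit_ball_vol ?d"
  have q: "?q > 0" "real ?d + ?q = real ?d * ?q"
    using dim by (auto simp: field_simps)
  have V: "V \<ge> 0"
    by (rule weak_gradient_bound_nonneg[OF bd])
  have [measurable]: "f \<in> borel_measurable borel" "G \<in> sets borel"
    using f open_G by auto
  have m: "mass_const * h ^ ?d > 0" "kernel_mass h \<ge> mass_const * h ^ ?d"
    using mass_const_pos h kernel_mass_ge[OF h] by auto
  then have "kernel_mass h > 0"
    by linarith
  then have "kernel_mass h powr ?q > 0" "(mass_const * h ^ ?d) powr ?q > 0"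
    using mass_const_pos h by auto
  note m = m mult_pos_pos[OF this]
  have cr: "cell_radius \<ge> 0"
    unfolding cell_radius_def by (simp add: sum_nonneg)
  have hq: "(h ^ ?d) powr ?q = h ^ ?d * h powr ?q"
  proof -
    have "(h ^ ?d) powr ?q = h powr (real ?d * ?q)"
      using h by (simp add: powr_realpow[symmetric] powr_powr)
    also have "\<dots> = h powr (real ?d + ?q)"
      by (simp only: q(2))
    also have "\<dots> = h ^ ?d * h powr ?q"
      unfolding powr_add using h by (simp add: powr_realpow)
    finally show ?thesis .
  qed
  have "(\<integral>\<^sup>+x. indicator G x * ennreal (\<bar>mollify h f x / kernel_mass h\<bar> powr ?q) \<partial>lborel)
    = (\<integral>\<^sup>+x. ennreal (1 / kernel_mass h powr ?q) * (indicator G x * ennreal (\<bar>mollify h f x\<bar> powr ?q)) \<partial>lborel)"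
    using m by (intro nn_integral_cong) (simp add: powr_divide ennreal_mult[symmetric] indicator_def)
  also have "\<dots> = ennreal (1 / kernel_mass h powr ?q) * (\<integral>\<^sup>+x. indicator G x * ennreal (\<bar>mollify h f x\<bar> powr ?q) \<partial>lborel)"
    by (rule nn_integral_cmult) measurable
  also have "\<dots> \<le> ennreal (1 / (mass_const * h ^ ?d) powr ?q) * ennreal (?U * (h * cell_radius) ^ ?d * (h * (?C * V)) powr ?q)"
    using m q(1) by (intro mult_mono nn_integral_mollify_powr_le dim f bd h R ennreal_leI divide_left_mono powr_mono2) auto
  also have "\<dots> = ennreal (1 / (mass_const * h ^ ?d) powr ?q * (?U * (h * cell_radius) ^ ?d * (h * (?C * V)) powr ?q))"
    using h cr by (intro ennreal_mult[symmetric]) auto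
  also have "1 / (mass_const * h ^ ?d) powr ?q * (?U * (h * cell_radius) ^ ?d * (h * (?C * V)) powr ?q) =
      cone_sobolev_const * V powr ?q"
    using h mass_const_pos
    by (simp add: cone_sobolev_const_def powr_mult powr_divide hq power_mult_distrib)
  finally show ?thesis .
qed

text \<open>Fatou's lemma for normalized mollifications along a subsequence that converges almost
  everywhere, which L^1 convergence provides.\<close>

lemma cone_sobolev:
  assumes dim: "DIM('a) \<ge> 2" and f: "integrable lborel f" and bd: "weak_gradient_bound G f V"
    and R: "\<And>x. norm x > R \<Longrightarrow> f x = 0"
  shows "(\<integral>\<^sup>+x. indicator G x * ennreal (\<bar>f x\<bar> powr sobolev_exponent TYPE('a)) \<partial>lborel)
    \<le> ennreal (cone_sobolev_const * V powr sobolev_exponent TYPE('a))"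
proof -
  let ?q = "sobolev_exponent TYPE('a)"
  have q: "?q > 0"
    using dim by simp
  have [measurable]: "f \<in> borel_measurable borel" "G \<in> sets borel"
    using f open_G by auto
  define h where "h n = 1 / real (Suc n)" for n
  have h: "h n > 0" "h \<longlonglongrightarrow> 0" for n
    unfolding h_def using LIMSEQ_inverse_real_of_nat by (auto simp: inverse_eq_divide)
  define g where "g n x = mollify (h n) f x / kernel_mass (h n)" for n x
  have [measurable]: "g n \<in> borel_measurable borel" for n
    unfolding g_def by measurable
  have L1: "(\<lambda>n. \<integral>\<^sup>+x. ennreal (norm (g n x - f x)) \<partial>lborel) \<longlonglongrightarrow> 0"
    unfolding g_def using mollify_tendsto_L1[OF f R h] by simp
  then have "\<forall>\<^sub>F n in sequentially. (\<integral>\<^sup>+x. ennreal (norm (g n x - f x)) \<partial>lborel) < 1"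
    by (rule order_tendstoD(2)) simp
  \<comment> \<open>The L^1 distance is known to be finite only eventually; shifting by
    \<open>n0\<close> makes all differences integrable.\<close>
  then obtain n0 where n0: "\<And>n. n \<ge> n0 \<Longrightarrow> (\<integral>\<^sup>+x. ennreal (norm (g n x - f x)) \<partial>lborel) < 1"
    by (auto simp: eventually_sequentially)
  have int: "integrable lborel (\<lambda>x. g (n + n0) x - f x)" for n
    using n0[of "n + n0"] less_trans[OF _ ennreal_one_less_top] by (intro integrableI_bounded) auto
  have "(\<lambda>n. ennreal (\<integral>x. norm (g (n + n0) x - f x) \<partial>lborel)) \<longlonglongrightarrow> 0"
    using LIMSEQ_ignore_initial_segment[OF L1, of n0]
    by (subst nn_integral_eq_integral[OF integrable_norm[OF int], symmetric]) auto
  then have "(\<lambda>n. \<integral>x. norm (g (n + n0) x - f x) \<partial>lborel) \<longlonglongrightarrow> 0"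
    by (subst (asm) ennreal_0[symmetric], subst (asm) tendsto_ennreal_iff) auto
  then obtain r where r: "AE x in lborel. (\<lambda>n. g (r n + n0) x - f x) \<longlonglongrightarrow> 0"
    using tendsto_L1_AE_subseq[of lborel "\<lambda>n x. g (n + n0) x - f x", OF int] by blast
  have "AE x in lborel. indicator G x * ennreal (\<bar>f x\<bar> powr ?q) =
      liminf (\<lambda>n. indicator G x * ennreal (\<bar>g (r n + n0) x\<bar> powr ?q))"
    using r
  proof eventually_elim
    case (elim x)
    have "(\<lambda>n. g (r n + n0) x) \<longlonglongrightarrow> f x"
      using LIM_zero_cancel[OF elim] .
    then have "(\<lambda>n. \<bar>g (r n + n0) x\<bar> powr ?q) \<longlonglongrightarrow> \<bar>f x\<bar> powr ?q"
      using q by (intro tendsto_powr2 tendsto_rabs tendsto_const) auto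
    then have "(\<lambda>n. ennreal (\<bar>g (r n + n0) x\<bar> powr ?q)) \<longlonglongrightarrow> ennreal (\<bar>f x\<bar> powr ?q)"
      by (rule tendsto_ennrealI)
    then have "(\<lambda>n. indicator G x * ennreal (\<bar>g (r n + n0) x\<bar> powr ?q)) \<longlonglongrightarrow> indicator G x * ennreal (\<bar>f x\<bar> powr ?q)"
      by (cases "x \<in> G") auto
    then show ?case
      by (intro lim_imp_Liminf[symmetric]) auto
  qed
  then have "(\<integral>\<^sup>+x. indicator G x * ennreal (\<bar>f x\<bar> powr ?q) \<partial>lborel) =
      (\<integral>\<^sup>+x. liminf (\<lambda>n. indicator G x * ennreal (\<bar>g (r n + n0) x\<bar> powr ?q)) \<partial>lborel)"
    by (rule nn_integral_cong_AE)
  also have "\<dots> \<le> liminf (\<lambda>n. \<integral>\<^sup>+x. indicator G x * ennreal (\<bar>g (r n + n0) x\<bar> powr ?q) \<partial>lborel)"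
    by (rule nn_integral_liminf) measurable
  also have "\<dots> \<le> liminf (\<lambda>n::nat. ennreal (cone_sobolev_const * V powr ?q))"
    unfolding g_def
    by (intro Liminf_mono always_eventually allI nn_integral_mollify_normalized_le[OF dim f bd h(1) R])
  also have "\<dots> = ennreal (cone_sobolev_const * V powr ?q)"
    by (rule Liminf_const) simp
  finally show ?thesis .
qed

end

section \<open>Localization\<close>

text \<open>A test function \<phi> of \<open>G\<close> need not be supported in
  \<open>\<Omega>\<close>, but its product with \<eta>, restricted to \<open>\<Omega>\<close>, is:
  its support lies in that of \<phi> intersected with \<open>Z\<close>. By the product rule \<eta>
  times a partial derivative of \<phi> is the derivative of this product minus \<phi> times the
  derivative of \<eta>. The first term is covered by the bound for \<open>U\<close>, the second
  costs \<open>K\<close> times the L^1 norm.\<close>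

lemma weak_gradient_bound_localize:
  fixes \<eta> U :: "'a::euclidean_space \<Rightarrow> real"
  assumes "open \<Omega>" and U: "integrable lborel U" "\<And>x. x \<notin> \<Omega> \<Longrightarrow> U x = 0" "weak_gradient_bound \<Omega> U V"
    and \<eta>: "smooth \<eta>" "\<And>x. \<bar>\<eta> x\<bar> \<le> 1" "\<And>x i. i \<in> Basis \<Longrightarrow> \<bar>partial_deriv \<eta> i x\<bar> \<le> K"
    and Z: "closed Z" "Z \<inter> G \<subseteq> \<Omega>" "\<And>x. x \<in> \<Omega> \<Longrightarrow> \<eta> x \<noteq> 0 \<Longrightarrow> x \<in> Z"
  shows "weak_gradient_bound G (\<lambda>x. \<eta> x * U x) (V + K * (\<integral>x. \<bar>U x\<bar> \<partial>lborel))"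
  unfolding weak_gradient_bound_def
proof (intro ballI allI impI)
  fix \<phi> i M
  assume \<phi>: "\<phi> \<in> test_functions G" and i: "i \<in> (Basis :: 'a set)" and M: "\<forall>x. \<bar>\<phi> x\<bar> \<le> M"
  note \<phi>D = test_functionsD[OF \<phi>]
  \<comment> \<open>The cutoff may be nonzero outside \<open>\<Omega>\<close>, so the product is set
    to 0 there. Integrals against \<open>U\<close> do not change, as \<open>U\<close> vanishes
    outside \<open>\<Omega>\<close>.\<close>
  define \<zeta> where "\<zeta> x = (if x \<in> \<Omega> then \<eta> x * \<phi> x else 0)" for x
  define S where "S = closure {x. \<phi> x \<noteq> 0} \<inter> Z"
  have S: "compact S" "S \<subseteq> \<Omega>"
    unfolding S_def using \<phi>D(2,3) Z by (auto intro: compact_Int_closed)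
  have \<zeta>_eq_0: "\<zeta> x = 0" if "x \<notin> S" for x
    using that Z(3)[of x] eq_0_outside_support[of x \<phi>] by (auto simp: \<zeta>_def S_def)
  have "smooth \<zeta>"
  proof (rule smooth_local)
    show "open \<Omega>" "open (- S)" "\<Omega> \<union> - S = UNIV"
      using assms(1) S compact_imp_closed by auto
    show "smooth (\<lambda>x. \<eta> x * \<phi> x)"
      using \<eta>(1) \<phi>D(1) by (rule smooth_mult)
    show "smooth (\<lambda>_::'a. 0::real)"
      by (rule smooth_const)
    show "\<zeta> x = \<eta> x * \<phi> x" if "x \<in> \<Omega>" for x
      using that by (simp add: \<zeta>_def)
    show "\<zeta> x = 0" if "x \<in> - S" for x
      using that by (intro \<zeta>_eq_0) simp
  qed
  then have \<zeta>: "\<zeta> \<in> test_functions \<Omega>"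
    using S \<zeta>_eq_0 by (rule test_functionsI)
  have M0: "0 \<le> M"
    using M abs_ge_zero order_trans by blast
  have "\<bar>\<zeta> x\<bar> \<le> M" for x
    using mult_mono[OF \<eta>(2)[of x], of "\<bar>\<phi> x\<bar>" M] M M0 by (auto simp: \<zeta>_def abs_mult)
  then have 1: "\<bar>\<integral>x. U x * partial_deriv \<zeta> i x \<partial>lborel\<bar> \<le> V * M"
    using U(3) \<zeta> i unfolding weak_gradient_bound_def by blast
  have deriv: "partial_deriv \<zeta> i x = \<eta> x * partial_deriv \<phi> i x + partial_deriv \<eta> i x * \<phi> x" if "x \<in> \<Omega>" for x
  proof -
    have "(\<zeta> has_derivative (\<lambda>h. \<eta> x * frechet_derivative \<phi> (at x) h + frechet_derivative \<eta> (at x) h * \<phi> x)) (at x)"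
      by (rule has_derivative_transform_within_open[OF has_derivative_mult[OF smooth_has_derivative[OF \<eta>(1)] smooth_has_derivative[OF \<phi>D(1)]] assms(1) that])
         (simp add: \<zeta>_def)
    then show ?thesis
      by (simp add: frechet_derivative_at[symmetric])
  qed
  have [measurable]: "partial_deriv \<eta> i \<in> borel_measurable borel" "\<phi> \<in> borel_measurable borel"
    "partial_deriv \<zeta> i \<in> borel_measurable borel"
    using smooth_partial_deriv[OF \<eta>(1) i] \<phi>D(1) smooth_partial_deriv[OF \<open>smooth \<zeta>\<close> i]
    by (auto intro: borel_measurable_continuous_onI smooth_continuous_on)
  obtain B where B: "\<And>x i. i \<in> Basis \<Longrightarrow> \<bar>partial_deriv \<zeta> i x\<bar> \<le> B"
    using test_function_partials_bounded[OF \<zeta>] by blast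
  have K0: "K \<ge> 0"
    using \<eta>(3)[OF i, of 0] abs_ge_zero order_trans by blast
  have le: "\<bar>partial_deriv \<eta> i x * \<phi> x\<bar> \<le> K * M" for x
    unfolding abs_mult using \<eta>(3)[OF i] M K0 by (intro mult_mono) auto
  have int: "integrable lborel (\<lambda>x. U x * partial_deriv \<zeta> i x)"
    "integrable lborel (\<lambda>x. U x * (partial_deriv \<eta> i x * \<phi> x))"
    using B[OF i] le by (auto intro!: integrable_mult_bounded[OF U(1)])
  have "(\<integral>x. \<eta> x * U x * partial_deriv \<phi> i x \<partial>lborel) =
      (\<integral>x. U x * partial_deriv \<zeta> i x - U x * (partial_deriv \<eta> i x * \<phi> x) \<partial>lborel)"
  proof (intro Bochner_Integration.integral_cong refl)
    fix x
    show "\<eta> x * U x * partial_deriv \<phi> i x = U x * partial_deriv \<zeta> i x - U x * (partial_deriv \<eta> i x * \<phi> x)"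
      using deriv[of x] U(2)[of x] by (cases "x \<in> \<Omega>") (simp_all add: algebra_simps)
  qed
  also have "\<dots> = (\<integral>x. U x * partial_deriv \<zeta> i x \<partial>lborel) - (\<integral>x. U x * (partial_deriv \<eta> i x * \<phi> x) \<partial>lborel)"
    using int by (rule Bochner_Integration.integral_diff)
  finally have eq: "(\<integral>x. \<eta> x * U x * partial_deriv \<phi> i x \<partial>lborel) = \<dots>" .
  have "\<bar>\<integral>x. U x * (partial_deriv \<eta> i x * \<phi> x) \<partial>lborel\<bar> \<le> (\<integral>x. \<bar>U x * (partial_deriv \<eta> i x * \<phi> x)\<bar> \<partial>lborel)"
    by (rule integral_abs_bound)
  also have "\<dots> \<le> (\<integral>x. (K * M) * \<bar>U x\<bar> \<partial>lborel)"
  proof (rule integral_mono)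
    show "\<bar>U x * (partial_deriv \<eta> i x * \<phi> x)\<bar> \<le> (K * M) * \<bar>U x\<bar>" for x
      using mult_left_mono[OF le abs_ge_zero] by (simp add: abs_mult mult.commute)
  qed (use int U(1) in auto)
  finally have "\<bar>\<integral>x. U x * (partial_deriv \<eta> i x * \<phi> x) \<partial>lborel\<bar> \<le> K * M * (\<integral>x. \<bar>U x\<bar> \<partial>lborel)"
    by simp
  then show "\<bar>\<integral>x. \<eta> x * U x * partial_deriv \<phi> i x \<partial>lborel\<bar> \<le> (V + K * (\<integral>x. \<bar>U x\<bar> \<partial>lborel)) * M"
    unfolding eq using 1 by (simp add: algebra_simps)
qed

text \<open>One constant serves all \<open>U\<close> and \<open>V\<close>. The inequality is stated
  for the power of the norm, so that the contributions of several sets simply add up.\<close>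

definition locally_sobolev :: "'a::euclidean_space set \<Rightarrow> 'a set \<Rightarrow> bool" where
  "locally_sobolev \<Omega> E \<longleftrightarrow> E \<in> sets borel \<and> (\<exists>C\<ge>0. \<forall>U V. integrable lborel U \<longrightarrow> (\<forall>x. x \<notin> \<Omega> \<longrightarrow> U x = 0) \<longrightarrow>
     weak_gradient_bound \<Omega> U V \<longrightarrow>
     (\<integral>\<^sup>+x. indicator E x * ennreal (\<bar>U x\<bar> powr sobolev_exponent TYPE('a)) \<partial>lborel)
       \<le> ennreal (C * (V + (\<integral>x. \<bar>U x\<bar> \<partial>lborel)) powr sobolev_exponent TYPE('a)))"

lemma locally_sobolev_empty: "locally_sobolev \<Omega> {}"
  unfolding locally_sobolev_def by auto

lemma locally_sobolev_Un:
  fixes \<Omega> :: "'a::euclidean_space set"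
  assumes "locally_sobolev \<Omega> E" "locally_sobolev \<Omega> F"
  shows "locally_sobolev \<Omega> (E \<union> F)"
proof -
  let ?q = "sobolev_exponent TYPE('a)"
  obtain C D where CD: "C \<ge> 0" "D \<ge> 0"
    "\<And>U V. integrable lborel U \<Longrightarrow> (\<forall>x. x \<notin> \<Omega> \<longrightarrow> U x = 0) \<Longrightarrow> weak_gradient_bound \<Omega> U V \<Longrightarrow>
      (\<integral>\<^sup>+x. indicator E x * ennreal (\<bar>U x\<bar> powr ?q) \<partial>lborel) \<le> ennreal (C * (V + (\<integral>x. \<bar>U x\<bar> \<partial>lborel)) powr ?q)"
    "\<And>U V. integrable lborel U \<Longrightarrow> (\<forall>x. x \<notin> \<Omega> \<longrightarrow> U x = 0) \<Longrightarrow> weak_gradient_bound \<Omega> U V \<Longrightarrow>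
      (\<integral>\<^sup>+x. indicator F x * ennreal (\<bar>U x\<bar> powr ?q) \<partial>lborel) \<le> ennreal (D * (V + (\<integral>x. \<bar>U x\<bar> \<partial>lborel)) powr ?q)"
    using assms unfolding locally_sobolev_def by blast
  have [measurable]: "E \<in> sets borel" "F \<in> sets borel"
    using assms by (auto simp: locally_sobolev_def)
  show ?thesis
    unfolding locally_sobolev_def
  proof (intro conjI exI[of _ "C + D"] allI impI)
    fix U V assume U: "integrable lborel U" "\<forall>x. x \<notin> \<Omega> \<longrightarrow> U x = 0" "weak_gradient_bound \<Omega> U V"
    have [measurable]: "U \<in> borel_measurable borel"
      using U(1) by auto
    let ?N = "(V + (\<integral>x. \<bar>U x\<bar> \<partial>lborel)) powr ?q"
    have "(\<integral>\<^sup>+x. indicator (E \<union> F) x * ennreal (\<bar>U x\<bar> powr ?q) \<partial>lborel) \<le>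
      (\<integral>\<^sup>+x. indicator E x * ennreal (\<bar>U x\<bar> powr ?q) + indicator F x * ennreal (\<bar>U x\<bar> powr ?q) \<partial>lborel)"
      by (intro nn_integral_mono) (auto simp: indicator_def)
    also have "\<dots> = (\<integral>\<^sup>+x. indicator E x * ennreal (\<bar>U x\<bar> powr ?q) \<partial>lborel) +
        (\<integral>\<^sup>+x. indicator F x * ennreal (\<bar>U x\<bar> powr ?q) \<partial>lborel)"
      by (rule nn_integral_add) measurable
    also have "\<dots> \<le> ennreal (C * ?N) + ennreal (D * ?N)"
      by (intro add_mono CD U)
    also have "\<dots> = ennreal ((C + D) * ?N)"
      using CD by (simp add: distrib_right ennreal_plus[symmetric] del: ennreal_plus)
    finally show "(\<integral>\<^sup>+x. indicator (E \<union> F) x * ennreal (\<bar>U x\<bar> powr ?q) \<partial>lborel) \<le> \<dots>" .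
  qed (use CD in auto)
qed

lemma locally_sobolev_UN:
  "finite A \<Longrightarrow> (\<And>a. a \<in> A \<Longrightarrow> locally_sobolev \<Omega> (E a)) \<Longrightarrow> locally_sobolev \<Omega> (\<Union>a\<in>A. E a)"
  by (induction A rule: finite_induct) (auto simp: locally_sobolev_empty locally_sobolev_Un)

text \<open>The cutoff may depend on \<open>n\<close>, but \<open>K\<close> and \<open>c\<close> may
  not. Restriction to a ball of radius \<open>n\<close> allows cutoffs that confine \<open>U\<close>
  to a bounded set, as the inequality on \<open>G\<close> requires; Fatou's lemma then removes the
  restriction, so that \<open>E\<close> may be unbounded.\<close>

lemma locally_sobolevI:
  fixes \<Omega> :: "'a::euclidean_space set"
  assumes dim: "DIM('a) \<ge> 2" and "open \<Omega>" and G: "cone_domain G w \<rho>" and E: "E \<in> sets borel"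
    and c: "c > 0"
    and cutoff: "\<And>n::nat. \<exists>\<eta> Z. smooth \<eta> \<and> (\<forall>x. \<bar>\<eta> x\<bar> \<le> 1) \<and> (\<forall>i\<in>Basis. \<forall>x. \<bar>partial_deriv \<eta> i x\<bar> \<le> K) \<and>
      closed Z \<and> bounded Z \<and> Z \<inter> G \<subseteq> \<Omega> \<and> (\<forall>x\<in>\<Omega>. \<eta> x \<noteq> 0 \<longrightarrow> x \<in> Z) \<and>
      (\<forall>x\<in>\<Omega> \<inter> E \<inter> ball 0 (real n). x \<in> G \<and> c \<le> \<bar>\<eta> x\<bar>)"
  shows "locally_sobolev \<Omega> E"
proof -
  interpret cone_domain G w \<rho> by (fact G)
  let ?q = "sobolev_exponent TYPE('a)"
  have q: "?q > 0"
    using dim by simp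
  have S0: "cone_sobolev_const \<ge> 0"
    unfolding cone_sobolev_const_def cell_radius_def by (auto simp: sum_nonneg)
  \<comment> \<open>The power of \<open>c\<close> pays for dividing by the cutoff on
    \<open>E\<close>, that of \<open>max 1 K\<close> for bounding \<open>V\<close> plus
    \<open>K\<close> times the L^1 norm by a multiple of their unweighted sum.\<close>
  define C where "C = cone_sobolev_const * max 1 K powr ?q / c powr ?q"
  have [measurable]: "G \<in> sets borel" "E \<in> sets borel" "ball (0::'a) d \<in> sets borel" for d
    using open_G E by auto
  show ?thesis
    unfolding locally_sobolev_def
  proof (intro conjI exI[of _ C] allI impI)
    fix U V assume U: "integrable lborel U" "\<forall>x. x \<notin> \<Omega> \<longrightarrow> U x = 0" "weak_gradient_bound \<Omega> U V"
    have [measurable]: "U \<in> borel_measurable borel"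
      using U(1) by auto
    have V: "V \<ge> 0"
      by (rule weak_gradient_bound_nonneg[OF U(3)])
    let ?N = "\<integral>x. \<bar>U x\<bar> \<partial>lborel"
    let ?g = "\<lambda>n x. indicator (E \<inter> ball 0 (real n)) x * ennreal (\<bar>U x\<bar> powr ?q)"
    have bound: "(\<integral>\<^sup>+x. ?g n x \<partial>lborel) \<le> ennreal (C * (V + ?N) powr ?q)" for n
    proof -
      obtain \<eta> Z where \<eta>: "smooth \<eta>" "\<And>x. \<bar>\<eta> x\<bar> \<le> 1" "\<And>x i. i \<in> Basis \<Longrightarrow> \<bar>partial_deriv \<eta> i x\<bar> \<le> K"
        and Z: "closed Z" "bounded Z" "Z \<inter> G \<subseteq> \<Omega>" "\<And>x. x \<in> \<Omega> \<Longrightarrow> \<eta> x \<noteq> 0 \<Longrightarrow> x \<in> Z"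
        and ge: "\<And>x. x \<in> \<Omega> \<Longrightarrow> x \<in> E \<Longrightarrow> x \<in> ball 0 (real n) \<Longrightarrow> x \<in> G \<and> c \<le> \<bar>\<eta> x\<bar>"
        using cutoff[of n] by auto
      have [measurable]: "\<eta> \<in> borel_measurable borel"
        using \<eta>(1) by (intro borel_measurable_continuous_onI smooth_continuous_on)
      obtain R where R: "\<And>x. x \<in> Z \<Longrightarrow> norm x \<le> R"
        using Z(2) by (auto simp: bounded_iff)
      have wgb: "weak_gradient_bound G (\<lambda>x. \<eta> x * U x) (V + K * ?N)"
        using U by (intro weak_gradient_bound_localize[OF assms(2) _ _ _ \<eta> Z(1,3,4)]) auto
      have int: "integrable lborel (\<lambda>x. \<eta> x * U x)"
        using integrable_mult_bounded[OF U(1) _ \<eta>(2)] by (simp add: mult.commute)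
      have supp: "\<eta> x * U x = 0" if "norm x > R" for x
        using that U(2) Z(4)[of x] R[of x] by (cases "x \<in> \<Omega>") auto
      have "(\<integral>\<^sup>+x. ?g n x \<partial>lborel) \<le>
          (\<integral>\<^sup>+x. ennreal (1 / c powr ?q) * (indicator G x * ennreal (\<bar>\<eta> x * U x\<bar> powr ?q)) \<partial>lborel)"
      proof (intro nn_integral_mono)
        fix x
        show "?g n x \<le> ennreal (1 / c powr ?q) * (indicator G x * ennreal (\<bar>\<eta> x * U x\<bar> powr ?q))"
        proof (cases "x \<in> \<Omega> \<and> x \<in> E \<inter> ball 0 (real n)")
          case True
          then have x: "x \<in> G" "c \<le> \<bar>\<eta> x\<bar>"
            using ge[of x] by auto
          have "c powr ?q * \<bar>U x\<bar> powr ?q \<le> \<bar>\<eta> x\<bar> powr ?q * \<bar>U x\<bar> powr ?q"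
            using x(2) c q by (intro mult_right_mono powr_mono2) auto
          then have "\<bar>U x\<bar> powr ?q \<le> 1 / c powr ?q * \<bar>\<eta> x * U x\<bar> powr ?q"
            using c by (simp add: abs_mult powr_mult pos_le_divide_eq mult.commute)
          then have "ennreal (\<bar>U x\<bar> powr ?q) \<le> ennreal (1 / c powr ?q) * ennreal (\<bar>\<eta> x * U x\<bar> powr ?q)"
            by (subst ennreal_mult[symmetric]) (auto intro!: ennreal_leI)
          then show ?thesis
            using True x(1) by simp
        next
          case False
          then have *: "?g n x = 0"
            using U(2) by (auto simp: indicator_def)
          show ?thesis
            unfolding * by simp
        qed
      qed
      also have "\<dots> = ennreal (1 / c powr ?q) * (\<integral>\<^sup>+x. indicator G x * ennreal (\<bar>\<eta> x * U x\<bar> powr ?q) \<partial>lborel)"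
        by (rule nn_integral_cmult) measurable
      also have "\<dots> \<le> ennreal (1 / c powr ?q) * ennreal (cone_sobolev_const * (V + K * ?N) powr ?q)"
        by (intro mult_left_mono cone_sobolev[OF dim int wgb supp]) auto
      also have "\<dots> = ennreal (1 / c powr ?q * (cone_sobolev_const * (V + K * ?N) powr ?q))"
        using S0 by (intro ennreal_mult[symmetric]) auto
      also have "\<dots> \<le> ennreal (1 / c powr ?q * (cone_sobolev_const * (max 1 K * (V + ?N)) powr ?q))"
      proof (intro ennreal_leI mult_left_mono powr_mono2)
        have "V \<le> max 1 K * V" "K * ?N \<le> max 1 K * ?N"
          using V by (auto intro!: mult_right_mono mult_le_cancel_right1[THEN iffD2] simp: mult_le_cancel_right1)
        then show "V + K * ?N \<le> max 1 K * (V + ?N)"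
          by (simp add: distrib_left)
        show "0 \<le> V + K * ?N"
          by (rule weak_gradient_bound_nonneg[OF wgb])
      qed (use S0 q in auto)
      also have "1 / c powr ?q * (cone_sobolev_const * (max 1 K * (V + ?N)) powr ?q) = C * (V + ?N) powr ?q"
        by (simp add: C_def powr_mult)
      finally show ?thesis .
    qed
    have "(\<integral>\<^sup>+x. indicator E x * ennreal (\<bar>U x\<bar> powr ?q) \<partial>lborel) = (\<integral>\<^sup>+x. liminf (\<lambda>n. ?g n x) \<partial>lborel)"
    proof (intro nn_integral_cong)
      fix x :: 'a
      obtain n0 where n0: "norm x < real n0"
        using reals_Archimedean2 by blast
      have "\<forall>\<^sub>F n in sequentially. ?g n x = indicator E x * ennreal (\<bar>U x\<bar> powr ?q)"
        unfolding eventually_sequentially by (rule exI[of _ n0]) (use n0 in \<open>auto simp: indicator_def\<close>)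
      then have "(\<lambda>n. ?g n x) \<longlonglongrightarrow> indicator E x * ennreal (\<bar>U x\<bar> powr ?q)"
        by (rule tendsto_eventually)
      then show "indicator E x * ennreal (\<bar>U x\<bar> powr ?q) = liminf (\<lambda>n. ?g n x)"
        by (intro lim_imp_Liminf[symmetric]) auto
    qed
    also have "\<dots> \<le> liminf (\<lambda>n. \<integral>\<^sup>+x. ?g n x \<partial>lborel)"
      by (rule nn_integral_liminf) measurable
    also have "\<dots> \<le> liminf (\<lambda>n::nat. ennreal (C * (V + ?N) powr ?q))"
      by (intro Liminf_mono always_eventually allI bound)
    also have "\<dots> = ennreal (C * (V + ?N) powr ?q)"
      by (rule Liminf_const) simp
    finally show "(\<integral>\<^sup>+x. indicator E x * ennreal (\<bar>U x\<bar> powr ?q) \<partial>lborel) \<le> ennreal (C * (V + ?N) powr ?q)" .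
  qed (use S0 E in \<open>auto simp: C_def\<close>)
qed

section \<open>Lipschitz boundary charts\<close>

lemma lipschitz_epigraph_cone_domain:
  fixes e :: "'a::euclidean_space"
  assumes e: "norm e = 1" and L: "L-lipschitz_on {z. z \<bullet> e = 0} \<gamma>"
  shows "cone_domain {y. \<gamma> (y - (y \<bullet> e) *\<^sub>R e) < y \<bullet> e} e (1 / (2 * L + 2))"
proof
  have ee: "e \<bullet> e = 1"
    using e by (simp add: dot_square_norm)
  define P where "P y = y - (y \<bullet> e) *\<^sub>R e" for y
  have P: "P y \<bullet> e = 0" for y
    by (simp add: P_def inner_diff_left ee)
  have L0: "L \<ge> 0"
    using L by (rule lipschitz_on_nonneg)
  show "1 / (2 * L + 2) > 0"
    using L0 by simp
  have "continuous_on UNIV P"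
    unfolding P_def by (intro continuous_intros)
  then have "continuous_on UNIV (\<lambda>y. \<gamma> (P y))"
    using P by (intro continuous_on_compose2[OF lipschitz_on_continuous_on[OF L]]) auto
  then show "open {y. \<gamma> (y - (y \<bullet> e) *\<^sub>R e) < y \<bullet> e}"
    unfolding P_def by (intro open_Collect_less continuous_intros)
  fix x z t
  assume x: "x \<in> {y. \<gamma> (y - (y \<bullet> e) *\<^sub>R e) < y \<bullet> e}" and z: "z \<in> ball e (1 / (2 * L + 2))" and t: "(t::real) \<ge> 0"
  \<comment> \<open>For \<open>z\<close> within \<open>?\<rho>\<close> of \<open>e\<close> the
    tangential part has norm at most \<open>2 * ?\<rho>\<close> and the vertical part is at least
    \<open>1 - 2 * ?\<rho>\<close>. The ray in direction \<open>z\<close> stays above the graph if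
    \<open>L * (2 * ?\<rho>) \<le> 1 - 2 * ?\<rho>\<close>; this radius gives equality.\<close>
  let ?\<rho> = "1 / (2 * L + 2)"
  have n: "norm (z - e) < ?\<rho>"
    using z by (simp add: dist_norm norm_minus_commute)
  have ze: "\<bar>(z - e) \<bullet> e\<bar> \<le> norm (z - e)"
    using Cauchy_Schwarz_ineq2[of "z - e" e] e by simp
  have "P z = (z - e) - ((z - e) \<bullet> e) *\<^sub>R e"
    by (simp add: P_def inner_diff_left ee algebra_simps)
  then have "norm (P z) \<le> norm (z - e) + \<bar>(z - e) \<bullet> e\<bar>"
    using norm_triangle_ineq4[of "z - e" "((z - e) \<bullet> e) *\<^sub>R e"] e by simp
  then have "norm (P z) \<le> 2 * ?\<rho>"
    using n ze by linarith
  then have "L * norm (P z) \<le> L * (2 * ?\<rho>)"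
    using L0 by (rule mult_left_mono)
  also have "\<dots> = 1 - 2 * ?\<rho>"
    using L0 by (simp add: field_simps)
  also have "\<dots> \<le> z \<bullet> e"
    using n ze L0 by (simp add: inner_diff_left ee)
  finally have slope: "t * (L * norm (P z)) \<le> t * (z \<bullet> e)"
    using t by (rule mult_left_mono)
  have "\<gamma> (P (x + t *\<^sub>R z)) \<le> \<gamma> (P x) + L * dist (P (x + t *\<^sub>R z)) (P x)"
    using lipschitz_onD[OF L, of "P (x + t *\<^sub>R z)" "P x"] P by (simp add: dist_real_def)
  also have "P (x + t *\<^sub>R z) - P x = t *\<^sub>R P z"
    by (simp add: P_def inner_add_left algebra_simps)
  then have "L * dist (P (x + t *\<^sub>R z)) (P x) = t * (L * norm (P z))"
    using t by (simp add: dist_norm)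
  also have "\<gamma> (P x) + t * (L * norm (P z)) < x \<bullet> e + t * (z \<bullet> e)"
    using x slope by (simp add: P_def)
  finally show "x + t *\<^sub>R z \<in> {y. \<gamma> (y - (y \<bullet> e) *\<^sub>R e) < y \<bullet> e}"
    by (simp add: P_def inner_add_left)
qed

text \<open>Three nested radii are used. In \<open>ball a r\<close> the set \<open>\<Omega>\<close>
  coincides with the epigraph; the cutoff lives in the ball of radius \<open>3 * r / 4\<close>,
  whose closure is still inside the chart; and it is bounded below on
  \<open>ball a (r / 2)\<close>.\<close>

lemma locally_sobolev_boundary:
  fixes \<Omega> :: "'a::euclidean_space set"
  assumes dim: "DIM('a) \<ge> 2" and "open \<Omega>" and lip: "lipschitz_boundary \<Omega>" and a: "a \<in> frontier \<Omega>"
  obtains s where "s > 0" "locally_sobolev \<Omega> (ball a s)"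
proof -
  obtain r e \<gamma> L where r: "r > 0" and e: "norm e = 1" and L: "L-lipschitz_on {z. z \<bullet> e = 0} \<gamma>"
    and chart: "\<Omega> \<inter> ball a r = {y \<in> ball a r. \<gamma> (y - (y \<bullet> e) *\<^sub>R e) < y \<bullet> e}"
    using lip a unfolding lipschitz_boundary_def by blast
  define G where "G = {y. \<gamma> (y - (y \<bullet> e) *\<^sub>R e) < y \<bullet> e}"
  have G: "\<Omega> \<inter> ball a r = G \<inter> ball a r"
    using chart by (auto simp: G_def)
  define \<eta> where "\<eta> = bump a (3 * r / 4)"
  have \<eta>0: "\<eta> x = 0 \<longleftrightarrow> x \<notin> ball a (3 * r / 4)" for x
    unfolding \<eta>_def using r by (intro bump_eq_0_iff) simp
  have "\<eta> x = 0" if "x \<notin> cball a (3 * r / 4)" for x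
    using that by (simp add: \<eta>0)
  then obtain K where K: "\<And>x i. i \<in> Basis \<Longrightarrow> \<bar>partial_deriv \<eta> i x\<bar> \<le> K"
    using partial_derivs_bounded_if_constant_outside[of \<eta> "cball a (3 * r / 4)" 0]
    by (metis \<eta>_def smooth_bump compact_cball)
  let ?c = "exp_cutoff ((3 * r / 4)\<^sup>2 - (r / 2)\<^sup>2)"
  have "(3 * r / 4)\<^sup>2 - (r / 2)\<^sup>2 > 0"
    using r by (simp add: power2_eq_square field_simps)
  then have c: "?c > 0"
    by (simp add: exp_cutoff_def)
  have "locally_sobolev \<Omega> (ball a (r / 2))"
  proof (rule locally_sobolevI[OF dim assms(2) lipschitz_epigraph_cone_domain[OF e L, folded G_def] _ c, where K = K],
      simp, intro exI[of _ \<eta>] exI[of _ "cball a (3 * r / 4)"] conjI ballI allI impI)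
    show "smooth \<eta>"
      by (simp add: \<eta>_def smooth_bump)
    show "\<bar>\<eta> x\<bar> \<le> 1" for x
      by (simp add: \<eta>_def bump_nonneg bump_le_1)
    show "cball a (3 * r / 4) \<inter> G \<subseteq> \<Omega>"
    proof
      fix x assume "x \<in> cball a (3 * r / 4) \<inter> G"
      then have "x \<in> G \<inter> ball a r"
        using r by auto
      then show "x \<in> \<Omega>"
        using G by blast
    qed
    fix n :: nat and x assume x: "x \<in> \<Omega> \<inter> ball a (r / 2) \<inter> ball 0 (real n)"
    then have "x \<in> \<Omega> \<inter> ball a r"
      using r by auto
    then show "x \<in> G"
      using G by blast
    have "?c \<le> \<eta> x"
      unfolding \<eta>_def using x by (intro bump_ge) simp
    then show "?c \<le> \<bar>\<eta> x\<bar>"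
      by simp
  qed (use K \<eta>0 in auto)
  then show thesis
    using that[of "r / 2"] r by simp
qed

section \<open>The part of the domain away from the boundary\<close>

lemma cone_domain_UNIV: "cone_domain UNIV 0 1"
  by unfold_locales auto

text \<open>The chart is now the whole space, because the cutoff vanishes near the boundary. To have
  bounded support also for unbounded \<open>\<Omega>\<close>, it is multiplied by a second, wide
  cutoff whose derivative bound does not depend on the width.\<close>

lemma locally_sobolev_interior:
  fixes \<Omega> :: "'a::euclidean_space set"
  assumes dim: "DIM('a) \<ge> 2" and "open \<Omega>" and A: "finite A" "\<And>a. a \<in> A \<Longrightarrow> s a > 0"
    and cover: "frontier \<Omega> \<subseteq> (\<Union>a\<in>A. ball a (s a))"
  shows "locally_sobolev \<Omega> (- (\<Union>a\<in>A. ball a (2 * s a)))"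
proof -
  define m where "m a = exp_cutoff ((2 * s a)\<^sup>2 - (s a)\<^sup>2)" for a
  have m: "m a > 0" if "a \<in> A" for a
  proof -
    have "(2 * s a)\<^sup>2 - (s a)\<^sup>2 > 0"
      using A(2)[OF that] by (simp add: power2_eq_square)
    then show ?thesis
      by (simp add: m_def exp_cutoff_def)
  qed
  \<comment> \<open>On \<open>ball a (s a)\<close> the bump is at least \<open>m a\<close>, so the
    argument of the outer \<open>exp_cutoff\<close> is nonpositive and the factor is 0. Outside
    \<open>ball a (2 * s a)\<close> the bump is 0 and the factor is \<open>exp_cutoff 1\<close>,
    whence the constant value \<open>\<kappa>\<close> far from the boundary.\<close>
  define \<eta> where "\<eta> x = (\<Prod>a\<in>A. exp_cutoff (1 + (- (1 / m a)) * bump a (2 * s a) x))" for x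
  define \<kappa> where "\<kappa> = exp_cutoff 1 ^ card A"
  \<comment> \<open>Removing balls that cover the frontier leaves a closed set contained in
    \<open>\<Omega>\<close>.\<close>
  define Z where "Z = closure \<Omega> - (\<Union>a\<in>A. ball a (s a))"
  have Z: "closed Z" "Z \<subseteq> \<Omega>"
  proof -
    show "closed Z"
      unfolding Z_def by (intro closed_Diff open_UN) auto
    show "Z \<subseteq> \<Omega>"
      using cover assms(2) by (auto simp: Z_def frontier_def interior_open)
  qed
  have \<eta>_smooth: "smooth \<eta>"
    unfolding \<eta>_def
    by (intro smooth_prod smooth_compose[OF smooth_exp_cutoff] smooth_add smooth_mult smooth_const smooth_bump)
  have \<eta>_far: "\<eta> x = \<kappa>" if "x \<notin> (\<Union>a\<in>A. ball a (2 * s a))" for x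
  proof -
    have "bump a (2 * s a) x = 0" if "a \<in> A" for a
      using that \<open>x \<notin> _\<close> A(2)[OF that] by (subst bump_eq_0_iff) auto
    then show ?thesis
      by (simp add: \<eta>_def \<kappa>_def)
  qed
  have \<eta>_near: "\<eta> x = 0" if "a \<in> A" "x \<in> ball a (s a)" for x a
  proof -
    have "m a \<le> bump a (2 * s a) x"
      unfolding m_def using that by (intro bump_ge) simp
    then have "1 + (- (1 / m a)) * bump a (2 * s a) x \<le> 0"
      using m[OF that(1)] by (simp add: field_simps)
    then show ?thesis
      unfolding \<eta>_def using A(1) that(1) exp_cutoff_eq_0_iff by (intro prod_zero) auto
  qed
  have \<eta>_le: "\<bar>\<eta> x\<bar> \<le> 1" for x
    unfolding \<eta>_def by (auto simp: abs_prod exp_cutoff_nonneg intro!: prod_le_1 exp_cutoff_le_1)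
  have "\<eta> x = \<kappa>" if "x \<notin> (\<Union>a\<in>A. cball a (2 * s a))" for x
    using that by (intro \<eta>_far) auto
  moreover have "compact (\<Union>a\<in>A. cball a (2 * s a))"
    using A(1) by (intro compact_UN) auto
  ultimately obtain K where K: "K \<ge> 0" "\<And>x i. i \<in> Basis \<Longrightarrow> \<bar>partial_deriv \<eta> i x\<bar> \<le> K"
    using partial_derivs_bounded_if_constant_outside[OF \<eta>_smooth] by metis
  define \<chi>0 where "\<chi>0 = bump (0::'a) 2"
  have \<chi>0: "smooth \<chi>0" "\<And>x. \<bar>\<chi>0 x\<bar> \<le> 1" "\<And>x. \<chi>0 x = 0 \<longleftrightarrow> x \<notin> ball 0 2"
    using bump_eq_0_iff[of 2 "0::'a"] by (auto simp: \<chi>0_def smooth_bump bump_nonneg bump_le_1)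
  have "\<chi>0 x = 0" if "x \<notin> cball 0 2" for x
    using that by (simp add: \<chi>0(3))
  then obtain K' where K': "K' \<ge> 0" "\<And>x i. i \<in> Basis \<Longrightarrow> \<bar>partial_deriv \<chi>0 i x\<bar> \<le> K'"
    using partial_derivs_bounded_if_constant_outside[of \<chi>0 "cball 0 2" 0] \<chi>0(1) by (metis compact_cball)
  \<comment> \<open>The number 3 is 2^2 - 1^2: the wide cutoff is a bump of radius 2, rescaled so
    that it is evaluated at distance at most 1 on the ball of radius \<open>n\<close>.\<close>
  have c: "\<kappa> * exp_cutoff 3 > 0"
    by (simp add: \<kappa>_def exp_cutoff_def)
  show ?thesis
  proof (rule locally_sobolevI[OF dim assms(2) cone_domain_UNIV _ c, where K = "K + K'"])
    show "- (\<Union>a\<in>A. ball a (2 * s a)) \<in> sets borel"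
      by (intro borel_closed closed_Compl open_UN) auto
    fix n :: nat
    \<comment> \<open>The successor ensures \<open>N \<ge> 1\<close>, so that rescaling by
      \<open>1 / N\<close> does not increase derivatives, also for \<open>n = 0\<close>.\<close>
    define N where "N = real (Suc n)"
    have N: "N \<ge> 1" "N > real n"
      by (auto simp: N_def)
    define cut where "cut x = \<chi>0 ((1 / N) *\<^sub>R x)" for x
    have cut_smooth: "smooth cut"
      unfolding cut_def using smooth_affine[OF \<chi>0(1), of "1 / N" 0] by simp
    have cut_deriv: "\<bar>partial_deriv cut i x\<bar> \<le> K'" if i: "i \<in> Basis" for i x
    proof -
      have "(cut has_derivative (\<lambda>h. frechet_derivative \<chi>0 (at ((1 / N) *\<^sub>R x)) ((1 / N) *\<^sub>R h))) (at x)"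
        unfolding cut_def
        by (rule has_derivative_compose[OF _ smooth_has_derivative[OF \<chi>0(1)]]) (auto intro!: derivative_eq_intros)
      then have "partial_deriv cut i x = frechet_derivative \<chi>0 (at ((1 / N) *\<^sub>R x)) ((1 / N) *\<^sub>R i)"
        by (simp add: frechet_derivative_at[symmetric])
      also have "\<dots> = (1 / N) * partial_deriv \<chi>0 i ((1 / N) *\<^sub>R x)"
        using linear_cmul[OF has_derivative_linear[OF smooth_has_derivative[OF \<chi>0(1)]]] by simp
      finally have "\<bar>partial_deriv cut i x\<bar> = (1 / N) * \<bar>partial_deriv \<chi>0 i ((1 / N) *\<^sub>R x)\<bar>"
        using N by (simp add: abs_mult)
      also have "\<dots> \<le> 1 * K'"
        using N K'(2)[OF i] by (intro mult_mono) auto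
      finally show ?thesis by simp
    qed
    show "\<exists>\<eta> Z. smooth \<eta> \<and> (\<forall>x. \<bar>\<eta> x\<bar> \<le> 1) \<and> (\<forall>i\<in>Basis. \<forall>x. \<bar>partial_deriv \<eta> i x\<bar> \<le> K + K') \<and>
      closed Z \<and> bounded Z \<and> Z \<inter> UNIV \<subseteq> \<Omega> \<and> (\<forall>x\<in>\<Omega>. \<eta> x \<noteq> 0 \<longrightarrow> x \<in> Z) \<and>
      (\<forall>x\<in>\<Omega> \<inter> - (\<Union>a\<in>A. ball a (2 * s a)) \<inter> ball 0 (real n). x \<in> UNIV \<and> \<kappa> * exp_cutoff 3 \<le> \<bar>\<eta> x\<bar>)"
    proof (intro exI[of _ "\<lambda>x. \<eta> x * cut x"] exI[of _ "Z \<inter> cball 0 (2 * N)"] conjI allI ballI impI)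
      show "smooth (\<lambda>x. \<eta> x * cut x)"
        using \<eta>_smooth cut_smooth by (rule smooth_mult)
      show "\<bar>\<eta> x * cut x\<bar> \<le> 1" for x
        using mult_mono[OF \<eta>_le[of x] \<chi>0(2)[of "(1 / N) *\<^sub>R x"]] by (simp add: abs_mult cut_def)
      show "\<bar>partial_deriv (\<lambda>x. \<eta> x * cut x) i x\<bar> \<le> K + K'" if i: "i \<in> Basis" for i x
      proof -
        have "partial_deriv (\<lambda>x. \<eta> x * cut x) i x = \<eta> x * partial_deriv cut i x + partial_deriv \<eta> i x * cut x"
          by (simp add: frechet_derivative_at[OF has_derivative_mult[OF smooth_has_derivative[OF \<eta>_smooth] smooth_has_derivative[OF cut_smooth]], symmetric])
        also have "\<bar>\<dots>\<bar> \<le> \<bar>\<eta> x\<bar> * \<bar>partial_deriv cut i x\<bar> + \<bar>partial_deriv \<eta> i x\<bar> * \<bar>cut x\<bar>"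
          by (metis abs_mult abs_triangle_ineq)
        also have "\<dots> \<le> 1 * K' + K * 1"
          using K(1) K(2)[OF i] cut_deriv[OF i] \<eta>_le \<chi>0(2)
          by (intro add_mono mult_mono) (auto simp: cut_def)
        finally show ?thesis by simp
      qed
      show "closed (Z \<inter> cball 0 (2 * N))" "bounded (Z \<inter> cball 0 (2 * N))" "Z \<inter> cball 0 (2 * N) \<inter> UNIV \<subseteq> \<Omega>"
        using Z by (auto intro: bounded_subset[OF bounded_cball])
      show "x \<in> Z \<inter> cball 0 (2 * N)" if x: "x \<in> \<Omega>" "\<eta> x * cut x \<noteq> 0" for x
      proof
        show "x \<in> Z"
          using x \<eta>_near[of _ x] closure_subset[of \<Omega>] by (auto simp: Z_def)
        have "norm ((1 / N) *\<^sub>R x) < 2"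
          using x(2) \<chi>0(3)[of "(1 / N) *\<^sub>R x"] by (auto simp: cut_def)
        then show "x \<in> cball 0 (2 * N)"
          using N by (simp add: field_simps)
      qed
      show "\<kappa> * exp_cutoff 3 \<le> \<bar>\<eta> x * cut x\<bar>" if x: "x \<in> \<Omega> \<inter> - (\<Union>a\<in>A. ball a (2 * s a)) \<inter> ball 0 (real n)" for x
      proof -
        have "dist 0 ((1 / N) *\<^sub>R x) \<le> 1"
          using x N by (simp add: field_simps)
        then have "exp_cutoff 3 \<le> cut x"
          using bump_ge[of "0::'a" "(1 / N) *\<^sub>R x" 1 2] by (simp add: cut_def \<chi>0_def)
        moreover have "\<eta> x = \<kappa>"
          using x by (intro \<eta>_far) auto
        moreover have "\<kappa> \<ge> 0"
          by (simp add: \<kappa>_def exp_cutoff_nonneg)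
        ultimately show ?thesis
          by (simp add: abs_mult mult_left_mono)
      qed
    qed auto
  qed
qed

lemma locally_sobolev_UNIV:
  fixes \<Omega> :: "'a::euclidean_space set"
  assumes dim: "DIM('a) \<ge> 2" and "open \<Omega>" "compact (frontier \<Omega>)" and lip: "lipschitz_boundary \<Omega>"
  shows "locally_sobolev \<Omega> UNIV"
proof -
  obtain r where r: "\<And>a. a \<in> frontier \<Omega> \<Longrightarrow> r a > 0 \<and> locally_sobolev \<Omega> (ball a (r a))"
  proof -
    have "\<forall>a\<in>frontier \<Omega>. \<exists>s. s > 0 \<and> locally_sobolev \<Omega> (ball a s)"
      using locally_sobolev_boundary[OF dim assms(2) lip] by blast
    then show thesis
      using that by metis
  qed
  \<comment> \<open>Halving the radii leaves room for the interior cutoff, which vanishes on the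
    balls of radius \<open>r a / 2\<close> and is constant outside those of radius
    \<open>r a\<close>.\<close>
  have "frontier \<Omega> \<subseteq> (\<Union>a\<in>frontier \<Omega>. ball a (r a / 2))"
    using r by force
  then obtain A where A: "A \<subseteq> frontier \<Omega>" "finite A" "frontier \<Omega> \<subseteq> (\<Union>a\<in>A. ball a (r a / 2))"
    using compactE_image[OF assms(3), of "frontier \<Omega>" "\<lambda>a. ball a (r a / 2)"] by (metis open_ball)
  have "locally_sobolev \<Omega> (- (\<Union>a\<in>A. ball a (2 * (r a / 2))))"
    using A r by (intro locally_sobolev_interior dim assms(2)) auto
  moreover have "locally_sobolev \<Omega> (\<Union>a\<in>A. ball a (r a))"
    using A r by (intro locally_sobolev_UN) auto
  ultimately have "locally_sobolev \<Omega> (- (\<Union>a\<in>A. ball a (r a)) \<union> (\<Union>a\<in>A. ball a (r a)))"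
    by (intro locally_sobolev_Un) simp_all
  then show ?thesis
    by (simp only: Compl_partition2)
qed

section \<open>Functions of bounded variation\<close>

text \<open>A non-integrable \<open>\<phi>\<close> has integral 0 by convention, so the bound holds
  in this case too.\<close>

lemma integral_abs_le_mult_emeasure:
  fixes \<phi> :: "'a \<Rightarrow> real"
  assumes "\<And>x. \<bar>\<phi> x\<bar> \<le> K" "emeasure P (space P) \<le> ennreal \<tau>" "\<tau> \<ge> 0"
  shows "\<bar>integral\<^sup>L P \<phi>\<bar> \<le> K * \<tau>"
proof (cases "integrable P \<phi>")
  case True
  have K: "K \<ge> 0"
    using assms(1) abs_ge_zero order_trans by blast
  have "ennreal \<bar>integral\<^sup>L P \<phi>\<bar> \<le> (\<integral>\<^sup>+x. ennreal \<bar>\<phi> x\<bar> \<partial>P)"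
    using integral_norm_bound_ennreal[OF True] by simp
  also have "\<dots> \<le> (\<integral>\<^sup>+x. ennreal K \<partial>P)"
    using assms(1) by (intro nn_integral_mono ennreal_leI)
  also have "\<dots> \<le> ennreal K * ennreal \<tau>"
    using assms(2) by (simp add: mult_left_mono)
  also have "\<dots> = ennreal (K * \<tau>)"
    using K assms(3) by (simp add: ennreal_mult)
  finally show ?thesis
    using K assms(3) by (simp add: ennreal_le_iff)
next
  case False
  have "K \<ge> 0"
    using assms(1) abs_ge_zero order_trans by blast
  then show ?thesis
    using False assms(3) by (simp add: not_integrable_integral_eq)
qed

lemma norm_le_total_variation:
  assumes "E \<in> sets M"
  shows "ennreal (norm (\<mu> E)) \<le> total_variation M \<mu> E"
proof -
  \<comment> \<open>\<open>E\<close> is partitioned into itself and empty sets, and only the first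
    term of the series is kept.\<close>
  define A where "A = (\<lambda>n::nat. if n = 0 then E else {})"
  have "range A \<subseteq> sets M \<and> disjoint_family A \<and> (\<Union>n. A n) = E"
    using assms by (auto simp: A_def disjoint_family_on_def)
  then have "(\<Sum>n. ennreal (norm (\<mu> (A n)))) \<le> total_variation M \<mu> E"
    unfolding total_variation_def by (intro SUP_upper) simp
  moreover have "sum (\<lambda>n. ennreal (norm (\<mu> (A n)))) {0} \<le> (\<Sum>n. ennreal (norm (\<mu> (A n))))"
    by (intro sum_le_suminf) auto
  ultimately show ?thesis
    by (simp add: A_def)
qed

lemma total_variation_inner_le:
  fixes \<mu> :: "'a set \<Rightarrow> 'b::euclidean_space"
  assumes "i \<in> Basis"
  shows "total_variation M (\<lambda>E. \<mu> E \<bullet> i) E \<le> total_variation M \<mu> E"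
  unfolding total_variation_def
  using Basis_le_norm[OF assms] by (intro SUP_mono') (auto intro!: suminf_le ennreal_leI)

text \<open>If the set function in the definition of \<^const>\<open>positive_part\<close> or \<^const>\<open>negative_part\<close> were not
  a measure, \<^const>\<open>measure_of\<close> would return the zero measure; the bound below holds in any case.\<close>

lemma emeasure_jordan_parts_le:
  assumes fin: "total_variation M \<nu> (space M) < \<infinity>"
  shows "emeasure (positive_part M \<nu>) (space (positive_part M \<nu>)) \<le> total_variation M \<nu> (space M)"
    and "emeasure (negative_part M \<nu>) (space (negative_part M \<nu>)) \<le> total_variation M \<nu> (space M)"
proof -
  let ?t = "enn2real (total_variation M \<nu> (space M))"
  have t: "total_variation M \<nu> (space M) = ennreal ?t"
    using fin by (simp add: less_top)
  have "ennreal \<bar>\<nu> (space M)\<bar> \<le> ennreal ?t"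
    using norm_le_total_variation[of "space M" M \<nu>] unfolding t[symmetric] by simp
  then have "\<bar>\<nu> (space M)\<bar> \<le> ?t"
    by (simp add: ennreal_le_iff)
  then have "ennreal ((?t + \<nu> (space M)) / 2) \<le> ennreal ?t" "ennreal ((?t - \<nu> (space M)) / 2) \<le> ennreal ?t"
    by (auto intro!: ennreal_leI)
  then show "emeasure (positive_part M \<nu>) (space (positive_part M \<nu>)) \<le> total_variation M \<nu> (space M)"
    "emeasure (negative_part M \<nu>) (space (negative_part M \<nu>)) \<le> total_variation M \<nu> (space M)"
    unfolding positive_part_def negative_part_def emeasure_measure_of_conv space_measure_of_conv t[symmetric]
    by auto
qed

text \<open>Each Jordan part is bounded separately by the whole total variation, hence the factor
  2.\<close>

lemma signed_integral_le:
  assumes "\<And>x. \<bar>\<phi> x\<bar> \<le> K" "total_variation M \<nu> (space M) \<le> ennreal \<tau>" "\<tau> \<ge> 0"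
  shows "\<bar>signed_integral M \<nu> \<phi>\<bar> \<le> 2 * \<tau> * K"
proof -
  have fin: "total_variation M \<nu> (space M) < \<infinity>"
    by (rule le_less_trans[OF assms(2)]) simp
  have "\<bar>integral\<^sup>L (positive_part M \<nu>) \<phi>\<bar> \<le> K * \<tau>" "\<bar>integral\<^sup>L (negative_part M \<nu>) \<phi>\<bar> \<le> K * \<tau>"
    using emeasure_jordan_parts_le[OF fin, THEN order_trans, OF assms(2)]
    by (auto intro!: integral_abs_le_mult_emeasure assms(1,3))
  then show ?thesis
    unfolding signed_integral_def by (simp add: mult_ac)
qed

text \<open>Passes from a function that is Lebesgue measurable on \<open>\<Omega>\<close> to a Borel
  function on the whole space, the setting of the preceding inequalities. The factor 2 stems from
  the two Jordan parts.\<close>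

lemma BV_borel_representative:
  fixes \<Omega> :: "'a::euclidean_space set"
  assumes "open \<Omega>" and u: "u \<in> BV \<Omega>" and fin: "gradient_variation \<Omega> u \<Omega> < \<infinity>"
  obtains U where "integrable lborel U" "\<And>x. x \<notin> \<Omega> \<Longrightarrow> U x = 0"
    "weak_gradient_bound \<Omega> U (2 * enn2real (gradient_variation \<Omega> u \<Omega>))"
    "AE x in lebesgue. (if x \<in> \<Omega> then u x else 0) = U x"
proof -
  define \<mu> where "\<mu> = distributional_gradient \<Omega> u"
  define \<tau> where "\<tau> = enn2real (gradient_variation \<Omega> u \<Omega>)"
  have \<tau>: "total_variation (restrict_space borel \<Omega>) \<mu> \<Omega> = ennreal \<tau>"
    using fin by (simp add: gradient_variation_def \<mu>_def \<tau>_def less_top)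
  have \<Omega>: "\<Omega> \<in> sets lebesgue" "\<Omega> \<in> sets borel"
    using assms(1) by auto
  have int: "integrable (lebesgue_on \<Omega>) u" and ex: "\<exists>\<mu>. is_distributional_gradient \<Omega> u \<mu>"
    using u by (auto simp: BV_def)
  have "is_distributional_gradient \<Omega> u \<mu>"
    unfolding \<mu>_def distributional_gradient_def using ex by (rule someI_ex)
  then have grad: "(\<integral>x. u x * partial_deriv \<phi> i x \<partial>lebesgue_on \<Omega>) =
      - signed_integral (restrict_space borel \<Omega>) (\<lambda>E. \<mu> E \<bullet> i) \<phi>"
    if "\<phi> \<in> test_functions \<Omega>" "i \<in> Basis" for \<phi> i
    using that by (auto simp: is_distributional_gradient_def)
  let ?u = "\<lambda>x. if x \<in> \<Omega> then u x else 0"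
  have restrict: "(\<lambda>x. indicator \<Omega> x * v x) = (\<lambda>x. if x \<in> \<Omega> then v x else 0)" for v :: "'a \<Rightarrow> real"
    by (auto simp: indicator_def)
  have int_u: "integrable lebesgue ?u"
    using int \<Omega>(1) by (simp add: integrable_restrict_space restrict)
  obtain U' where U': "U' \<in> borel_measurable lborel" "AE x in lborel. ?u x = U' x"
    using completion_ex_borel_measurable_real[OF borel_measurable_integrable[OF int_u]] by blast
  \<comment> \<open>The Borel version agrees with the extension of \<open>u\<close> by zero only
    almost everywhere; the indicator makes it vanish at every point outside
    \<open>\<Omega>\<close>.\<close>
  define U where "U x = indicator \<Omega> x * U' x" for x
  have U_meas [measurable]: "U \<in> borel_measurable borel"
    using U'(1) \<Omega>(2) unfolding U_def by measurable
  have AE_lborel: "AE x in lborel. ?u x = U x"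
    using U'(2) by eventually_elim (auto simp: U_def indicator_def split: if_splits)
  then have AE: "AE x in lebesgue. ?u x = U x"
    by (rule AE_completion)
  have "integrable lebesgue U"
    by (rule integrable_cong_AE_imp[OF int_u _ AE]) (simp add: measurable_completion)
  then have int_U: "integrable lborel U"
    by (simp add: integrable_completion)
  have "weak_gradient_bound \<Omega> U (2 * \<tau>)"
    unfolding weak_gradient_bound_def
  proof (intro ballI allI impI)
    fix \<phi> i M assume \<phi>: "\<phi> \<in> test_functions \<Omega>" and i: "i \<in> (Basis::'a set)" and M: "\<forall>x. \<bar>\<phi> x\<bar> \<le> M"
    have [measurable]: "partial_deriv \<phi> i \<in> borel_measurable borel"
      using smooth_partial_deriv[OF test_functionsD(1)[OF \<phi>] i]
      by (intro borel_measurable_continuous_onI smooth_continuous_on)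
    have "(\<integral>x. U x * partial_deriv \<phi> i x \<partial>lborel) = (\<integral>x. U x * partial_deriv \<phi> i x \<partial>lebesgue)"
      by (rule integral_completion[symmetric]) measurable
    also have "\<dots> = (\<integral>x. (if x \<in> \<Omega> then u x * partial_deriv \<phi> i x else 0) \<partial>lebesgue)"
    proof (rule integral_cong_AE)
      show "(\<lambda>x. if x \<in> \<Omega> then u x * partial_deriv \<phi> i x else 0) \<in> borel_measurable lebesgue"
      proof -
        have "(\<lambda>x. ?u x * partial_deriv \<phi> i x) \<in> borel_measurable lebesgue"
          using int_u by (intro borel_measurable_times) (auto simp: measurable_completion)
        then show ?thesis
          by (rule back_subst[where P = "\<lambda>f. f \<in> _"]) auto
      qed
      show "AE x in lebesgue. U x * partial_deriv \<phi> i x = (if x \<in> \<Omega> then u x * partial_deriv \<phi> i x else 0)"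
        using AE by eventually_elim (auto split: if_splits)
    qed (simp add: measurable_completion)
    also have "\<dots> = (\<integral>x. u x * partial_deriv \<phi> i x \<partial>lebesgue_on \<Omega>)"
      using \<Omega>(1) by (subst integral_restrict_space) (simp_all add: restrict)
    also have "\<dots> = - signed_integral (restrict_space borel \<Omega>) (\<lambda>E. \<mu> E \<bullet> i) \<phi>"
      by (rule grad[OF \<phi> i])
    finally have "\<bar>\<integral>x. U x * partial_deriv \<phi> i x \<partial>lborel\<bar> = \<bar>signed_integral (restrict_space borel \<Omega>) (\<lambda>E. \<mu> E \<bullet> i) \<phi>\<bar>"
      by simp
    also have "\<dots> \<le> 2 * \<tau> * M"
      using total_variation_inner_le[OF i, of "restrict_space borel \<Omega>" \<mu> \<Omega>] M
      by (intro signed_integral_le) (auto simp: space_restrict_space \<tau> \<tau>_def)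
    finally show "\<bar>\<integral>x. U x * partial_deriv \<phi> i x \<partial>lborel\<bar> \<le> 2 * \<tau> * M" .
  qed
  then show thesis
    using that[of U] int_U AE by (simp add: U_def \<tau>_def)
qed

lemma nn_integral_lebesgue_on_representative:
  assumes "\<Omega> \<in> sets lebesgue" "AE x in lebesgue. (if x \<in> \<Omega> then u x else 0) = U x" "U \<in> borel_measurable lborel"
  shows "(\<integral>\<^sup>+x. ennreal (\<bar>u x\<bar> powr p) \<partial>lebesgue_on \<Omega>) = (\<integral>\<^sup>+x. ennreal (\<bar>U x\<bar> powr p) \<partial>lborel)"
proof -
  have "(\<integral>\<^sup>+x. ennreal (\<bar>u x\<bar> powr p) \<partial>lebesgue_on \<Omega>) = (\<integral>\<^sup>+x. ennreal (\<bar>u x\<bar> powr p) * indicator \<Omega> x \<partial>lebesgue)"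
    using assms(1) by (intro nn_integral_restrict_space) simp
  also have "\<dots> = (\<integral>\<^sup>+x. ennreal (\<bar>U x\<bar> powr p) \<partial>lebesgue)"
    by (rule nn_integral_cong_AE, use assms(2) in eventually_elim) (auto simp: indicator_def split: if_splits)
  also have "\<dots> = (\<integral>\<^sup>+x. ennreal (\<bar>U x\<bar> powr p) \<partial>lborel)"
    by (simp add: nn_integral_completion)
  finally show ?thesis .
qed

theorem corollary1p4:
  fixes \<Omega> :: "'a::euclidean_space set"
  assumes "DIM('a) \<ge> 2"
    and "open \<Omega>"
    and "compact (frontier \<Omega>)"
    and "lipschitz_boundary \<Omega>"
  shows "\<exists>C::real. C > 0 \<and> (\<forall>u\<in>BV \<Omega>.
           Lp_norm (real DIM('a) / (real DIM('a) - 1)) \<Omega> u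
             \<le> ennreal C * (gradient_variation \<Omega> u \<Omega> + Lp_norm 1 \<Omega> u))"
proof -
  let ?q = "sobolev_exponent TYPE('a)"
  have q: "?q > 0"
    using assms(1) by simp
  obtain C where C: "C \<ge> 0" and sobolev: "\<And>U V. integrable lborel U \<Longrightarrow> (\<forall>x. x \<notin> \<Omega> \<longrightarrow> U x = 0) \<Longrightarrow>
      weak_gradient_bound \<Omega> U V \<Longrightarrow>
      (\<integral>\<^sup>+x. ennreal (\<bar>U x\<bar> powr ?q) \<partial>lborel) \<le> ennreal (C * (V + (\<integral>x. \<bar>U x\<bar> \<partial>lborel)) powr ?q)"
    using locally_sobolev_UNIV[OF assms] unfolding locally_sobolev_def by auto
  \<comment> \<open>The factor 2 absorbs the one in the gradient bound \<open>2 * \<tau>\<close>;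
    adding 1 keeps the constant positive when \<open>C = 0\<close>.\<close>
  let ?K = "2 * C powr (1 / ?q) + 1"
  have K: "?K > 0"
    by (simp add: add_nonneg_pos)
  have "Lp_norm ?q \<Omega> u \<le> ennreal ?K * (gradient_variation \<Omega> u \<Omega> + Lp_norm 1 \<Omega> u)" if u: "u \<in> BV \<Omega>" for u
  proof (cases "gradient_variation \<Omega> u \<Omega> < \<infinity>")
    case False
    \<comment> \<open>Infinite variation makes the right-hand side infinite, since \<open>?K\<close>
      is positive.\<close>
    then have "gradient_variation \<Omega> u \<Omega> = \<infinity>"
      by (metis infinity_ennreal_def top.not_eq_extremum)
    then show ?thesis
      using K by (simp add: ennreal_mult_top)
  next
    case True
    define \<tau> where "\<tau> = enn2real (gradient_variation \<Omega> u \<Omega>)"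
    have \<tau>: "gradient_variation \<Omega> u \<Omega> = ennreal \<tau>" "\<tau> \<ge> 0"
      using True by (auto simp: \<tau>_def less_top)
    obtain U where U: "integrable lborel U" "\<And>x. x \<notin> \<Omega> \<Longrightarrow> U x = 0" "weak_gradient_bound \<Omega> U (2 * \<tau>)"
      "AE x in lebesgue. (if x \<in> \<Omega> then u x else 0) = U x"
      using BV_borel_representative[OF assms(2) u True] unfolding \<tau>_def by blast
    note rep = nn_integral_lebesgue_on_representative[OF _ U(4)]
    have \<Omega>: "\<Omega> \<in> sets lebesgue" and [measurable]: "U \<in> borel_measurable borel"
      using assms(2) U(1) by auto
    define N where "N = (\<integral>x. \<bar>U x\<bar> \<partial>lborel)"
    have N: "N \<ge> 0"
      by (simp add: N_def)
    have "(\<integral>\<^sup>+x. ennreal (\<bar>u x\<bar> powr 1) \<partial>lebesgue_on \<Omega>) = ennreal N"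
      using U(1) by (subst rep[OF \<Omega>]) (simp_all add: nn_integral_eq_integral N_def)
    then have norm1: "Lp_norm 1 \<Omega> u = ennreal N"
      using N by (simp add: Lp_norm_def)
    define I where "I = (\<integral>\<^sup>+x. ennreal (\<bar>u x\<bar> powr ?q) \<partial>lebesgue_on \<Omega>)"
    have I: "I \<le> ennreal (C * (2 * \<tau> + N) powr ?q)"
      unfolding I_def N_def using sobolev[OF U(1) _ U(3)] U(2) by (subst rep[OF \<Omega>]) auto
    then have "enn2real I \<le> C * (2 * \<tau> + N) powr ?q"
      using C by (intro enn2real_leI) auto
    then have "enn2real I powr (1 / ?q) \<le> (C * (2 * \<tau> + N) powr ?q) powr (1 / ?q)"
      using q by (intro powr_mono2) auto
    also have "\<dots> = C powr (1 / ?q) * (2 * \<tau> + N)"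
      using assms(1) \<tau>(2) N by (simp add: powr_mult powr_powr)
    also have "\<dots> \<le> ?K * (\<tau> + N)"
    proof -
      have "C powr (1 / ?q) * (2 * \<tau> + N) \<le> C powr (1 / ?q) * (2 * (\<tau> + N))"
        using N by (intro mult_left_mono) auto
      then show ?thesis
        using N \<tau>(2) by (simp add: algebra_simps)
    qed
    finally have "ennreal (enn2real I powr (1 / ?q)) \<le> ennreal (?K * (\<tau> + N))"
      by (rule ennreal_leI)
    moreover have "I \<noteq> \<infinity>"
      using I by (auto simp: top_unique)
    ultimately have "Lp_norm ?q \<Omega> u \<le> ennreal (?K * (\<tau> + N))"
      by (simp add: Lp_norm_def I_def[symmetric])
    also have "\<dots> = ennreal ?K * (gradient_variation \<Omega> u \<Omega> + Lp_norm 1 \<Omega> u)"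
      unfolding \<tau>(1) norm1 using N \<tau>(2) K by (simp only: ennreal_mult ennreal_plus less_imp_le add_nonneg_nonneg)
    finally show ?thesis .
  qed
  then show ?thesis
    using K by blast
qed

end
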